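(* Let $A\in\mathbb{C}^{n\times n}$ and $1\le k\le (n+1)/2$, and suppose that $O_k(A)$ is not contained in a plane through the origin in $\mathbb{R}^3$. Then $\dim(\Lambda_k(A))\in\{0,1\}$ if and only if $(0,0,0)$ belongs to the relative interior of a face $F$ of $\operatorname{conv}(O_k(A))$ with $1\le\dim(F)\le2$. Moreover, in this case: (i) if $\dim(F)=1$, then $F$ is the convex hull of two antipodal points on $O_k(A)$; (ii) if $\dim(F)=2$ and $F\subseteq\{(t,x,y):t+ax+by=0\}$ for some $a,b\in\mathbb{R}$, then $\Lambda_k(A)=\{a+ib\}$.
   Context: For $A\in\mathbb{C}^{n\times n}$ put $\Re(A)=\frac12(A+A^* )$ and $\Im(A)=\frac{1}{2i}(A-A^* )$. For a Hermitian $n\times n$ matrix $M$, $\lambda_1(M)\ge\dots\ge\lambda_n(M)$ are its eigenvalues with multiplicity, and $\lambda_k(\theta)=\lambda_k(\cos(\theta)\Re(A)+\sin(\theta)\Im(A))$ for $\theta\in\mathbb{R}$. The rank-$k$ numerical range is $\Lambda_k(A)=\{\mu\in\mathbb{C}: \exists X\in\mathbb{C}^{n\times k} \text{ with } X^*X=I_k,\ X^*AX=\mu I_k\}$, a convex compact subset of $\mathbb{C}\cong\mathbb{R}^2$. Let $O_k(A)=\{(\lambda_k(\theta),-\cos\theta,-\sin\theta):\theta\in[0,2\pi)\}\subset\mathbb{R}^3$. The dimension of a convex set is the (real) dimension of its affine hull, with $\dim\emptyset=-1$. A face of a convex set $S$ is a convex subset $F\subseteq S$ such that whenever a point of $F$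 equals $\lambda u+(1-\lambda)v$ with $u,v\in S$ and $\lambda\in(0,1)$, then $u,v\in F$. Antipodal points of $O_k(A)$: the points $(\lambda_k(\theta),-\cos\theta,-\sin\theta)$ and $(\lambda_k(\theta+\pi),-\cos(\theta+\pi),-\sin(\theta+\pi))$ are antipodal points of $O_k(A)$ when $\lambda_k(\theta)=\lambda_{n-k+1}(\theta)$; in that case they are negatives of each other. *)

theory Defs
  imports
    "HOL-Analysis.Analysis"
    "Jordan_Normal_Form.Schur_Decomposition"
begin

definition re_mat :: "complex mat \<Rightarrow> complex mat" where
  "re_mat A = (1 / 2) \<cdot>\<^sub>m (A + mat_adjoint A)"

definition im_mat :: "complex mat \<Rightarrow> complex mat" where
  "im_mat A = (1 / (2 * \<i>)) \<cdot>\<^sub>m (A - mat_adjoint A)"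

text \<open>
  \<open>nth_eigenvalue M k\<close> is \<open>\<lambda>\<^sub>k(M)\<close>, indexed from 1, for Hermitian \<open>M\<close>: the roots of the
  characteristic polynomial with multiplicity are then real, and \<open>Re\<close> only changes their type.
  The value has no meaning for other matrices, or for \<open>k\<close> outside \<open>{1..dim_row M}\<close>.
\<close>

definition nth_eigenvalue :: "complex mat \<Rightarrow> nat \<Rightarrow> real" where
  "nth_eigenvalue M k =
     rev (sorted_list_of_multiset (image_mset Re (proots (char_poly M)))) ! (k - 1)"

definition eig_fun :: "nat \<Rightarrow> complex mat \<Rightarrow> real \<Rightarrow> real" where
  "eig_fun k A \<theta> =
     nth_eigenvalue (complex_of_real (cos \<theta>) \<cdot>\<^sub>m re_mat A + complex_of_real (sin \<theta>) \<cdot>\<^sub>m im_mat A) k"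

definition rank_num_range :: "nat \<Rightarrow> complex mat \<Rightarrow> complex set" where
  "rank_num_range k A =
     {\<mu>. \<exists>X \<in> carrier_mat (dim_row A) k.
        mat_adjoint X * X = 1\<^sub>m k \<and> mat_adjoint X * A * X = \<mu> \<cdot>\<^sub>m 1\<^sub>m k}"

definition O_point :: "nat \<Rightarrow> complex mat \<Rightarrow> real \<Rightarrow> real \<times> real \<times> real" where
  "O_point k A \<theta> = (eig_fun k A \<theta>, - cos \<theta>, - sin \<theta>)"

definition O_set :: "nat \<Rightarrow> complex mat \<Rightarrow> (real \<times> real \<times> real) set" where
  "O_set k A = O_point k A ` {0..<2 * pi}"

definition antipodal_points ::
  "nat \<Rightarrow> complex mat \<Rightarrow> real \<times> real \<times> real \<Rightarrow> real \<times> real \<times> real \<Rightarrow> bool" where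
  "antipodal_points k A p q \<longleftrightarrow>
     (\<exists>\<theta>. eig_fun k A \<theta> = eig_fun (dim_row A - k + 1) A \<theta> \<and>
          p = O_point k A \<theta> \<and> q = O_point k A (\<theta> + pi))"

end

theory Submission
  imports
    Defs
    "Jordan_Normal_Form.Spectral_Radius"
begin

text \<open>
  The analytic input is the theorem of Li and Sze: \<open>\<Lambda>\<^sub>k(A)\<close> is the intersection of the half-planes
  \<open>x cos \<theta> + y sin \<theta> \<le> \<lambda>\<^sub>k(\<theta>)\<close>. After a shift it says that \<open>A\<close> has a \<open>k\<close>-dimensional isotropic subspace
  if the real part of every \<open>z A\<close> with \<open>\<bar>z\<bar> = 1\<close> is nonnegative on some \<open>k\<close>-dimensional subspace, and this
  is proved by induction on \<open>n\<close>. If \<open>v\<close> is isotropic and \<open>A v\<close>, \<open>A\<^sup>* v\<close> are parallel, the condition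
  passes to the hyperplane orthogonal to \<open>A v\<close>. Such a \<open>v\<close> exists if \<open>\<lambda>\<^sub>k\<close> of some real part vanishes
  (in the kernel of that real part) or if \<open>n = 2 k\<close> (as an eigenvector of the pencil \<open>A - w A\<^sup>*\<close>).
  Otherwise shift \<open>A\<close> along the real axis in both directions until \<open>\<lambda>\<^sub>k\<close> of a real part vanishes; the two isotropic
  subspaces found there span a \<open>2 k\<close>-dimensional space on which the condition still holds.

  The rest is convex duality: \<open>(a, b) \<in> \<Lambda>\<^sub>k(A)\<close> means that \<open>(1, a, b)\<close> is nonnegative on \<open>conv(O\<^sub>k(A))\<close>,
  and \<open>\<lambda>\<^sub>k(\<theta>) + \<lambda>\<^sub>k(\<theta> + \<pi>) \<ge> 0\<close> forces every supporting functional at the origin to have a positive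
  first coefficient. So both sides of the equivalence say that the origin is in the boundary of the hull.
\<close>

no_notation inner (infix "\<bullet>" 70)
no_notation vec_nth (infixl "$" 90)

section \<open>Sesquilinear forms of complex matrices\<close>

text \<open>Parallelism of \<open>A v\<close> and of the adjoint applied to \<open>v\<close> makes
  the induction uniform in the direction \<open>z\<close>: adding a multiple of an isotropic
  \<open>v\<close> to \<open>x\<close> changes the real part of \<open>z\<close> times the form only
  through the inner products of \<open>x\<close> with these two vectors. If they are parallel and
  not both zero, a single hyperplane kills both cross terms for all \<open>z\<close> at once, and it
  contains \<open>v\<close>, so \<open>v\<close> can refill the dimension that a nonnegative
  subspace loses in the cut. Hence \<open>n\<close> drops while \<open>k\<close> stays. Two shifts
  help only for \<open>2 k < n\<close>: for \<open>n = 2 k\<close> the two isotropic subspaces would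
  span the whole space and nothing would become smaller. That case has to find its vector
  algebraically. Eigenvalues enter as roots of a characteristic polynomial, so everything about
  subspaces has to pass through a spectral theorem and a max-min characterization. In the geometric
  part, \<open>2 k \<le> n + 1\<close> gives \<open>k \<le> n - k + 1\<close>, which is the source
  of the nonnegative antipodal sums.\<close>

lemma mat_adjoint_carrier[simp]: "A \<in> carrier_mat n m \<Longrightarrow> mat_adjoint A \<in> carrier_mat m n"
  unfolding mat_adjoint_def by auto

lemma index_mat_adjoint[simp]:
  "i < dim_col A \<Longrightarrow> j < dim_row A \<Longrightarrow> mat_adjoint A $$ (i, j) = conjugate (A $$ (j, i))"
  unfolding mat_adjoint_def mat_of_rows_def by (simp add: cols_def)

lemma dim_mat_adjoint[simp]:
  "dim_row (mat_adjoint A) = dim_col A" "dim_col (mat_adjoint A) = dim_row A"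
  unfolding mat_adjoint_def by auto

lemma mat_adjoint_adjoint[simp]: "mat_adjoint (mat_adjoint A) = A"
  by (rule eq_matI) auto

lemma cscalar_prod_mult_mat_vec:
  fixes A :: "complex mat"
  assumes "A \<in> carrier_mat n m" "x \<in> carrier_vec m" "y \<in> carrier_vec n"
  shows "(A *\<^sub>v x) \<bullet>c y = x \<bullet>c (mat_adjoint A *\<^sub>v y)"
proof -
  have "(A *\<^sub>v x) \<bullet>c y = (\<Sum>i<n. \<Sum>j<m. A $$ (i,j) * x $ j * cnj (y $ i))"
    using assms by (auto simp: scalar_prod_def sum_distrib_right atLeast0LessThan intro!: sum.cong)
  also have "\<dots> = (\<Sum>j<m. \<Sum>i<n. A $$ (i,j) * x $ j * cnj (y $ i))"
    by (rule sum.swap)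
  also have "\<dots> = x \<bullet>c (mat_adjoint A *\<^sub>v y)"
    using assms by (auto simp: scalar_prod_def sum_distrib_left atLeast0LessThan mult_ac intro!: sum.cong)
  finally show ?thesis .
qed

definition sesq :: "complex mat \<Rightarrow> complex vec \<Rightarrow> complex vec \<Rightarrow> complex" where
  "sesq A x y = (A *\<^sub>v x) \<bullet>c y"

context
  fixes A :: "complex mat" and n :: nat
  assumes A: "A \<in> carrier_mat n n"
begin

lemma sesq_add_left:
  "x \<in> carrier_vec n \<Longrightarrow> y \<in> carrier_vec n \<Longrightarrow> w \<in> carrier_vec n \<Longrightarrow>
    sesq A (x + y) w = sesq A x w + sesq A y w"
  unfolding sesq_def using A
  by (simp add: mult_add_distrib_mat_vec[of A n n] add_scalar_prod_distrib[of _ n])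

lemma sesq_smult_left:
  "x \<in> carrier_vec n \<Longrightarrow> w \<in> carrier_vec n \<Longrightarrow> sesq A (c \<cdot>\<^sub>v x) w = c * sesq A x w"
  unfolding sesq_def using A
  by (simp add: mult_mat_vec[of A n n])

lemma sesq_add_right:
  "x \<in> carrier_vec n \<Longrightarrow> y \<in> carrier_vec n \<Longrightarrow> w \<in> carrier_vec n \<Longrightarrow>
    sesq A w (x + y) = sesq A w x + sesq A w y"
  unfolding sesq_def using A
  by (simp add: conjugate_add_vec[of _ n] scalar_prod_add_distrib[of _ n])

lemma sesq_smult_right:
  "x \<in> carrier_vec n \<Longrightarrow> w \<in> carrier_vec n \<Longrightarrow> sesq A w (c \<cdot>\<^sub>v x) = cnj c * sesq A w x"
  unfolding sesq_def using A
  by (simp add: conjugate_smult_vec)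

lemmas sesq_simps = sesq_add_left sesq_smult_left sesq_add_right sesq_smult_right

lemma sesq_smult_mat:
  "x \<in> carrier_vec n \<Longrightarrow> w \<in> carrier_vec n \<Longrightarrow> sesq (c \<cdot>\<^sub>m A) x w = c * sesq A x w"
proof -
  assume "x \<in> carrier_vec n" "w \<in> carrier_vec n"
  moreover have "(c \<cdot>\<^sub>m A) *\<^sub>v x = c \<cdot>\<^sub>v (A *\<^sub>v x)"
    by (rule eq_vecI) (use A \<open>x \<in> carrier_vec n\<close> in \<open>auto simp: smult_scalar_prod_distrib[of _ n]\<close>)
  ultimately show ?thesis using A by (simp add: sesq_def)
qed

lemma sesq_add_mat:
  "B \<in> carrier_mat n n \<Longrightarrow> x \<in> carrier_vec n \<Longrightarrow> w \<in> carrier_vec n \<Longrightarrow>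
    sesq (A + B) x w = sesq A x w + sesq B x w"
  using A by (simp add: sesq_def add_mult_distrib_mat_vec[of A n n] add_scalar_prod_distrib[of _ n])

lemma sesq_minus_mat:
  "B \<in> carrier_mat n n \<Longrightarrow> x \<in> carrier_vec n \<Longrightarrow> w \<in> carrier_vec n \<Longrightarrow>
    sesq (A - B) x w = sesq A x w - sesq B x w"
  using A by (simp add: sesq_def minus_mult_distrib_mat_vec[of A n n] minus_scalar_prod_distrib[of _ n])

lemma sesq_mat_adjoint:
  assumes x: "x \<in> carrier_vec n" and y: "y \<in> carrier_vec n"
  shows "sesq (mat_adjoint A) x y = cnj (sesq A y x)"
proof -
  have "sesq (mat_adjoint A) x y = x \<bullet>c (A *\<^sub>v y)"
    unfolding sesq_def using cscalar_prod_mult_mat_vec[of "mat_adjoint A" n n x y] A x y by simp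
  also have "\<dots> = cnj ((A *\<^sub>v y) \<bullet>c x)"
    using conjugate_conjugate_sprod[of "A *\<^sub>v y" n x] A x y
    by (metis conjugate_vec_sprod_comm conjugate_complex_def complex_cnj_cnj mult_mat_vec_carrier)
  finally show ?thesis by (simp add: sesq_def)
qed

text \<open>Restricting a form to the range of \<open>Y\<close> gives the form of a smaller square
  matrix, so the induction on the size never leaves matrices.\<close>

lemma sesq_congruence:
  assumes Y: "Y \<in> carrier_mat n m" and x: "x \<in> carrier_vec m" and y: "y \<in> carrier_vec m"
  shows "sesq (mat_adjoint Y * A * Y) x y = sesq A (Y *\<^sub>v x) (Y *\<^sub>v y)"
proof -
  have "(mat_adjoint Y * A * Y) *\<^sub>v x = mat_adjoint Y *\<^sub>v (A *\<^sub>v (Y *\<^sub>v x))"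
    using assms A assoc_mult_mat_vec[of "mat_adjoint Y * A" m n Y m x]
      assoc_mult_mat_vec[of "mat_adjoint Y" m n A n "Y *\<^sub>v x"]
    by (metis mat_adjoint_carrier mult_carrier_mat mult_mat_vec_carrier)
  then show ?thesis
    unfolding sesq_def
    using cscalar_prod_mult_mat_vec[of "mat_adjoint Y" m n "A *\<^sub>v (Y *\<^sub>v x)" y] assms A by simp
qed

end

lemma sesq_one: "x \<in> carrier_vec n \<Longrightarrow> sesq (1\<^sub>m n) x y = x \<bullet>c y"
  by (simp add: sesq_def)

lemma cscalar_prod_self:
  "x \<in> carrier_vec n \<Longrightarrow> x \<bullet>c (x :: complex vec) = of_real (\<Sum>i<n. (cmod (x $ i))\<^sup>2)"
  by (simp add: scalar_prod_def complex_norm_square[symmetric] atLeast0LessThan)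

text \<open>The squared norm as a real number: bounds on Rayleigh quotients can then be written as
  inequalities without division.\<close>

definition nrm2 :: "complex vec \<Rightarrow> real" where
  "nrm2 x = Re (x \<bullet>c x)"

lemma nrm2_eq: "x \<in> carrier_vec n \<Longrightarrow> nrm2 x = (\<Sum>i<n. (cmod (x $ i))\<^sup>2)"
  by (simp add: nrm2_def cscalar_prod_self)

lemma cscalar_prod_nrm2: "x \<bullet>c x = of_real (nrm2 x)"
  using cscalar_prod_self[of x "dim_vec x"] by (simp add: nrm2_def)

lemma nrm2_pos_iff: "x \<in> carrier_vec n \<Longrightarrow> nrm2 x > 0 \<longleftrightarrow> x \<noteq> 0\<^sub>v n"
  by (metis conjugate_square_eq_0_vec cscalar_prod_nrm2 nrm2_eq of_real_eq_0_iff
      order_less_le sum_nonneg zero_le_power2)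

lemma nrm2_nonneg: "nrm2 x \<ge> 0"
  using nrm2_eq[of x "dim_vec x"] by (simp add: sum_nonneg)

lemma mult_zero_vec[simp]: "X \<in> carrier_mat n p \<Longrightarrow> X *\<^sub>v 0\<^sub>v p = (0\<^sub>v n :: complex vec)"
  by (rule eq_vecI) auto

section \<open>Subspaces as ranges of injective matrices\<close>

text \<open>A \<open>k\<close>-dimensional subspace is encoded as the range of a matrix with
  \<open>k\<close> columns and trivial kernel. Its dimension is the column count, and passing to a
  subspace is matrix multiplication.\<close>

definition inj_mat :: "complex mat \<Rightarrow> bool" where
  "inj_mat X \<longleftrightarrow> (\<forall>y \<in> carrier_vec (dim_col X). X *\<^sub>v y = 0\<^sub>v (dim_row X) \<longrightarrow> y = 0\<^sub>v (dim_col X))"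

lemma inj_matD: "inj_mat X \<Longrightarrow> X \<in> carrier_mat n k \<Longrightarrow> y \<in> carrier_vec k \<Longrightarrow> X *\<^sub>v y = 0\<^sub>v n \<Longrightarrow> y = 0\<^sub>v k"
  unfolding inj_mat_def by auto

lemma inj_matI: "X \<in> carrier_mat n k \<Longrightarrow> (\<And>y. y \<in> carrier_vec k \<Longrightarrow> X *\<^sub>v y = 0\<^sub>v n \<Longrightarrow> y = 0\<^sub>v k) \<Longrightarrow> inj_mat X"
  unfolding inj_mat_def by auto

lemma inj_mat_mult:
  "inj_mat X \<Longrightarrow> inj_mat Y \<Longrightarrow> X \<in> carrier_mat n m \<Longrightarrow> Y \<in> carrier_mat m k \<Longrightarrow> inj_mat (X * Y)"
  by (rule inj_matI[of _ n k]) (auto intro!: inj_matD[of Y m k] inj_matD[of X n m])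

lemma inj_mat_left_inverse:
  assumes "L * X = 1\<^sub>m k" "X \<in> carrier_mat n k" "L \<in> carrier_mat k n"
  shows "inj_mat X"
proof (rule inj_matI[OF assms(2)])
  fix y :: "complex vec" assume y: "y \<in> carrier_vec k" and "X *\<^sub>v y = 0\<^sub>v n"
  then have "L *\<^sub>v (X *\<^sub>v y) = 0\<^sub>v k" using assms by auto
  then show "y = 0\<^sub>v k"
    using y assms by (metis assoc_mult_mat_vec one_mult_mat_vec)
qed

definition hcat :: "complex mat \<Rightarrow> complex mat \<Rightarrow> complex mat" where
  "hcat X Y = mat (dim_row X) (dim_col X + dim_col Y)
     (\<lambda>(i,j). if j < dim_col X then X $$ (i,j) else Y $$ (i, j - dim_col X))"

lemma hcat_carrier[simp]:
  "X \<in> carrier_mat n p \<Longrightarrow> Y \<in> carrier_mat n q \<Longrightarrow> hcat X Y \<in> carrier_mat n (p + q)"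
  by (auto simp: hcat_def)

lemma dim_hcat[simp]: "dim_row (hcat X Y) = dim_row X" "dim_col (hcat X Y) = dim_col X + dim_col Y"
  by (auto simp: hcat_def)

lemma row_hcat:
  "X \<in> carrier_mat n p \<Longrightarrow> Y \<in> carrier_mat n q \<Longrightarrow> i < n \<Longrightarrow> row (hcat X Y) i = row X i @\<^sub>v row Y i"
  by (rule eq_vecI) (auto simp: hcat_def)

lemma hcat_mult_vec:
  assumes "X \<in> carrier_mat n p" "Y \<in> carrier_mat n q" "x \<in> carrier_vec p" "y \<in> carrier_vec q"
  shows "hcat X Y *\<^sub>v (x @\<^sub>v y) = X *\<^sub>v x + Y *\<^sub>v y"
proof (rule eq_vecI)
  show "dim_vec (hcat X Y *\<^sub>v (x @\<^sub>v y)) = dim_vec (X *\<^sub>v x + Y *\<^sub>v y)"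
    using assms by (simp add: hcat_def)
  fix i assume "i < dim_vec (X *\<^sub>v x + Y *\<^sub>v y)"
  then have i: "i < n" using assms by auto
  show "(hcat X Y *\<^sub>v (x @\<^sub>v y)) $ i = (X *\<^sub>v x + Y *\<^sub>v y) $ i"
    using assms i hcat_carrier[OF assms(1,2)]
    by (simp add: row_hcat[OF assms(1,2)] scalar_prod_append[of _ p _ q])
qed

lemma split_vec:
  assumes "z \<in> carrier_vec (p + q)"
  obtains x y where "x \<in> carrier_vec p" "y \<in> carrier_vec q" "z = x @\<^sub>v y"
  using vec_first_last_append[OF assms] vec_first_carrier vec_last_carrier by metis

lemma append_zero_vec: "0\<^sub>v p @\<^sub>v 0\<^sub>v q = (0\<^sub>v (p+q) :: complex vec)"
  by (rule eq_vecI) auto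

text \<open>Padding with zero rows gives a square matrix whose transpose kills the unit vector with
  index \<open>n\<close>, so its determinant vanishes.\<close>

lemma wide_mat_kernel:
  assumes X: "X \<in> carrier_mat n m" and "n < m"
  shows "\<exists>z \<in> carrier_vec m. z \<noteq> 0\<^sub>v m \<and> X *\<^sub>v z = (0\<^sub>v n :: complex vec)"
proof -
  define Q where "Q = mat m m (\<lambda>(i,j). if i < n then X $$ (i,j) else 0)"
  have Q: "Q \<in> carrier_mat m m" by (simp add: Q_def)
  have "Determinant.det Q = 0"
  proof -
    have "transpose_mat Q *\<^sub>v unit_vec m n = 0\<^sub>v m"
      by (rule eq_vecI) (use assms Q in \<open>auto simp: Q_def\<close>)
    then have "Determinant.det (transpose_mat Q) = 0"
      using det_0_iff_vec_prod_zero[of "transpose_mat Q" m] Q unit_vec_nonzero[of n m] \<open>n < m\<close>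
      by (metis transpose_carrier_mat unit_vec_carrier unit_vec_nonzero)
    then show ?thesis using det_transpose[OF Q] by simp
  qed
  then obtain z where z: "z \<in> carrier_vec m" "z \<noteq> 0\<^sub>v m" "Q *\<^sub>v z = 0\<^sub>v m"
    using det_0_iff_vec_prod_zero[OF Q] by auto
  have "X *\<^sub>v z = 0\<^sub>v n"
  proof (rule eq_vecI)
    fix i assume "i < dim_vec (0\<^sub>v n :: complex vec)"
    then have i: "i < n" by simp
    have "row Q i = row X i" by (rule eq_vecI) (use i assms in \<open>auto simp: Q_def\<close>)
    moreover have "(Q *\<^sub>v z) $ i = 0" using z i assms by simp
    ultimately show "(X *\<^sub>v z) $ i = 0\<^sub>v n $ i" using i assms X Q by simp
  qed (use X in auto)
  then show ?thesis using z by auto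
qed

lemma inj_hcatD:
  assumes "X \<in> carrier_mat n p" "Y \<in> carrier_mat n q" "\<not> inj_mat (hcat X Y)"
  obtains x y where "x \<in> carrier_vec p" "y \<in> carrier_vec q"
    "X *\<^sub>v x + Y *\<^sub>v y = 0\<^sub>v n" "x \<noteq> 0\<^sub>v p \<or> y \<noteq> 0\<^sub>v q"
proof -
  from assms(3) inj_matI[OF hcat_carrier[OF assms(1,2)]] obtain z where
    z: "z \<in> carrier_vec (p+q)" "hcat X Y *\<^sub>v z = 0\<^sub>v n" "z \<noteq> 0\<^sub>v (p+q)" by auto
  from split_vec[OF z(1)] obtain x y where xy: "x \<in> carrier_vec p" "y \<in> carrier_vec q" "z = x @\<^sub>v y" .
  then have "x \<noteq> 0\<^sub>v p \<or> y \<noteq> 0\<^sub>v q" using z append_zero_vec by auto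
  then show thesis using that[OF xy(1,2)] z(2) hcat_mult_vec[OF assms(1,2) xy(1,2)] xy(3) by auto
qed

lemma inj_mat_le:
  assumes "X \<in> carrier_mat n k" "inj_mat X"
  shows "k \<le> n"
  using wide_mat_kernel[OF assms(1)] inj_matD[OF assms(2,1)] by force

text \<open>The dimension count behind every intersection argument below: \<open>p + q\<close>
  columns in dimension \<open>n\<close> are dependent, and injectivity of each block forces both
  coefficient vectors in the dependence to be nonzero.\<close>

lemma inj_mats_meet:
  assumes X: "X \<in> carrier_mat n p" "inj_mat X" and Y: "Y \<in> carrier_mat n q" "inj_mat Y" and "p + q > n"
  obtains x y where "x \<in> carrier_vec p" "y \<in> carrier_vec q" "X *\<^sub>v x = Y *\<^sub>v y"
    "x \<noteq> 0\<^sub>v p" "y \<noteq> 0\<^sub>v q" "X *\<^sub>v x \<noteq> 0\<^sub>v n"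
proof -
  have "\<not> inj_mat (hcat X Y)" using inj_mat_le[OF hcat_carrier[OF X(1) Y(1)]] assms by auto
  from inj_hcatD[OF X(1) Y(1) this] obtain x y where xy: "x \<in> carrier_vec p" "y \<in> carrier_vec q"
    "X *\<^sub>v x + Y *\<^sub>v y = 0\<^sub>v n" "x \<noteq> 0\<^sub>v p \<or> y \<noteq> 0\<^sub>v q" .
  have c: "X *\<^sub>v x \<in> carrier_vec n" "Y *\<^sub>v y \<in> carrier_vec n" using xy X Y by auto
  have *: "X *\<^sub>v x = Y *\<^sub>v (- y)"
  proof (rule eq_vecI)
    fix i assume "i < dim_vec (Y *\<^sub>v (- y))"
    then have i: "i < n" using Y by auto
    have "(X *\<^sub>v x) $ i + (Y *\<^sub>v y) $ i = 0"
    proof -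
      have "(X *\<^sub>v x + Y *\<^sub>v y) $ i = 0" unfolding xy(3) using i by simp
      then show ?thesis using i c Y by (subst (asm) index_add_vec) auto
    qed
    moreover have "(Y *\<^sub>v (- y)) $ i = - (Y *\<^sub>v y) $ i" using i xy Y by simp
    ultimately show "(X *\<^sub>v x) $ i = (Y *\<^sub>v (- y)) $ i"
      by (metis eq_neg_iff_add_eq_0)
  qed (use X Y in auto)
  have x: "x \<noteq> 0\<^sub>v p"
  proof
    assume "x = 0\<^sub>v p"
    then have "Y *\<^sub>v y = 0\<^sub>v n" using xy c X by simp
    then have "y = 0\<^sub>v q" using inj_matD[OF Y(2,1)] xy by auto
    then show False using xy \<open>x = 0\<^sub>v p\<close> by auto
  qed
  then have "X *\<^sub>v x \<noteq> 0\<^sub>v n" using inj_matD[OF X(2,1)] xy by auto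
  moreover have "-y \<noteq> 0\<^sub>v q" using \<open>X *\<^sub>v x \<noteq> 0\<^sub>v n\<close> * Y by auto
  ultimately show thesis using that[of x "-y"] xy * x by auto
qed

text \<open>\<open>Y\<close> solves the equation of the hyperplane for a coordinate \<open>p\<close>
  with nonzero coefficient, and \<open>L\<close> forgets that coordinate;
  \<open>insert_index p\<close> enumerates the others. The product here is bilinear, so callers pass
  a conjugated vector when they mean an orthogonal complement.\<close>

lemma hyperplane_basis:
  fixes g :: "complex vec"
  assumes g: "g \<in> carrier_vec n" "g \<noteq> 0\<^sub>v n"
  obtains Y L where "Y \<in> carrier_mat n (n - 1)" "L \<in> carrier_mat (n - 1) n" "L * Y = 1\<^sub>m (n - 1)"
    "\<And>x. x \<in> carrier_vec n \<Longrightarrow> g \<bullet> x = 0 \<Longrightarrow> Y *\<^sub>v (L *\<^sub>v x) = x"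
    "\<And>y. y \<in> carrier_vec (n - 1) \<Longrightarrow> g \<bullet> (Y *\<^sub>v y) = 0"
proof -
  obtain p where p: "p < n" "g $ p \<noteq> 0" using g by (metis carrier_vecD eq_vecI index_zero_vec)
  let ?s = "insert_index p"
  define L :: "complex mat" where "L = mat (n-1) n (\<lambda>(i,j). if j = ?s i then 1 else 0)"
  define Y :: "complex mat" where
    "Y = mat n (n-1) (\<lambda>(i,j). if i = p then - g $ ?s j / g $ p else if i = ?s j then 1 else 0)"
  have L: "L \<in> carrier_mat (n-1) n" and Y: "Y \<in> carrier_mat n (n-1)" by (auto simp: L_def Y_def)
  have sn: "?s i < n" if "i < n - 1" for i using that by (auto simp: insert_index_def)
  have sinj: "?s i = ?s j \<longleftrightarrow> i = j" for i j by (auto simp: insert_index_def)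
  have sp: "?s i \<noteq> p" for i by simp
  have Lx: "(L *\<^sub>v x) $ i = x $ ?s i" if "i < n - 1" "x \<in> carrier_vec n" for i x
  proof -
    have "row L i = unit_vec n (?s i)"
      by (rule eq_vecI) (use that sn in \<open>auto simp: L_def unit_vec_def\<close>)
    then show ?thesis using that L sn by simp
  qed
  have Ysx: "(Y *\<^sub>v y) $ ?s i = y $ i" if "i < n - 1" "y \<in> carrier_vec (n-1)" for i y
  proof -
    have "row Y (?s i) = unit_vec (n-1) i"
      by (rule eq_vecI) (use that sn sinj in \<open>auto simp: Y_def unit_vec_def\<close>)
    then show ?thesis using that Y sn by simp
  qed
  have sum_split: "(\<Sum>i<n. f i) = f p + (\<Sum>i<n-1. f (?s i))" for f :: "nat \<Rightarrow> complex"
  proof -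
    have "{..<n} = insert p (?s ` {..<n-1})"
      using insert_index_image[of p "n-1"] p by (auto simp: atLeast0LessThan)
    moreover have "p \<notin> ?s ` {..<n-1}" by (metis imageE sp)
    moreover have "inj_on ?s {..<n-1}" by (rule insert_index_inj_on)
    ultimately show ?thesis by (simp add: sum.reindex)
  qed
  have Yp: "g $ p * (Y *\<^sub>v y) $ p = - (\<Sum>i<n-1. g $ ?s i * y $ i)" if "y \<in> carrier_vec (n-1)" for y
    using that p Y by (auto simp: scalar_prod_def Y_def sum_distrib_left sum_negf[symmetric] atLeast0LessThan intro!: sum.cong)
  have g_eq: "g \<bullet> x = g $ p * x $ p + (\<Sum>i<n-1. g $ ?s i * x $ ?s i)" if "x \<in> carrier_vec n" for x
    using that sum_split[of "\<lambda>i. g $ i * x $ i"] by (simp add: scalar_prod_def atLeast0LessThan)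
  have "g \<bullet> (Y *\<^sub>v y) = 0" if "y \<in> carrier_vec (n-1)" for y
    using g_eq[of "Y *\<^sub>v y"] Yp[OF that] that Y Ysx by simp
  moreover have "Y *\<^sub>v (L *\<^sub>v x) = x" if x: "x \<in> carrier_vec n" "g \<bullet> x = 0" for x
  proof (rule eq_vecI)
    have Lxc: "L *\<^sub>v x \<in> carrier_vec (n-1)" using L x by simp
    fix i assume "i < dim_vec x"
    then have i: "i < n" using x by simp
    show "(Y *\<^sub>v (L *\<^sub>v x)) $ i = x $ i"
    proof (cases "i = p")
      case True
      have "g $ p * (Y *\<^sub>v (L *\<^sub>v x)) $ p = g $ p * x $ p"
      proof -
        have "(\<Sum>i<n-1. g $ ?s i * (L *\<^sub>v x) $ i) = (\<Sum>i<n-1. g $ ?s i * x $ ?s i)"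
          using Lx x by (intro sum.cong) auto
        then show ?thesis using Yp[OF Lxc] g_eq[OF x(1)] x(2) by (metis eq_neg_iff_add_eq_0)
      qed
      then show ?thesis using p True by simp
    next
      case False
      then have "i \<in> ?s ` {..<n-1}" using i insert_index_image[of p "n-1"] p by (auto simp: atLeast0LessThan)
      then obtain j where "j < n - 1" "i = ?s j" by auto
      then show ?thesis using Ysx[OF _ Lxc] Lx x by simp
    qed
  qed (use x Y in auto)
  moreover have "L * Y = 1\<^sub>m (n-1)"
  proof (rule eq_matI)
    fix i j assume "i < dim_row (1\<^sub>m (n-1) :: complex mat)" "j < dim_col (1\<^sub>m (n-1):: complex mat)"
    then have ij: "i < n-1" "j < n-1" by auto
    have "(L * Y) $$ (i,j) = (L *\<^sub>v col Y j) $ i" using ij L Y by simp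
    also have "\<dots> = col Y j $ ?s i" using ij Y by (intro Lx) auto
    also have "\<dots> = 1\<^sub>m (n-1) $$ (i,j)" using ij sn sinj by (auto simp: Y_def)
    finally show "(L * Y) $$ (i,j) = 1\<^sub>m (n-1) $$ (i,j)" .
  qed (use L Y in auto)
  ultimately show thesis using that[of Y L] L Y by blast
qed

section \<open>Spectral theorem for Hermitian matrices\<close>

lemma mat_adjoint_mult:
  fixes A :: "complex mat"
  assumes "A \<in> carrier_mat n m" "B \<in> carrier_mat m k"
  shows "mat_adjoint (A * B) = mat_adjoint B * mat_adjoint A"
  by (rule eq_matI) (use assms in \<open>auto simp: scalar_prod_def mult.commute\<close>)

lemma mat_adjoint_one[simp]: "mat_adjoint (1\<^sub>m n :: complex mat) = 1\<^sub>m n"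
  by (rule eq_matI) auto

lemma mat_adjoint_mult_mult:
  fixes X :: "complex mat"
  assumes X: "X \<in> carrier_mat n k" and U: "U \<in> carrier_mat k m"
  shows "mat_adjoint (X * U) * (X * U) = mat_adjoint U * (mat_adjoint X * X) * U"
proof -
  have c: "mat_adjoint X \<in> carrier_mat k n" "mat_adjoint U \<in> carrier_mat m k" "X * U \<in> carrier_mat n m"
    "mat_adjoint X * X \<in> carrier_mat k k"
    using assms by auto
  have "mat_adjoint (X * U) * (X * U) = mat_adjoint U * (mat_adjoint X * (X * U))"
    unfolding mat_adjoint_mult[OF assms] by (rule assoc_mult_mat[OF c(2,1,3)])
  also have "mat_adjoint X * (X * U) = mat_adjoint X * X * U"
    by (rule assoc_mult_mat[OF c(1) X U, symmetric])
  also have "mat_adjoint U * (mat_adjoint X * X * U) = mat_adjoint U * (mat_adjoint X * X) * U"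
    by (rule assoc_mult_mat[OF c(2,4) U, symmetric])
  finally show ?thesis .
qed

lemma mult_unit_vec:
  fixes X :: "complex mat"
  assumes "X \<in> carrier_mat n k" "j < k"
  shows "X *\<^sub>v unit_vec k j = col X j"
  by (rule eq_vecI) (use assms in auto)

lemma sesq_unit_vec:
  assumes "M \<in> carrier_mat k k" "i < k" "j < k"
  shows "sesq M (unit_vec k j) (unit_vec k i) = M $$ (i,j)"
proof -
  have "conjugate (unit_vec k i) = (unit_vec k i :: complex vec)"
    by (rule eq_vecI) (auto simp: unit_vec_def)
  then show ?thesis using assms by (simp add: sesq_def)
qed

lemma index_congruence:
  assumes "A \<in> carrier_mat n n" "X \<in> carrier_mat n k" "i < k" "j < k"
  shows "(mat_adjoint X * A * X) $$ (i,j) = sesq A (col X j) (col X i)"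
proof -
  have u: "unit_vec k j \<in> carrier_vec k" "unit_vec k i \<in> carrier_vec k" by auto
  have X: "X *\<^sub>v unit_vec k j = col X j" if "j < k" for j
    by (rule eq_vecI) (use that assms in auto)
  let ?M = "mat_adjoint X * A * X"
  have M: "?M \<in> carrier_mat k k" using assms by auto
  have "sesq ?M (unit_vec k j) (unit_vec k i) = ?M $$ (i,j)"
    by (rule sesq_unit_vec[OF M assms(3,4)])
  then show ?thesis using sesq_congruence[OF assms(1,2) u] X assms by simp
qed

lemma index_gram:
  fixes X :: "complex mat"
  assumes "X \<in> carrier_mat n k" "i < k" "j < k"
  shows "(mat_adjoint X * X) $$ (i,j) = col X j \<bullet>c col X i"
  using index_congruence[of "1\<^sub>m n" n X k i j] assms by (simp add: sesq_one[of _ n])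

lemma sesq_gram:
  fixes X :: "complex mat"
  assumes "X \<in> carrier_mat n k" "y \<in> carrier_vec k" "z \<in> carrier_vec k"
  shows "sesq (mat_adjoint X * X) y z = (X *\<^sub>v y) \<bullet>c (X *\<^sub>v z)"
  using sesq_congruence[of "1\<^sub>m n" n X k y z] assms by (simp add: sesq_one[of _ n])

text \<open>The spectral theorem in one fixed size, named so that orthonormalization in dimension
  \<open>n\<close> is available inside the induction step for \<open>Suc n\<close>.\<close>

definition diagonalizable_size :: "nat \<Rightarrow> bool" where
  "diagonalizable_size n \<longleftrightarrow> (\<forall>H \<in> carrier_mat n n. mat_adjoint H = H \<longrightarrow>
     (\<exists>U \<in> carrier_mat n n. \<exists>d :: nat \<Rightarrow> real. mat_adjoint U * U = 1\<^sub>m n \<and>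
        mat_adjoint U * H * U = mat_diag n (\<lambda>i. complex_of_real (d i))))"

text \<open>Instead of Gram-Schmidt, the Gram matrix of the columns is diagonalized: the columns of
  \<open>X * U\<close> are orthogonal with squared norms \<open>d i\<close>, which are positive by
  injectivity, and are then rescaled.\<close>

lemma orthonormalize_aux:
  assumes "diagonalizable_size k" and X: "X \<in> carrier_mat n k" "inj_mat X"
  shows "\<exists>R \<in> carrier_mat k k. mat_adjoint (X * R) * (X * R) = 1\<^sub>m k"
proof -
  let ?G = "mat_adjoint X * X"
  have G: "?G \<in> carrier_mat k k" using X by auto
  have "mat_adjoint ?G = ?G" using X mat_adjoint_mult[of "mat_adjoint X" k n X k] by simp
  then obtain U d where U: "U \<in> carrier_mat k k" "mat_adjoint U * U = 1\<^sub>m k"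
    and D: "mat_adjoint U * ?G * U = mat_diag k (\<lambda>i. complex_of_real (d i))"
    using assms(1) G unfolding diagonalizable_size_def by blast
  have injU: "inj_mat U" by (rule inj_mat_left_inverse[OF U(2)]) (use U in auto)
  have XU: "X * U \<in> carrier_mat n k" using X U by auto
  have injXU: "inj_mat (X * U)" by (rule inj_mat_mult[OF X(2) injU X(1) U(1)])
  have "mat_adjoint (X * U) * (X * U) = mat_adjoint U * ?G * U"
    by (rule mat_adjoint_mult_mult[OF X(1) U(1)])
  then have gram: "col (X * U) j \<bullet>c col (X * U) i = (if i = j then of_real (d i) else 0)" if "i < k" "j < k" for i j
    unfolding index_gram[OF XU that, symmetric] mat_adjoint_mult_mult[OF X(1) U(1)] D
    using that by (auto simp: mat_diag_def)
  have dpos: "d i > 0" if i: "i < k" for i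
  proof -
    have "(X * U) *\<^sub>v unit_vec k i = col (X * U) i"
      by (rule mult_unit_vec[OF XU i])
    moreover have "(X * U) *\<^sub>v unit_vec k i \<noteq> 0\<^sub>v n"
      using inj_matD[OF injXU XU, of "unit_vec k i"] i unit_vec_nonzero[of k i] by auto
    ultimately have "nrm2 (col (X * U) i) > 0"
      using nrm2_pos_iff[of "col (X * U) i" n] i XU by auto
    then show ?thesis using gram[OF i i] by (simp add: nrm2_def)
  qed
  let ?s = "\<lambda>i. complex_of_real (1 / sqrt (d i))"
  define R where "R = U * mat_diag k ?s"
  have R: "R \<in> carrier_mat k k" using U by (simp add: R_def)
  have XR: "X * R \<in> carrier_mat n k" using X R by simp
  have "X * R = (X * U) * mat_diag k ?s" unfolding R_def using X U by (simp add: assoc_mult_mat[of X n k U k _ k])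
  then have XRe: "X * R = mat n k (\<lambda>(i,j). (X * U) $$ (i,j) * ?s j)"
    using mat_diag_mult_right[OF XU, of ?s] by simp
  have col: "col (X * R) j = ?s j \<cdot>\<^sub>v col (X * U) j" if "j < k" for j
    unfolding XRe by (rule eq_vecI) (use that XU X U in auto)
  have "mat_adjoint (X * R) * (X * R) = 1\<^sub>m k"
  proof (rule eq_matI)
    fix i j assume "i < dim_row (1\<^sub>m k :: complex mat)" "j < dim_col (1\<^sub>m k :: complex mat)"
    then have ij: "i < k" "j < k" by auto
    have c: "col (X * U) i \<in> carrier_vec n" "col (X * U) j \<in> carrier_vec n" using ij XU by auto
    have "(mat_adjoint (X * R) * (X * R)) $$ (i,j) = of_real (1 / sqrt (d j) * (1 / sqrt (d i))) * (col (X * U) j \<bullet>c col (X * U) i)"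
      using index_gram[OF XR ij] c by (simp add: col[OF ij(1)] col[OF ij(2)] conjugate_smult_vec)
    also have "\<dots> = 1\<^sub>m k $$ (i,j)"
      using dpos[OF ij(1)] ij by (cases "i = j") (simp_all add: gram)
    finally show "(mat_adjoint (X * R) * (X * R)) $$ (i,j) = 1\<^sub>m k $$ (i,j)" .
  qed (use XR X R in auto)
  then show ?thesis using R by blast
qed

lemma col_hcat:
  assumes "X \<in> carrier_mat n p" "Y \<in> carrier_mat n q" "j < p + q"
  shows "col (hcat X Y) j = (if j < p then col X j else col Y (j - p))"
  by (rule eq_vecI) (use assms in \<open>auto simp: hcat_def\<close>)

text \<open>A unit eigenvector \<open>v\<close> is split off. \<open>H\<close> is compressed to an
  orthonormal basis of the orthogonal complement and diagonalized there; the mixed entries vanish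
  because \<open>v\<close> is an eigenvector and \<open>H\<close> is Hermitian.\<close>

lemma diagonalizable_size_all: "diagonalizable_size n"
proof (induction n)
  case 0
  show ?case unfolding diagonalizable_size_def
  proof (intro ballI impI)
    fix H :: "complex mat" assume "H \<in> carrier_mat 0 0"
    then show "\<exists>U \<in> carrier_mat 0 0. \<exists>d :: nat \<Rightarrow> real. mat_adjoint U * U = 1\<^sub>m 0 \<and>
        mat_adjoint U * H * U = mat_diag 0 (\<lambda>i. complex_of_real (d i))"
      by (intro bexI[of _ "1\<^sub>m 0"]) (auto simp: mat_eq_iff mat_diag_def)
  qed
next
  case (Suc n)
  show ?case unfolding diagonalizable_size_def
  proof (intro ballI impI)
    fix H :: "complex mat" assume H: "H \<in> carrier_mat (Suc n) (Suc n)" and herm: "mat_adjoint H = H"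
    let ?N = "Suc n"
    from spectrum_non_empty[OF H] obtain \<mu> where "eigenvalue H \<mu>" unfolding spectrum_def by auto
    then obtain v0 where v0: "v0 \<in> carrier_vec ?N" "v0 \<noteq> 0\<^sub>v ?N" "H *\<^sub>v v0 = \<mu> \<cdot>\<^sub>v v0"
      using H unfolding eigenvalue_def eigenvector_def by auto
    define v where "v = complex_of_real (1 / sqrt (nrm2 v0)) \<cdot>\<^sub>v v0"
    have nv0: "nrm2 v0 > 0" using nrm2_pos_iff v0 by blast
    have v: "v \<in> carrier_vec ?N" using v0 by (simp add: v_def)
    have vv: "v \<bullet>c v = 1"
      using v0 nv0 by (simp add: v_def conjugate_smult_vec cscalar_prod_nrm2 of_real_mult[symmetric] del: of_real_mult of_real_divide)
    have Hv: "H *\<^sub>v v = \<mu> \<cdot>\<^sub>v v"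
      using v0 H by (simp add: v_def mult_mat_vec[of H ?N ?N] smult_smult_assoc mult.commute)
    have v_ne: "v \<noteq> 0\<^sub>v ?N" using vv by auto
    then have "conjugate v \<noteq> 0\<^sub>v ?N" by (metis conjugate_id conjugate_zero_vec)
    from hyperplane_basis[OF _ this] v obtain Y L where
      Y: "Y \<in> carrier_mat ?N n" and L: "L \<in> carrier_mat n ?N" "L * Y = 1\<^sub>m n"
      and Yv: "\<And>y. y \<in> carrier_vec n \<Longrightarrow> conjugate v \<bullet> (Y *\<^sub>v y) = 0"
      by (metis carrier_vec_conjugate diff_Suc_1)
    have injY: "inj_mat Y" using inj_mat_left_inverse[OF L(2) Y L(1)] .
    from orthonormalize_aux[OF Suc.IH Y injY] obtain R where
      R: "R \<in> carrier_mat n n" and YR: "mat_adjoint (Y * R) * (Y * R) = 1\<^sub>m n" by auto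
    let ?Z = "Y * R"
    have Z: "?Z \<in> carrier_mat ?N n" using Y R by simp
    let ?H' = "mat_adjoint ?Z * H * ?Z"
    have "mat_adjoint ?H' = ?H'"
    proof -
      have "mat_adjoint ?H' = mat_adjoint ?Z * mat_adjoint (mat_adjoint ?Z * H)"
        by (rule mat_adjoint_mult[OF mult_carrier_mat[OF mat_adjoint_carrier[OF Z] H] Z])
      also have "mat_adjoint (mat_adjoint ?Z * H) = H * ?Z"
        using mat_adjoint_mult[of "mat_adjoint ?Z" n ?N H ?N] Z H herm by simp
      finally show ?thesis using Z H by (simp add: assoc_mult_mat[of _ n ?N _ ?N _ n])
    qed
    moreover have "?H' \<in> carrier_mat n n" using Z H by (auto intro!: mult_carrier_mat[of _ n ?N])
    ultimately obtain U d where U: "U \<in> carrier_mat n n" "mat_adjoint U * U = 1\<^sub>m n"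
      and D: "mat_adjoint U * ?H' * U = mat_diag n (\<lambda>i. complex_of_real (d i))"
      using Suc.IH unfolding diagonalizable_size_def by blast
    let ?T = "?Z * U"
    have T: "?T \<in> carrier_mat ?N n" using Z U by auto
    have colT: "col ?T j = Y *\<^sub>v (R *\<^sub>v col U j)" if "j < n" for j
    proof -
      have "col U j \<in> carrier_vec n" using that U by simp
      then show ?thesis unfolding col_mult2[OF Z U(1) that] by (rule assoc_mult_mat_vec[OF Y R])
    qed
    have colTZ: "col ?T j = ?Z *\<^sub>v col U j" if "j < n" for j
      using that by (rule col_mult2[OF Z U(1)])
    have Tv: "col ?T j \<bullet>c v = 0" if "j < n" for j
    proof -
      have "conjugate v \<bullet> col ?T j = 0" using Yv[of "R *\<^sub>v col U j"] that R U by (simp add: colT)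
      moreover have "col ?T j \<in> carrier_vec ?N" using that T by simp
      ultimately show ?thesis using comm_scalar_prod[of "conjugate v" ?N "col ?T j"] v
        by (simp add: carrier_vec_conjugate)
    qed
    have vT: "v \<bullet>c col ?T j = 0" if "j < n" for j
    proof -
      have "col ?T j \<in> carrier_vec ?N" using that T by simp
      then have "v \<bullet>c col ?T j = cnj (col ?T j \<bullet>c v)"
        using conjugate_conjugate_sprod[OF _ v, of "col ?T j"] sesq_mat_adjoint[of "1\<^sub>m ?N" ?N v "col ?T j"] v
        by (simp add: sesq_one)
      then show ?thesis using Tv[OF that] by simp
    qed
    have TT: "col ?T j \<bullet>c col ?T i = (if i = j then 1 else 0)" if "i < n" "j < n" for i j
    proof -
      have "col ?T j \<bullet>c col ?T i = sesq (mat_adjoint ?Z * ?Z) (col U j) (col U i)"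
        using that U sesq_gram[OF Z] by (simp add: colTZ)
      also have "\<dots> = (mat_adjoint U * U) $$ (i,j)"
        using index_gram[OF U(1)] that YR U(1) sesq_one[of "col U j" n "col U i"] by simp
      finally show ?thesis using U that by simp
    qed
    have HTT: "sesq H (col ?T j) (col ?T i) = (if i = j then of_real (d i) else 0)" if "i < n" "j < n" for i j
    proof -
      have "sesq H (col ?T j) (col ?T i) = sesq ?H' (col U j) (col U i)"
        using that U sesq_congruence[OF H Z] by (simp add: colTZ)
      also have "\<dots> = (mat_adjoint U * ?H' * U) $$ (i,j)"
        using index_congruence[of ?H' n U n i j] \<open>?H' \<in> carrier_mat n n\<close> U that by simp
      finally show ?thesis using D that by (simp add: mat_diag_def)
    qed
    have HvT: "sesq H v (col ?T j) = 0" if "j < n" for j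
      using vT[OF that] T v that by (simp add: sesq_def Hv)
    have HTv: "sesq H (col ?T j) v = 0" if "j < n" for j
      using sesq_mat_adjoint[OF H, of "col ?T j" v] herm HvT[OF that] T v that by simp
    have Hvv: "sesq H v v = \<mu>" using v vv by (simp add: sesq_def Hv)
    have "\<mu> = cnj \<mu>" using sesq_mat_adjoint[OF H v v] herm Hvv by simp
    then have mu: "\<mu> = complex_of_real (Re \<mu>)" by (simp add: complex_eq_iff)
    define V where "V = mat ?N 1 (\<lambda>(i,j). v $ i)"
    have V: "V \<in> carrier_mat ?N 1" by (simp add: V_def)
    have colV: "col V 0 = v" by (rule eq_vecI) (use v in \<open>auto simp: V_def\<close>)
    define W where "W = hcat V ?T"
    have W: "W \<in> carrier_mat ?N ?N" using hcat_carrier[OF V T] by (simp add: W_def)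
    have colW: "col W j = (if j = 0 then v else col ?T (j - 1))" if "j < ?N" for j
      unfolding W_def using col_hcat[OF V T, of j] that colV by auto
    let ?d = "\<lambda>i. if i = 0 then Re \<mu> else d (i - 1)"
    have "mat_adjoint W * W = 1\<^sub>m ?N"
      by (rule eq_matI) (use W in \<open>auto simp: index_gram[OF W] colW vv Tv vT TT simp del: index_mult_mat(1)\<close>)
    moreover have "mat_adjoint W * H * W = mat_diag ?N (\<lambda>i. complex_of_real (?d i))"
    proof (rule eq_matI)
      fix i j assume "i < dim_row (mat_diag ?N (\<lambda>i. complex_of_real (?d i)))"
        "j < dim_col (mat_diag ?N (\<lambda>i. complex_of_real (?d i)))"
      then have ij: "i < ?N" "j < ?N" by (auto simp: mat_diag_def)
      have "sesq H (col W j) (col W i) = (if i = j then complex_of_real (?d i) else 0)"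
      proof (cases "i = 0"; cases "j = 0")
        assume "i = 0" "j = 0"
        then show ?thesis using Hvv mu by (simp add: colW)
      qed (use ij in \<open>auto simp: colW HTv HvT HTT\<close>)
      then show "(mat_adjoint W * H * W) $$ (i,j) = mat_diag ?N (\<lambda>i. complex_of_real (?d i)) $$ (i,j)"
        unfolding index_congruence[OF H W ij] using ij by (simp add: mat_diag_def)
    qed (use W in \<open>auto simp: mat_diag_def\<close>)
    ultimately show "\<exists>U \<in> carrier_mat ?N ?N. \<exists>d :: nat \<Rightarrow> real. mat_adjoint U * U = 1\<^sub>m ?N \<and>
        mat_adjoint U * H * U = mat_diag ?N (\<lambda>i. complex_of_real (d i))"
      by (intro bexI[OF _ W] exI[of _ ?d] conjI)
  qed
qed

lemmas orthonormalize = orthonormalize_aux[OF diagonalizable_size_all]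

text \<open>The entries satisfying an upward closed \<open>P\<close> form a tail of the sorted list.
  The predicate is general because both \<open>t \<le> x\<close> and the strict \<open>t < x\<close>
  are needed later.\<close>

lemma sorted_nth_ge_iff:
  fixes S :: "real list"
  assumes "sorted S" "1 \<le> k" "k \<le> length S" and P: "\<And>x y. P x \<Longrightarrow> x \<le> y \<Longrightarrow> P y"
  shows "P (rev S ! (k - 1)) \<longleftrightarrow> k \<le> length (filter P S)"
proof -
  let ?n = "length S"
  have r: "rev S ! (k - 1) = S ! (?n - k)" using assms by (simp add: rev_nth)
  have f: "length (filter P S) = card {i. i < ?n \<and> P (S ! i)}" by (rule length_filter_conv_card)
  show ?thesis
  proof
    assume "P (rev S ! (k - 1))"
    then have "{?n - k..<?n} \<subseteq> {i. i < ?n \<and> P (S ! i)}"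
      using r P sorted_nth_mono[OF assms(1)] by fastforce
    then have "card {?n - k..<?n} \<le> card {i. i < ?n \<and> P (S ! i)}" by (intro card_mono) auto
    then show "k \<le> length (filter P S)" using f assms by simp
  next
    assume k: "k \<le> length (filter P S)"
    show "P (rev S ! (k - 1))"
    proof (rule ccontr)
      assume "\<not> P (rev S ! (k - 1))"
      then have "\<not> P (S ! i)" if "i \<le> ?n - k" for i
        using r P sorted_nth_mono[OF assms(1), of i "?n - k"] that assms by auto
      then have "{i. i < ?n \<and> P (S ! i)} \<subseteq> {Suc (?n - k)..<?n}"
        by (smt (verit) atLeastLessThan_iff mem_Collect_eq not_less_eq_eq subsetI)
      then have "card {i. i < ?n \<and> P (S ! i)} \<le> card {Suc (?n - k)..<?n}" by (intro card_mono) auto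
      then show False using k f assms by simp
    qed
  qed
qed

text \<open>Unitary diagonalization unfolded into what is used: Parseval, the diagonal quadratic
  form, the action of \<open>H\<close>, and the ordered eigenvalues. The \<open>d i\<close> are in
  no particular order, so \<open>nth_eigenvalue\<close> is tied to them by counting alone.\<close>

definition diagonalizes :: "nat \<Rightarrow> complex mat \<Rightarrow> complex mat \<Rightarrow> (nat \<Rightarrow> real) \<Rightarrow> bool" where
  "diagonalizes n H U d \<longleftrightarrow> U \<in> carrier_mat n n \<and> inj_mat U \<and>
    (\<forall>z \<in> carrier_vec n. nrm2 (U *\<^sub>v z) = (\<Sum>i<n. (cmod (z $ i))\<^sup>2) \<and>
      sesq H (U *\<^sub>v z) (U *\<^sub>v z) = of_real (\<Sum>i<n. d i * (cmod (z $ i))\<^sup>2) \<and>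
      H *\<^sub>v (U *\<^sub>v z) = U *\<^sub>v (vec n (\<lambda>i. of_real (d i) * z $ i))) \<and>
    (\<forall>k P. 1 \<le> k \<longrightarrow> k \<le> n \<longrightarrow> (\<forall>x y. P x \<longrightarrow> x \<le> y \<longrightarrow> P y) \<longrightarrow>
       P (nth_eigenvalue H k) = (k \<le> card {i. i < n \<and> P (d i)}))"

lemma diagonalizesD:
  assumes "diagonalizes n H U d"
  shows "U \<in> carrier_mat n n" "inj_mat U"
    "\<And>z. z \<in> carrier_vec n \<Longrightarrow> nrm2 (U *\<^sub>v z) = (\<Sum>i<n. (cmod (z $ i))\<^sup>2)"
    "\<And>z. z \<in> carrier_vec n \<Longrightarrow> sesq H (U *\<^sub>v z) (U *\<^sub>v z) = of_real (\<Sum>i<n. d i * (cmod (z $ i))\<^sup>2)"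
    "\<And>z. z \<in> carrier_vec n \<Longrightarrow> H *\<^sub>v (U *\<^sub>v z) = U *\<^sub>v (vec n (\<lambda>i. of_real (d i) * z $ i))"
    "\<And>k P. 1 \<le> k \<Longrightarrow> k \<le> n \<Longrightarrow> (\<And>x y. P x \<Longrightarrow> x \<le> y \<Longrightarrow> P y) \<Longrightarrow>
       P (nth_eigenvalue H k) \<longleftrightarrow> k \<le> card {i. i < n \<and> P (d i)}"
  using assms unfolding diagonalizes_def by blast+

lemma hermitian_diagonalization:
  assumes H: "H \<in> carrier_mat n n" and herm: "mat_adjoint H = H"
  obtains U d where "diagonalizes n H U d"
proof -
  obtain U d where U: "U \<in> carrier_mat n n" "mat_adjoint U * U = 1\<^sub>m n"
    and D: "mat_adjoint U * H * U = mat_diag n (\<lambda>i. complex_of_real (d i))" 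
    using diagonalizable_size_all[of n] assms unfolding diagonalizable_size_def by blast
  let ?D = "mat_diag n (\<lambda>i. complex_of_real (d i))"
  have UU: "U * mat_adjoint U = 1\<^sub>m n"
    using mat_mult_left_right_inverse[OF _ U(1,2)] U(1) by simp
  have injU: "inj_mat U" by (rule inj_mat_left_inverse[OF U(2)]) (use U in auto)
  have nrm: "nrm2 (U *\<^sub>v z) = (\<Sum>i<n. (cmod (z $ i))\<^sup>2)" if z: "z \<in> carrier_vec n" for z
    
    using nrm2_eq[OF z] sesq_gram[OF U(1) z z] U(2) sesq_one[OF z, of z] by (simp add: nrm2_def)
  have Dz: "?D *\<^sub>v z = vec n (\<lambda>i. of_real (d i) * z $ i)" if z: "z \<in> carrier_vec n" for z
  proof (rule eq_vecI)
    fix i assume "i < dim_vec (vec n (\<lambda>i. of_real (d i) * z $ i))"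
    then have i: "i < n" by simp
    have "row ?D i = of_real (d i) \<cdot>\<^sub>v unit_vec n i"
      by (rule eq_vecI) (use i in \<open>auto simp: mat_diag_def\<close>)
    then show "(?D *\<^sub>v z) $ i = vec n (\<lambda>i. of_real (d i) * z $ i) $ i"
      using i z by (simp add: mat_diag_def)
  qed (auto simp: mat_diag_def)
  have HU: "H * U = U * ?D"
  proof -
    have Ua: "mat_adjoint U \<in> carrier_mat n n" using U by simp
    have "mat_adjoint U * H * U = mat_adjoint U * (H * U)"
      by (rule assoc_mult_mat[OF Ua H U(1)])
    moreover have "U * (mat_adjoint U * (H * U)) = U * mat_adjoint U * (H * U)"
      by (rule assoc_mult_mat[OF U(1) Ua, symmetric]) (use H U in auto)
    ultimately have "U * ?D = 1\<^sub>m n * (H * U)" using D UU by simp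
    then show ?thesis using H U by simp
  qed
  have H_U: "H *\<^sub>v (U *\<^sub>v z) = U *\<^sub>v (vec n (\<lambda>i. of_real (d i) * z $ i))" if z: "z \<in> carrier_vec n" for z
    using assoc_mult_mat_vec[OF H U(1) z] assoc_mult_mat_vec[OF U(1) _ z, of ?D] HU Dz[OF z] by simp
  have q: "sesq H (U *\<^sub>v z) (U *\<^sub>v z) = of_real (\<Sum>i<n. d i * (cmod (z $ i))\<^sup>2)" if z: "z \<in> carrier_vec n" for z
  proof -
    have "sesq H (U *\<^sub>v z) (U *\<^sub>v z) = sesq ?D z z" using sesq_congruence[OF H U(1) z z] D by simp
    also have "\<dots> = (\<Sum>i<n. of_real (d i) * z $ i * cnj (z $ i))"
      using z by (simp add: sesq_def Dz scalar_prod_def atLeast0LessThan)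
    also have "\<dots> = of_real (\<Sum>i<n. d i * (cmod (z $ i))\<^sup>2)"
      by (simp add: complex_norm_square[symmetric] mult.assoc)
    finally show ?thesis .
  qed
  have "similar_mat H ?D"
  proof (rule similar_matI[of _ _ U "mat_adjoint U" n])
    have "U * ?D * mat_adjoint U = H * (U * mat_adjoint U)"
      unfolding HU[symmetric] by (rule assoc_mult_mat[OF H U(1)]) (use U in auto)
    then show "H = U * ?D * mat_adjoint U" using UU H by simp
  qed (use U UU H in auto)
  then have "char_poly H = char_poly ?D" by (rule char_poly_similar)
  also have "\<dots> = (\<Prod>a \<leftarrow> diag_mat ?D. [:- a, 1:])"
    by (rule char_poly_upper_triangular[of _ n]) (auto simp: mat_diag_def)
  also have "diag_mat ?D = map (\<lambda>i. complex_of_real (d i)) [0..<n]"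
    by (auto simp: diag_mat_def mat_diag_def)
  finally have cp: "char_poly H = (\<Prod>a \<leftarrow> map (\<lambda>i. complex_of_real (d i)) [0..<n]. [:- a, 1:])" .
  \<comment> \<open>The root multiset of a product of monic linear factors is read off factor by
    factor; this is where algebraic multiplicities become repetitions among the
    \<open>d i\<close>.\<close>
  have pr_list: "proots (\<Prod>a \<leftarrow> as. [:- a, 1:]) = mset as" for as :: "complex list"
  proof (induction as)
    case (Cons a as)
    have "(\<Prod>a \<leftarrow> as. [:- a, 1:]) \<noteq> 0" by (auto simp: prod_list_zero_iff)
    then show ?case using Cons proots_mult[of "[:-a,1:]" "\<Prod>a \<leftarrow> as. [:- a, 1:]"] by (simp del: mult_pCons_left)
  qed auto
  then have pr: "image_mset Re (proots (char_poly H)) = mset (map d [0..<n])"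
    unfolding cp pr_list by (simp add: multiset.map_comp o_def)
  have ev: "P (nth_eigenvalue H k) \<longleftrightarrow> k \<le> card {i. i < n \<and> P (d i)}"
    if "1 \<le> k" "k \<le> n" and P: "\<And>x y. P x \<Longrightarrow> x \<le> y \<Longrightarrow> P y" for k P
  proof -
    have "length (filter P (sort (map d [0..<n]))) = length (filter P (map d [0..<n]))"
      by (metis filter_sort length_sort)
    also have "\<dots> = card {i. i < n \<and> P (d i)}"
      by (subst length_filter_conv_card) (auto intro!: arg_cong[of _ _ card])
    finally show ?thesis
      using sorted_nth_ge_iff[of "sort (map d [0..<n])" k P] that
      unfolding nth_eigenvalue_def pr sorted_list_of_multiset_mset by simp
  qed
  show thesis
    by (rule that[of U d]) (use U(1) injU nrm q H_U ev in \<open>simp add: diagonalizes_def\<close>)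
qed

section \<open>Courant--Fischer characterization of the eigenvalues\<close>

lemma coordinate_subspace:
  assumes "I \<subseteq> {..<n}" "m \<le> card I"
  obtains E :: "complex mat" where "E \<in> carrier_mat n m" "inj_mat E"
    "\<And>y i. y \<in> carrier_vec m \<Longrightarrow> i < n \<Longrightarrow> i \<notin> I \<Longrightarrow> (E *\<^sub>v y) $ i = 0"
proof -
  have "finite I" using assms(1) finite_subset by blast
  from obtain_subset_with_card_n[OF assms(2)] obtain J where J: "J \<subseteq> I" "card J = m" "finite J" by metis
  then obtain f where f: "bij_betw f {..<m} J"
    using ex_bij_betw_nat_finite[of J] by (auto simp: atLeast0LessThan)
  then have fJ: "f j \<in> J" if "j < m" for j using that by (auto simp: bij_betw_def)
  have inj: "f i = f j \<longleftrightarrow> i = j" if "i < m" "j < m" for i j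
    using f that by (auto simp: bij_betw_def inj_on_def)
  define E :: "complex mat" where "E = mat n m (\<lambda>(i,j). if i = f j then 1 else 0)"
  have E: "E \<in> carrier_mat n m" by (simp add: E_def)
  have Ef: "(E *\<^sub>v y) $ f j = y $ j" if "y \<in> carrier_vec m" "j < m" for y j
  proof -
    have "f j < n" using fJ[OF that(2)] J assms by auto
    moreover have "row E (f j) = unit_vec m j"
      by (rule eq_vecI) (use \<open>f j < n\<close> inj that in \<open>auto simp: E_def unit_vec_def\<close>)
    ultimately show ?thesis using E that by simp
  qed
  have E0: "(E *\<^sub>v y) $ i = 0" if "y \<in> carrier_vec m" "i < n" "i \<notin> I" for y i
  proof -
    have "row E i = 0\<^sub>v m"
      by (rule eq_vecI) (use that fJ J in \<open>auto simp: E_def\<close>)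
    then show ?thesis using E that by simp
  qed
  have "inj_mat E"
  proof (rule inj_matI[OF E])
    fix y :: "complex vec" assume y: "y \<in> carrier_vec m" and 0: "E *\<^sub>v y = 0\<^sub>v n"
    show "y = 0\<^sub>v m"
    proof (rule eq_vecI)
      fix j assume "j < dim_vec (0\<^sub>v m :: complex vec)"
      then have j: "j < m" by simp
      then have "f j < n" using fJ[OF j] J assms by auto
      then show "y $ j = 0\<^sub>v m $ j" using Ef[OF y j] 0 j by simp
    qed (use y in auto)
  qed
  then show thesis using that E E0 by blast
qed

text \<open>Sylvester's inertia argument: a nonnegative subspace of too large a dimension would meet
  the span of the coordinates with negative coefficient, where the form is strictly negative away
  from zero. \<open>g\<close> is an arbitrary function so that a threshold or a sign can be absorbed
  into the coefficients.\<close>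

lemma nonneg_subspace_iff:
  fixes g :: "complex vec \<Rightarrow> real" and e :: "nat \<Rightarrow> real"
  assumes U: "U \<in> carrier_mat n n" "inj_mat U"
    and g: "\<And>z. z \<in> carrier_vec n \<Longrightarrow> g (U *\<^sub>v z) = (\<Sum>i<n. e i * (cmod (z $ i))\<^sup>2)"
  shows "(\<exists>X \<in> carrier_mat n k. inj_mat X \<and> (\<forall>y \<in> carrier_vec k. 0 \<le> g (X *\<^sub>v y))) \<longleftrightarrow>
    k \<le> card {i. i < n \<and> 0 \<le> e i}" (is "?L \<longleftrightarrow> k \<le> card ?P")
proof
  assume ?L
  then obtain X where X: "X \<in> carrier_mat n k" "inj_mat X" "\<And>y. y \<in> carrier_vec k \<Longrightarrow> 0 \<le> g (X *\<^sub>v y)" by auto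
  show "k \<le> card ?P"
  proof (rule ccontr)
    assume "\<not> k \<le> card ?P"
    let ?N = "{i. i < n \<and> e i < 0}"
    have "?P \<union> ?N = {..<n}" "?P \<inter> ?N = {}" by auto
    then have "card ?P + card ?N = n" using card_Un_disjoint[of ?P ?N] by simp
    then have gt: "k + card ?N > n" using \<open>\<not> k \<le> card ?P\<close> by simp
    obtain E where E: "E \<in> carrier_mat n (card ?N)" "inj_mat E"
      "\<And>y i. y \<in> carrier_vec (card ?N) \<Longrightarrow> i < n \<Longrightarrow> i \<notin> ?N \<Longrightarrow> (E *\<^sub>v y) $ i = 0"
      using coordinate_subspace[of ?N n "card ?N"] by blast
    from inj_mats_meet[OF X(1,2) mult_carrier_mat[OF U(1) E(1)] inj_mat_mult[OF U(2) E(2) U(1) E(1)] gt]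
    obtain x w where xw: "x \<in> carrier_vec k" "w \<in> carrier_vec (card ?N)" "X *\<^sub>v x = U * E *\<^sub>v w" "w \<noteq> 0\<^sub>v (card ?N)" .
    let ?z = "E *\<^sub>v w"
    have z: "?z \<in> carrier_vec n" using E xw by simp
    have "?z \<noteq> 0\<^sub>v n" using inj_matD[OF E(2,1)] xw by auto
    then obtain p where p: "p < n" "?z $ p \<noteq> 0" using z by (metis carrier_vecD eq_vecI index_zero_vec)
    then have "e p < 0" using E(3)[OF xw(2) p(1)] by blast
    have "g (X *\<^sub>v x) = (\<Sum>i<n. e i * (cmod (?z $ i))\<^sup>2)"
      using g[OF z] xw(3) assoc_mult_mat_vec[OF U(1) E(1) xw(2)] by simp
    also have "\<dots> = e p * (cmod (?z $ p))\<^sup>2 + (\<Sum>i\<in>{..<n} - {p}. e i * (cmod (?z $ i))\<^sup>2)"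
      using p by (subst sum.remove[of _ p]) auto
    also have "(\<Sum>i\<in>{..<n} - {p}. e i * (cmod (?z $ i))\<^sup>2) \<le> 0"
    proof (rule sum_nonpos)
      fix i assume "i \<in> {..<n} - {p}"
      then show "e i * (cmod (?z $ i))\<^sup>2 \<le> 0"
        using E(3)[OF xw(2), of i] by (cases "e i < 0") (auto simp del: index_mult_mat_vec intro: mult_nonpos_nonneg)
    qed
    also have "e p * (cmod (?z $ p))\<^sup>2 + 0 < 0"
      using \<open>e p < 0\<close> p(2) by (simp add: mult_neg_pos del: index_mult_mat_vec)
    finally show False using X(3)[OF xw(1)] by simp
  qed
next
  assume "k \<le> card ?P"
  then obtain E where E: "E \<in> carrier_mat n k" "inj_mat E"
      "\<And>y i. y \<in> carrier_vec k \<Longrightarrow> i < n \<Longrightarrow> i \<notin> ?P \<Longrightarrow> (E *\<^sub>v y) $ i = 0"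
    using coordinate_subspace[of ?P n k] by blast
  have "0 \<le> g (U * E *\<^sub>v y)" if y: "y \<in> carrier_vec k" for y
  proof -
    have "0 \<le> e i * (cmod ((E *\<^sub>v y) $ i))\<^sup>2" if "i < n" for i
      using E(3)[OF y, of i] that by (cases "0 \<le> e i") (auto simp del: index_mult_mat_vec)
    then have "0 \<le> g (U *\<^sub>v (E *\<^sub>v y))"
      unfolding g[OF mult_mat_vec_carrier[OF E(1) y]] by (intro sum_nonneg) auto
    then show ?thesis using assoc_mult_mat_vec[OF U(1) E(1) y] by simp
  qed
  then show ?L using inj_mat_mult[OF U(2) E(2) U(1) E(1)] U E
    by (intro bexI[of _ "U * E"]) auto
qed

text \<open>Courant-Fischer in threshold form: comparing with every \<open>t\<close> replaces taking
  a maximum over subspaces, and each \<open>t\<close> only shifts the coefficients in the inertia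
  count.\<close>

lemma le_nth_eigenvalue_iff:
  assumes H: "H \<in> carrier_mat n n" "mat_adjoint H = H" and k: "1 \<le> k" "k \<le> n"
  shows "t \<le> nth_eigenvalue H k \<longleftrightarrow>
    (\<exists>X \<in> carrier_mat n k. inj_mat X \<and> (\<forall>y \<in> carrier_vec k. t * nrm2 (X *\<^sub>v y) \<le> Re (sesq H (X *\<^sub>v y) (X *\<^sub>v y))))"
proof -
  obtain U d where diag: "diagonalizes n H U d"
    using hermitian_diagonalization[OF H] by blast
  note U = diagonalizesD(1,2)[OF diag] and nrm = diagonalizesD(3)[OF diag]
    and q = diagonalizesD(4)[OF diag] and H_U = diagonalizesD(5)[OF diag] and ev = diagonalizesD(6)[OF diag]
  let ?g = "\<lambda>x. Re (sesq H x x) - t * nrm2 x"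
  have g: "?g (U *\<^sub>v z) = (\<Sum>i<n. (d i - t) * (cmod (z $ i))\<^sup>2)" if z: "z \<in> carrier_vec n" for z
    by (simp add: nrm[OF z] q[OF z] left_diff_distrib sum_subtractf sum_distrib_left)
  have "t \<le> nth_eigenvalue H k \<longleftrightarrow> k \<le> card {i. i < n \<and> t \<le> d i}"
    by (rule ev[OF k]) auto
  also have "\<dots> \<longleftrightarrow> k \<le> card {i. i < n \<and> 0 \<le> d i - t}" by simp
  also have "\<dots> \<longleftrightarrow> (\<exists>X \<in> carrier_mat n k. inj_mat X \<and> (\<forall>y \<in> carrier_vec k. 0 \<le> ?g (X *\<^sub>v y)))"
    using nonneg_subspace_iff[of U n ?g "\<lambda>i. d i - t", OF U g, of k] by blast
  finally show ?thesis by simp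
qed

text \<open>Complementary counting: at least \<open>k\<close> of the numbers \<open>- d i\<close>
  reach \<open>t\<close> exactly if fewer than \<open>n - k + 1\<close> of the \<open>d i\<close>
  exceed \<open>- t\<close>. Two reals below which the same \<open>t\<close> lie are equal.\<close>

lemma nth_eigenvalue_uminus:
  assumes H: "H \<in> carrier_mat n n" "mat_adjoint H = H" and k: "1 \<le> k" "k \<le> n"
    and H': "H' \<in> carrier_mat n n" "mat_adjoint H' = H'"
      "\<And>x. x \<in> carrier_vec n \<Longrightarrow> Re (sesq H' x x) = - Re (sesq H x x)"
  shows "nth_eigenvalue H' k = - nth_eigenvalue H (n - k + 1)"
proof -
  obtain U d where diag: "diagonalizes n H U d"
    using hermitian_diagonalization[OF H] by blast
  note U = diagonalizesD(1,2)[OF diag] and nrm = diagonalizesD(3)[OF diag]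
    and q = diagonalizesD(4)[OF diag] and H_U = diagonalizesD(5)[OF diag] and ev = diagonalizesD(6)[OF diag]
  have "t \<le> nth_eigenvalue H' k \<longleftrightarrow> t \<le> - nth_eigenvalue H (n - k + 1)" for t
  proof -
    let ?g = "\<lambda>x. Re (sesq H' x x) - t * nrm2 x"
    have g: "?g (U *\<^sub>v z) = (\<Sum>i<n. (- d i - t) * (cmod (z $ i))\<^sup>2)" if z: "z \<in> carrier_vec n" for z
      using H'(3)[of "U *\<^sub>v z"] z U
      by (simp add: nrm[OF z] q[OF z] left_diff_distrib sum_subtractf sum_distrib_left sum_negf)
    have "t \<le> nth_eigenvalue H' k \<longleftrightarrow>
       (\<exists>X \<in> carrier_mat n k. inj_mat X \<and> (\<forall>y \<in> carrier_vec k. 0 \<le> ?g (X *\<^sub>v y)))"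
      using le_nth_eigenvalue_iff[OF H'(1,2) k, of t] by simp
    also have "\<dots> \<longleftrightarrow> k \<le> card {i. i < n \<and> 0 \<le> - d i - t}"
      using nonneg_subspace_iff[of U n ?g "\<lambda>i. - d i - t", OF U g, of k] by blast
    also have "\<dots> \<longleftrightarrow> \<not> (n - k + 1 \<le> card {i. i < n \<and> - t < d i})"
    proof -
      let ?P = "{i. i < n \<and> 0 \<le> - d i - t}" and ?N = "{i. i < n \<and> - t < d i}"
      have "?P \<union> ?N = {..<n}" "?P \<inter> ?N = {}" by auto
      then have "card ?P + card ?N = n" using card_Un_disjoint[of ?P ?N] by simp
      then show ?thesis using k by linarith
    qed
    also have "\<dots> \<longleftrightarrow> \<not> (- t < nth_eigenvalue H (n - k + 1))"
      using ev[of "n - k + 1" "\<lambda>x. - t < x"] k by auto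
    finally show ?thesis by auto
  qed
  then show ?thesis by (meson order_antisym order_refl)
qed

lemma nth_eigenvalue_antimono:
  assumes H: "H \<in> carrier_mat n n" "mat_adjoint H = H" and "1 \<le> j" "j \<le> k" "k \<le> n"
  shows "nth_eigenvalue H k \<le> nth_eigenvalue H j"
proof -
  obtain U d where diag: "diagonalizes n H U d"
    using hermitian_diagonalization[OF H] by blast
  note U = diagonalizesD(1,2)[OF diag] and nrm = diagonalizesD(3)[OF diag]
    and q = diagonalizesD(4)[OF diag] and H_U = diagonalizesD(5)[OF diag] and ev = diagonalizesD(6)[OF diag]
  have "k \<le> card {i. i < n \<and> nth_eigenvalue H k \<le> d i}"
    using ev[of k "\<lambda>x. nth_eigenvalue H k \<le> x"] assms by auto
  then have "j \<le> card {i. i < n \<and> nth_eigenvalue H k \<le> d i}" using assms by simp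
  then show ?thesis using ev[of j "\<lambda>x. nth_eigenvalue H k \<le> x"] assms by auto
qed

section \<open>Eigenvalues of Hermitian parts and their continuity\<close>

lemma re_mat_carrier[simp]: "A \<in> carrier_mat n n \<Longrightarrow> re_mat A \<in> carrier_mat n n"
  by (simp add: re_mat_def)

lemma mat_adjoint_re_mat: "A \<in> carrier_mat n n \<Longrightarrow> mat_adjoint (re_mat A) = re_mat A"
  by (rule eq_matI) (auto simp: re_mat_def)

lemma sesq_re_mat:
  assumes "A \<in> carrier_mat n n" "x \<in> carrier_vec n" "y \<in> carrier_vec n"
  shows "sesq (re_mat A) x y = (sesq A x y + cnj (sesq A y x)) / 2"
  unfolding re_mat_def using assms
  by (subst sesq_smult_mat[of _ n]) (auto simp: sesq_add_mat[of _ n] sesq_mat_adjoint[of _ n])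

lemma sesq_re_mat_self:
  assumes "A \<in> carrier_mat n n" "x \<in> carrier_vec n"
  shows "sesq (re_mat A) x x = of_real (Re (sesq A x x))"
  by (simp add: sesq_re_mat[OF assms assms(2)] complex_eq_iff)

text \<open>Defined for arbitrary matrices so that a direction can be put into a scalar factor:
  \<open>eig_fun k A \<theta>\<close> is \<open>lam k\<close> of \<open>A\<close> rotated by
  \<open>cis (- \<theta>)\<close>.\<close>

definition lam :: "nat \<Rightarrow> complex mat \<Rightarrow> real" where
  "lam k A = nth_eigenvalue (re_mat A) k"

context
  fixes n k :: nat
  assumes k: "1 \<le> k" "k \<le> n"
begin

lemma le_lam_iff:
  assumes A: "A \<in> carrier_mat n n"
  shows "t \<le> lam k A \<longleftrightarrow>
    (\<exists>X \<in> carrier_mat n k. inj_mat X \<and> (\<forall>y \<in> carrier_vec k. t * nrm2 (X *\<^sub>v y) \<le> Re (sesq A (X *\<^sub>v y) (X *\<^sub>v y))))"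
proof -
  have "Re (sesq (re_mat A) (X *\<^sub>v y) (X *\<^sub>v y)) = Re (sesq A (X *\<^sub>v y) (X *\<^sub>v y))"
    if "X \<in> carrier_mat n k" "y \<in> carrier_vec k" for X y
    using sesq_re_mat_self[OF A, of "X *\<^sub>v y"] that by simp
  then show ?thesis
    unfolding lam_def using le_nth_eigenvalue_iff[OF re_mat_carrier[OF A] mat_adjoint_re_mat[OF A] k, of t] by auto
qed

text \<open>A subspace that is optimal for \<open>A\<close> is a test subspace for \<open>B\<close>.
  This one estimate yields both the exact shift rule and the Lipschitz bound in the
  direction.\<close>

lemma lam_mono:
  assumes A: "A \<in> carrier_mat n n" and B: "B \<in> carrier_mat n n"
    and AB: "\<And>x. x \<in> carrier_vec n \<Longrightarrow> Re (sesq A x x) \<le> Re (sesq B x x) + c * nrm2 x"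
  shows "lam k A \<le> lam k B + c"
proof -
  obtain X where X: "X \<in> carrier_mat n k" "inj_mat X"
    and AX: "\<And>y. y \<in> carrier_vec k \<Longrightarrow> lam k A * nrm2 (X *\<^sub>v y) \<le> Re (sesq A (X *\<^sub>v y) (X *\<^sub>v y))"
    using le_lam_iff[OF A, of "lam k A"] by auto
  have "(lam k A - c) * nrm2 (X *\<^sub>v y) \<le> Re (sesq B (X *\<^sub>v y) (X *\<^sub>v y))" if "y \<in> carrier_vec k" for y
    using AX[OF that] AB[of "X *\<^sub>v y"] X that by (simp add: left_diff_distrib)
  then have "lam k A - c \<le> lam k B" using le_lam_iff[OF B] X by blast
  then show ?thesis by simp
qed

lemma lam_shift:
  assumes A: "A \<in> carrier_mat n n" and B: "B \<in> carrier_mat n n"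
    and AB: "\<And>x. x \<in> carrier_vec n \<Longrightarrow> Re (sesq A x x) = Re (sesq B x x) + c * nrm2 x"
  shows "lam k A = lam k B + c"
  using lam_mono[OF A B, of c] lam_mono[OF B A, of "-c"] AB by force

end

lemma sesq_bound:
  assumes A: "A \<in> carrier_mat n n"
  obtains M where "M \<ge> 0" "\<And>x. x \<in> carrier_vec n \<Longrightarrow> cmod (sesq A x x) \<le> M * nrm2 x"
proof -
  let ?M = "\<Sum>i<n. \<Sum>j<n. cmod (A $$ (i,j))"
  have "cmod (sesq A x x) \<le> ?M * nrm2 x" if x: "x \<in> carrier_vec n" for x
  proof -
    have xi: "cmod (x $ i) \<le> sqrt (nrm2 x)" if "i < n" for i
      unfolding nrm2_eq[OF x] using that
      by (intro real_le_rsqrt) (auto intro!: member_le_sum[of i "{..<n}" "\<lambda>i. (cmod (x $ i))\<^sup>2"])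
    have "sesq A x x = (\<Sum>i<n. \<Sum>j<n. A $$ (i,j) * x $ j * cnj (x $ i))"
      using A x by (auto simp: sesq_def scalar_prod_def sum_distrib_right atLeast0LessThan intro!: sum.cong)
    also have "cmod \<dots> \<le> (\<Sum>i<n. \<Sum>j<n. cmod (A $$ (i,j)) * nrm2 x)"
    proof (intro sum_norm_le)
      fix i j assume ij: "i \<in> {..<n}" "j \<in> {..<n}"
      have "cmod (x $ j) * cmod (x $ i) \<le> sqrt (nrm2 x) * sqrt (nrm2 x)"
        using xi ij nrm2_nonneg[of x] by (intro mult_mono) auto
      then have "cmod (x $ j) * cmod (x $ i) \<le> nrm2 x" using nrm2_nonneg[of x] by simp
      then show "cmod (A $$ (i,j) * x $ j * cnj (x $ i)) \<le> cmod (A $$ (i,j)) * nrm2 x"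
        by (simp add: norm_mult mult.assoc mult_left_mono)
    qed
    also have "\<dots> = ?M * nrm2 x" by (simp add: sum_distrib_right)
    finally show ?thesis .
  qed
  then show thesis by (intro that[of ?M]) (auto intro!: sum_nonneg)
qed

lemma continuous_on_lam:
  assumes A: "A \<in> carrier_mat n n" and k: "1 \<le> k" "k \<le> n"
  shows "continuous_on UNIV (\<lambda>z. lam k (z \<cdot>\<^sub>m A))"
proof -
  obtain M where M: "M \<ge> 0" "\<And>x. x \<in> carrier_vec n \<Longrightarrow> cmod (sesq A x x) \<le> M * nrm2 x"
    using sesq_bound[OF A] by blast
  have le: "lam k (z \<cdot>\<^sub>m A) \<le> lam k (w \<cdot>\<^sub>m A) + M * dist z w" for z w
  proof (rule lam_mono[OF k])
    fix x :: "complex vec" assume x: "x \<in> carrier_vec n"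
    have "Re (z * sesq A x x) - Re (w * sesq A x x) \<le> cmod ((z - w) * sesq A x x)"
      using complex_Re_le_cmod[of "(z - w) * sesq A x x"] by (simp add: algebra_simps)
    also have "\<dots> \<le> dist z w * (M * nrm2 x)"
      unfolding norm_mult dist_norm by (intro mult_left_mono M x) auto
    finally show "Re (sesq (z \<cdot>\<^sub>m A) x x) \<le> Re (sesq (w \<cdot>\<^sub>m A) x x) + M * dist z w * nrm2 x"
      using x A by (simp add: sesq_smult_mat[of A n] mult_ac)
  qed (use A in auto)
  have "M-lipschitz_on UNIV (\<lambda>z. lam k (z \<cdot>\<^sub>m A))"
  proof (rule lipschitz_onI)
    fix z w :: complex
    show "dist (lam k (z \<cdot>\<^sub>m A)) (lam k (w \<cdot>\<^sub>m A)) \<le> M * dist z w"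
      using le[of z w] le[of w z] by (auto simp: dist_real_def dist_commute abs_le_iff)
  qed (use M in auto)
  then show ?thesis by (rule lipschitz_on_continuous_on)
qed

text \<open>At most \<open>k - 1\<close> of the \<open>d i\<close> are positive, so
  \<open>n - k + 1\<close> coordinates remain; this is just enough to meet every
  \<open>k\<close>-dimensional subspace. On these coordinates the form is semidefinite, so a
  vanishing value forces every term \<open>d i * z i\<close> to vanish, which gives a kernel vector
  and not merely a null vector.\<close>

lemma nonpos_subspace:
  assumes A: "A \<in> carrier_mat n n" and k: "1 \<le> k" "k \<le> n" and le: "lam k A \<le> 0"
  obtains W where "W \<in> carrier_mat n (n - k + 1)" "inj_mat W"
    "\<And>y. y \<in> carrier_vec (n - k + 1) \<Longrightarrow> Re (sesq A (W *\<^sub>v y) (W *\<^sub>v y)) \<le> 0"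
    "\<And>y. y \<in> carrier_vec (n - k + 1) \<Longrightarrow> Re (sesq A (W *\<^sub>v y) (W *\<^sub>v y)) = 0 \<Longrightarrow> re_mat A *\<^sub>v (W *\<^sub>v y) = 0\<^sub>v n"
proof -
  let ?H = "re_mat A" and ?m = "n - k + 1"
  obtain U d where diag: "diagonalizes n ?H U d"
    using hermitian_diagonalization[OF re_mat_carrier[OF A] mat_adjoint_re_mat[OF A]] by blast
  note U = diagonalizesD(1,2)[OF diag] and nrm = diagonalizesD(3)[OF diag]
    and q = diagonalizesD(4)[OF diag] and H_U = diagonalizesD(5)[OF diag] and ev = diagonalizesD(6)[OF diag]
  let ?P = "{i. i < n \<and> 0 < d i}" and ?N = "{i. i < n \<and> d i \<le> 0}"
  have "\<not> k \<le> card ?P" using ev[OF k, of "\<lambda>x. 0 < x"] le by (auto simp: lam_def)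
  moreover have "card ?P + card ?N = n"
  proof -
    have "?P \<union> ?N = {..<n}" "?P \<inter> ?N = {}" by auto
    then show ?thesis using card_Un_disjoint[of ?P ?N] by simp
  qed
  ultimately have "?m \<le> card ?N" using k by linarith
  then obtain E where E: "E \<in> carrier_mat n ?m" "inj_mat E"
      "\<And>y i. y \<in> carrier_vec ?m \<Longrightarrow> i < n \<Longrightarrow> i \<notin> ?N \<Longrightarrow> (E *\<^sub>v y) $ i = 0"
    using coordinate_subspace[of ?N n ?m] by blast
  let ?W = "U * E"
  have W: "?W \<in> carrier_mat n ?m" using U E by simp
  have Wy: "?W *\<^sub>v y = U *\<^sub>v (E *\<^sub>v y)" if "y \<in> carrier_vec ?m" for y
    using assoc_mult_mat_vec[OF U(1) E(1) that] .
  have qW: "Re (sesq A (?W *\<^sub>v y) (?W *\<^sub>v y)) = (\<Sum>i<n. d i * (cmod ((E *\<^sub>v y) $ i))\<^sup>2)" if y: "y \<in> carrier_vec ?m" for y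
  proof -
    have c: "E *\<^sub>v y \<in> carrier_vec n" "?W *\<^sub>v y \<in> carrier_vec n" using y E W by auto
    have "Re (sesq A (?W *\<^sub>v y) (?W *\<^sub>v y)) = Re (sesq ?H (?W *\<^sub>v y) (?W *\<^sub>v y))"
      using sesq_re_mat_self[OF A c(2)] by simp
    then show ?thesis using q[OF c(1)] by (simp add: Wy[OF y] del: index_mult_mat_vec)
  qed
  have nonpos: "d i * (cmod ((E *\<^sub>v y) $ i))\<^sup>2 \<le> 0" if "y \<in> carrier_vec ?m" "i < n" for y i
    using E(3)[OF that] that by (cases "d i \<le> 0") (auto simp del: index_mult_mat_vec intro: mult_nonpos_nonneg)
  show thesis
  proof (rule that[OF W inj_mat_mult[OF U(2) E(2) U(1) E(1)]])
    fix y :: "complex vec" assume y: "y \<in> carrier_vec ?m"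
    show "Re (sesq A (?W *\<^sub>v y) (?W *\<^sub>v y)) \<le> 0"
      unfolding qW[OF y] using nonpos[OF y] by (intro sum_nonpos) auto
    assume "Re (sesq A (?W *\<^sub>v y) (?W *\<^sub>v y)) = 0"
    then have "(\<Sum>i<n. - (d i * (cmod ((E *\<^sub>v y) $ i))\<^sup>2)) = 0" unfolding qW[OF y] by (simp add: sum_negf)
    then have "- (d i * (cmod ((E *\<^sub>v y) $ i))\<^sup>2) = 0" if "i < n" for i
      using sum_nonneg_eq_0_iff[of "{..<n}" "\<lambda>i. - (d i * (cmod ((E *\<^sub>v y) $ i))\<^sup>2)"] nonpos[OF y] that by auto
    then have "vec n (\<lambda>i. of_real (d i) * (E *\<^sub>v y) $ i) = 0\<^sub>v n"
      by (intro eq_vecI) (auto simp del: index_mult_mat_vec)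
    then show "?H *\<^sub>v (?W *\<^sub>v y) = 0\<^sub>v n"
      using H_U[of "E *\<^sub>v y"] E y U by (simp add: Wy[OF y] del: index_mult_mat_vec)
  qed
qed

section \<open>Isotropic subspaces\<close>

definition nonneg_dim :: "nat \<Rightarrow> nat \<Rightarrow> complex mat \<Rightarrow> complex \<Rightarrow> bool" where
  "nonneg_dim n k A z \<longleftrightarrow> (\<exists>X \<in> carrier_mat n k. inj_mat X \<and>
     (\<forall>y \<in> carrier_vec k. 0 \<le> Re (z * sesq A (X *\<^sub>v y) (X *\<^sub>v y))))"

text \<open>Only the quadratic form is required to vanish, which matches \<open>nonneg_dim\<close>;
  over the complex numbers polarization recovers the vanishing of the whole form.\<close>

definition isotropic_dim :: "nat \<Rightarrow> nat \<Rightarrow> complex mat \<Rightarrow> bool" where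
  "isotropic_dim n k A \<longleftrightarrow> (\<exists>X \<in> carrier_mat n k. inj_mat X \<and>
     (\<forall>y \<in> carrier_vec k. sesq A (X *\<^sub>v y) (X *\<^sub>v y) = 0))"

lemma nonneg_dim_iff_lam:
  assumes "A \<in> carrier_mat n n" "1 \<le> k" "k \<le> n"
  shows "nonneg_dim n k A z \<longleftrightarrow> 0 \<le> lam k (z \<cdot>\<^sub>m A)"
proof -
  have "sesq (z \<cdot>\<^sub>m A) (X *\<^sub>v y) (X *\<^sub>v y) = z * sesq A (X *\<^sub>v y) (X *\<^sub>v y)"
    if "X \<in> carrier_mat n k" "y \<in> carrier_vec k" for X y
    using that assms by (simp add: sesq_smult_mat[of A n])
  then show ?thesis
    unfolding nonneg_dim_def using le_lam_iff[OF assms(2,3), of "z \<cdot>\<^sub>m A" 0] assms(1) by auto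
qed

lemma nonneg_dim_le: "nonneg_dim n k A z \<Longrightarrow> k \<le> n"
  unfolding nonneg_dim_def using inj_mat_le by blast

section \<open>Restricting, cutting and enlarging subspaces\<close>

lemma isotropic_dim_restrict:
  assumes "A \<in> carrier_mat n n" "Y \<in> carrier_mat n m" "inj_mat Y"
    "isotropic_dim m k (mat_adjoint Y * A * Y)"
  shows "isotropic_dim n k A"
proof -
  obtain X where X: "X \<in> carrier_mat m k" "inj_mat X"
    "\<And>y. y \<in> carrier_vec k \<Longrightarrow> sesq (mat_adjoint Y * A * Y) (X *\<^sub>v y) (X *\<^sub>v y) = 0"
    using assms(4) unfolding isotropic_dim_def by auto
  have "sesq A (Y * X *\<^sub>v y) (Y * X *\<^sub>v y) = 0" if y: "y \<in> carrier_vec k" for y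
    unfolding assoc_mult_mat_vec[OF assms(2) X(1) y]
    using X(3)[OF y] sesq_congruence[OF assms(1,2), of "X *\<^sub>v y" "X *\<^sub>v y"] X(1) y by simp
  then show ?thesis unfolding isotropic_dim_def
    using inj_mat_mult[OF assms(3) X(2) assms(2) X(1)] assms X(1) by (intro bexI[of _ "Y * X"]) auto
qed

lemma nonneg_dim_restrictI:
  assumes A: "A \<in> carrier_mat n n" and Y: "Y \<in> carrier_mat n m" and X: "X \<in> carrier_mat m k" "inj_mat X"
    and nn: "\<And>y. y \<in> carrier_vec k \<Longrightarrow> 0 \<le> Re (z * sesq A (Y *\<^sub>v (X *\<^sub>v y)) (Y *\<^sub>v (X *\<^sub>v y)))"
  shows "nonneg_dim m k (mat_adjoint Y * A * Y) z"
  unfolding nonneg_dim_def using X nn sesq_congruence[OF A Y] by (intro bexI[of _ X]) auto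

text \<open>A subspace inside the hyperplane is rewritten in the coordinates of the hyperplane:
  \<open>L\<close> pulls it back and \<open>Y\<close> returns it unchanged.\<close>

lemma subspace_in_hyperplane:
  assumes L: "L \<in> carrier_mat m n" and Y: "Y \<in> carrier_mat n m"
    and YL: "\<And>x. x \<in> carrier_vec n \<Longrightarrow> g \<bullet> x = 0 \<Longrightarrow> Y *\<^sub>v (L *\<^sub>v x) = x"
    and X: "X \<in> carrier_mat n k" "inj_mat X" and gX: "\<And>y. y \<in> carrier_vec k \<Longrightarrow> g \<bullet> (X *\<^sub>v y) = 0"
  obtains X' where "X' \<in> carrier_mat m k" "inj_mat X'" "\<And>y. y \<in> carrier_vec k \<Longrightarrow> Y *\<^sub>v (X' *\<^sub>v y) = X *\<^sub>v y"
proof -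
  have LX: "L * X \<in> carrier_mat m k" using L X by simp
  have eq: "Y *\<^sub>v (L * X *\<^sub>v y) = X *\<^sub>v y" if y: "y \<in> carrier_vec k" for y
    unfolding assoc_mult_mat_vec[OF L X(1) y] using YL gX[OF y] X(1) y by simp
  have "inj_mat (L * X)"
  proof (rule inj_matI[OF LX])
    fix y assume y: "y \<in> carrier_vec k" "L * X *\<^sub>v y = 0\<^sub>v m"
    then have "X *\<^sub>v y = 0\<^sub>v n" using eq[OF y(1)] Y by simp
    then show "y = 0\<^sub>v k" using inj_matD[OF X(2,1) y(1)] by simp
  qed
  then show thesis using that LX eq by blast
qed

lemma cut_subspace:
  assumes X: "X \<in> carrier_mat n k" "inj_mat X" and k: "1 \<le> k" and g: "g \<in> carrier_vec n"
  obtains X' where "X' \<in> carrier_mat n (k - 1)" "inj_mat X'"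
    "\<And>y. y \<in> carrier_vec (k - 1) \<Longrightarrow> g \<bullet> (X' *\<^sub>v y) = 0"
    "\<And>y. y \<in> carrier_vec (k - 1) \<Longrightarrow> \<exists>w \<in> carrier_vec k. X' *\<^sub>v y = X *\<^sub>v w"
proof -
  define h where "h = transpose_mat X *\<^sub>v g"
  have h: "h \<in> carrier_vec k" using X g by (simp add: h_def)
  have hw: "h \<bullet> w = g \<bullet> (X *\<^sub>v w)" if "w \<in> carrier_vec k" for w
    unfolding h_def using transpose_vec_mult_scalar[OF X(1) that g] .
  \<comment> \<open>If the functional already vanishes on the range of \<open>X\<close>, some other
    coordinate functional is cut instead, so that the result has exactly \<open>k - 1\<close>
    columns in all cases.\<close>
  define h' where "h' = (if h = 0\<^sub>v k then unit_vec k 0 else h)"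
  have h': "h' \<in> carrier_vec k" "h' \<noteq> 0\<^sub>v k" using h k unit_vec_nonzero[of k 0] by (auto simp: h'_def)
  from hyperplane_basis[OF h'] obtain Z M where Z: "Z \<in> carrier_mat k (k - 1)"
    and M: "M \<in> carrier_mat (k - 1) k" "M * Z = 1\<^sub>m (k - 1)"
    and hZ: "\<And>y. y \<in> carrier_vec (k - 1) \<Longrightarrow> h' \<bullet> (Z *\<^sub>v y) = 0" by metis
  have XZ: "X * Z *\<^sub>v y = X *\<^sub>v (Z *\<^sub>v y)" if "y \<in> carrier_vec (k - 1)" for y
    using assoc_mult_mat_vec[OF X(1) Z that] .
  have injZ: "inj_mat Z" using inj_mat_left_inverse[OF M(2) Z M(1)] .
  show thesis
  proof (rule that[of "X * Z"])
    show "inj_mat (X * Z)" using inj_mat_mult[OF X(2) injZ X(1) Z] .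
    fix y :: "complex vec" assume y: "y \<in> carrier_vec (k - 1)"
    have Zy: "Z *\<^sub>v y \<in> carrier_vec k" using Z y by simp
    have "h \<bullet> (Z *\<^sub>v y) = 0" using hZ[OF y] Zy by (cases "h = 0\<^sub>v k") (auto simp: h'_def)
    then show "g \<bullet> (X * Z *\<^sub>v y) = 0" using hw[OF Zy] by (simp add: XZ[OF y])
    show "\<exists>w \<in> carrier_vec k. X * Z *\<^sub>v y = X *\<^sub>v w" using Zy XZ[OF y] by blast
  qed (use X Z in auto)
qed

lemma add_vec_subspace:
  assumes X: "X \<in> carrier_mat n j" "inj_mat X" and v: "v \<in> carrier_vec n"
    and nin: "\<And>y. y \<in> carrier_vec j \<Longrightarrow> X *\<^sub>v y \<noteq> v"
  obtains X' where "X' \<in> carrier_mat n (j + 1)" "inj_mat X'"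
    "\<And>y. y \<in> carrier_vec (j + 1) \<Longrightarrow> \<exists>w \<in> carrier_vec j. \<exists>c. X' *\<^sub>v y = X *\<^sub>v w + c \<cdot>\<^sub>v v"
proof -
  define V where "V = mat n 1 (\<lambda>(i,j). v $ i)"
  have V: "V \<in> carrier_mat n 1" by (simp add: V_def)
  have Vc: "V *\<^sub>v c = (c $ 0) \<cdot>\<^sub>v v" if "c \<in> carrier_vec 1" for c
    by (rule eq_vecI) (use that v in \<open>auto simp: V_def scalar_prod_def\<close>)
  have "inj_mat (hcat X V)"
  proof (rule ccontr)
    assume "\<not> inj_mat (hcat X V)"
    from inj_hcatD[OF X(1) V this] obtain x c where xc: "x \<in> carrier_vec j" "c \<in> carrier_vec 1"
      "X *\<^sub>v x + V *\<^sub>v c = 0\<^sub>v n" "x \<noteq> 0\<^sub>v j \<or> c \<noteq> 0\<^sub>v 1" .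
    have Xx: "X *\<^sub>v x \<in> carrier_vec n" using X xc by simp
    show False
    proof (cases "c $ 0 = 0")
      case True
      then have "c = 0\<^sub>v 1" by (intro eq_vecI) (use xc in auto)
      moreover have "0 \<cdot>\<^sub>v v = 0\<^sub>v n" by (rule eq_vecI) (use v in auto)
      then have "X *\<^sub>v x = 0\<^sub>v n" using xc Vc[OF xc(2)] True Xx by simp
      ultimately show False using inj_matD[OF X(2,1) xc(1)] xc(4) by simp
    next
      case False
      have "X *\<^sub>v ((- inverse (c $ 0)) \<cdot>\<^sub>v x) = v"
      proof (rule eq_vecI)
        fix i assume "i < dim_vec v"
        then have i: "i < n" using v by simp
        have "(X *\<^sub>v x + c $ 0 \<cdot>\<^sub>v v) $ i = 0" using xc(3) Vc[OF xc(2)] i by simp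
        then have "(X *\<^sub>v x) $ i + c $ 0 * v $ i = 0" using i v Xx by (subst (asm) index_add_vec) auto
        then have "(X *\<^sub>v x) $ i = - c $ 0 * v $ i" by (simp add: eq_neg_iff_add_eq_0)
        moreover have "(X *\<^sub>v ((- inverse (c $ 0)) \<cdot>\<^sub>v x)) $ i = - inverse (c $ 0) * (X *\<^sub>v x) $ i"
          using i mult_mat_vec[OF X(1) xc(1)] Xx by (metis carrier_vecD index_smult_vec(1))
        ultimately show "(X *\<^sub>v ((- inverse (c $ 0)) \<cdot>\<^sub>v x)) $ i = v $ i"
          using False by simp
      qed (use X v in auto)
      then show False using nin[of "(- inverse (c $ 0)) \<cdot>\<^sub>v x"] xc by simp
    qed
  qed
  moreover have "\<exists>w \<in> carrier_vec j. \<exists>c. hcat X V *\<^sub>v y = X *\<^sub>v w + c \<cdot>\<^sub>v v"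
    if y: "y \<in> carrier_vec (j + 1)" for y
  proof -
    from split_vec[OF y] obtain w c where "w \<in> carrier_vec j" "c \<in> carrier_vec 1" "y = w @\<^sub>v c" .
    then show ?thesis using hcat_mult_vec[OF X(1) V] Vc by auto
  qed
  ultimately show thesis using that[of "hcat X V"] hcat_carrier[OF X(1) V] by blast
qed

section \<open>Reducing the dimension along an isotropic vector\<close>

lemma sesq_add_smult_self:
  assumes "A \<in> carrier_mat n n" "x \<in> carrier_vec n" "v \<in> carrier_vec n"
  shows "sesq A (x + c \<cdot>\<^sub>v v) (x + c \<cdot>\<^sub>v v) =
    sesq A x x + cnj c * sesq A x v + c * sesq A v x + c * cnj c * sesq A v v"
  using assms by (simp add: sesq_simps[OF assms(1)] algebra_simps)

text \<open>A vector in the radical may be added to any isotropic subspace without changing the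
  form. So the problem is solved on the orthogonal complement of \<open>v\<close> with
  \<open>k - 1\<close>, and \<open>v\<close> supplies the missing dimension.\<close>

lemma isotropic_dim_radical:
  assumes A: "A \<in> carrier_mat n n" and v: "v \<in> carrier_vec n" "v \<noteq> 0\<^sub>v n" and k: "1 \<le> k"
    and rad: "\<And>x. x \<in> carrier_vec n \<Longrightarrow> sesq A v x = 0" "\<And>x. x \<in> carrier_vec n \<Longrightarrow> sesq A x v = 0"
    and nn: "\<And>z. cmod z = 1 \<Longrightarrow> nonneg_dim n k A z"
    and IH: "\<And>B. B \<in> carrier_mat (n - 1) (n - 1) \<Longrightarrow> (\<And>z. cmod z = 1 \<Longrightarrow> nonneg_dim (n - 1) (k - 1) B z) \<Longrightarrow>
               isotropic_dim (n - 1) (k - 1) B"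
  shows "isotropic_dim n k A"
proof -
  let ?g = "conjugate v"
  have g: "?g \<in> carrier_vec n" using v by (simp add: carrier_vec_conjugate)
  have gv: "?g \<bullet> v \<noteq> 0" using v g comm_scalar_prod[OF g v(1)] by simp
  have "?g \<noteq> 0\<^sub>v n" using gv v by auto
  from hyperplane_basis[OF g this] obtain Y L where
    Y: "Y \<in> carrier_mat n (n - 1)" and L: "L \<in> carrier_mat (n - 1) n" "L * Y = 1\<^sub>m (n - 1)"
    and YL: "\<And>x. x \<in> carrier_vec n \<Longrightarrow> ?g \<bullet> x = 0 \<Longrightarrow> Y *\<^sub>v (L *\<^sub>v x) = x"
    and gY: "\<And>y. y \<in> carrier_vec (n - 1) \<Longrightarrow> ?g \<bullet> (Y *\<^sub>v y) = 0" by blast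
  have injY: "inj_mat Y" using inj_mat_left_inverse[OF L(2) Y L(1)] .
  let ?B = "mat_adjoint Y * A * Y"
  have aY: "mat_adjoint Y \<in> carrier_mat (n - 1) n" using Y by simp
  have B: "?B \<in> carrier_mat (n - 1) (n - 1)" by (rule mult_carrier_mat[OF mult_carrier_mat[OF aY A] Y])
  have "isotropic_dim (n - 1) (k - 1) ?B"
  proof (rule IH[OF B])
    fix z :: complex assume "cmod z = 1"
    then obtain X where X: "X \<in> carrier_mat n k" "inj_mat X"
      and nnX: "\<And>y. y \<in> carrier_vec k \<Longrightarrow> 0 \<le> Re (z * sesq A (X *\<^sub>v y) (X *\<^sub>v y))"
      using nn unfolding nonneg_dim_def by blast
    from cut_subspace[OF X k g] obtain X' where X': "X' \<in> carrier_mat n (k - 1)" "inj_mat X'"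
      "\<And>y. y \<in> carrier_vec (k - 1) \<Longrightarrow> ?g \<bullet> (X' *\<^sub>v y) = 0"
      "\<And>y. y \<in> carrier_vec (k - 1) \<Longrightarrow> \<exists>w \<in> carrier_vec k. X' *\<^sub>v y = X *\<^sub>v w" by blast
    from subspace_in_hyperplane[OF L(1) Y YL X'(1-3)] obtain X'' where
      X'': "X'' \<in> carrier_mat (n - 1) (k - 1)" "inj_mat X''"
      "\<And>y. y \<in> carrier_vec (k - 1) \<Longrightarrow> Y *\<^sub>v (X'' *\<^sub>v y) = X' *\<^sub>v y" by blast
    show "nonneg_dim (n - 1) (k - 1) ?B z"
      by (rule nonneg_dim_restrictI[OF A Y X''(1,2)]) (use X''(3) X'(4) nnX in fastforce)
  qed
  then obtain X where X: "X \<in> carrier_mat (n - 1) (k - 1)" "inj_mat X"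
    and iso: "\<And>y. y \<in> carrier_vec (k - 1) \<Longrightarrow> sesq ?B (X *\<^sub>v y) (X *\<^sub>v y) = 0"
    unfolding isotropic_dim_def by blast
  have YX: "Y * X \<in> carrier_mat n (k - 1)" using Y X by simp
  have YXy: "Y * X *\<^sub>v y = Y *\<^sub>v (X *\<^sub>v y)" if "y \<in> carrier_vec (k - 1)" for y
    by (rule assoc_mult_mat_vec[OF Y X(1) that])
  have nin: "Y * X *\<^sub>v y \<noteq> v" if "y \<in> carrier_vec (k - 1)" for y
    using gY[of "X *\<^sub>v y"] gv X that by (auto simp: YXy)
  from add_vec_subspace[OF YX inj_mat_mult[OF injY X(2) Y X(1)] v(1) nin] obtain Z where
    Z: "Z \<in> carrier_mat n (k - 1 + 1)" "inj_mat Z"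
    "\<And>y. y \<in> carrier_vec (k - 1 + 1) \<Longrightarrow> \<exists>w \<in> carrier_vec (k - 1). \<exists>c. Z *\<^sub>v y = Y * X *\<^sub>v w + c \<cdot>\<^sub>v v" by blast
  have kk: "k - 1 + 1 = k" using k by simp
  have "sesq A (Z *\<^sub>v y) (Z *\<^sub>v y) = 0" if y: "y \<in> carrier_vec k" for y
  proof -
    from Z(3)[unfolded kk, OF y] obtain w c where w: "w \<in> carrier_vec (k - 1)" and Zy: "Z *\<^sub>v y = Y * X *\<^sub>v w + c \<cdot>\<^sub>v v" by blast
    have c: "Y * X *\<^sub>v w \<in> carrier_vec n" "X *\<^sub>v w \<in> carrier_vec (n - 1)" using YX X w by auto
    have "sesq A (Y * X *\<^sub>v w) (Y * X *\<^sub>v w) = 0"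
      using iso[OF w] sesq_congruence[OF A Y c(2) c(2)] by (simp add: YXy[OF w])
    then show ?thesis unfolding Zy sesq_add_smult_self[OF A c(1) v(1)] using rad c v by simp
  qed
  then show ?thesis unfolding isotropic_dim_def using Z kk by auto
qed

text \<open>The vector \<open>v\<close> is null for the real part of \<open>z\<close> times the form and orthogonal to the hyperplane, so it
  can replace the direction that a nonnegative subspace loses when it is cut with the hyperplane.\<close>

lemma nonneg_dim_hyperplane:
  assumes A: "A \<in> carrier_mat n n" and v: "v \<in> carrier_vec n" "v \<noteq> 0\<^sub>v n" and k: "1 \<le> k"
    and g: "g \<in> carrier_vec n" and gv: "g \<bullet> v = 0"
    and L: "L \<in> carrier_mat (n - 1) n" and Y: "Y \<in> carrier_mat n (n - 1)"
    and YL: "\<And>x. x \<in> carrier_vec n \<Longrightarrow> g \<bullet> x = 0 \<Longrightarrow> Y *\<^sub>v (L *\<^sub>v x) = x"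
    and Av: "\<And>x. x \<in> carrier_vec n \<Longrightarrow> sesq A v x = \<alpha> * cnj (g \<bullet> x)"
    and vA: "\<And>x. x \<in> carrier_vec n \<Longrightarrow> sesq A x v = \<beta> * (g \<bullet> x)"
    and z: "z * \<beta> + cnj (z * \<alpha>) \<noteq> 0"
    and nn: "nonneg_dim n k A z"
  shows "nonneg_dim (n - 1) k (mat_adjoint Y * A * Y) z"
proof -
  obtain X where X: "X \<in> carrier_mat n k" "inj_mat X"
    and nnX: "\<And>y. y \<in> carrier_vec k \<Longrightarrow> 0 \<le> Re (z * sesq A (X *\<^sub>v y) (X *\<^sub>v y))"
    using nn unfolding nonneg_dim_def by blast
  \<comment> \<open>The two cross terms merge into one because a number and its conjugate have the
    same real part; only the value of \<open>g\<close> at \<open>x\<close> remains.\<close>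
  have q: "Re (z * sesq A (x + c \<cdot>\<^sub>v v) (x + c \<cdot>\<^sub>v v)) =
      Re (z * sesq A x x) + Re (cnj c * (z * \<beta> + cnj (z * \<alpha>)) * (g \<bullet> x))" if x: "x \<in> carrier_vec n" for x c
  proof -
    have "Re (c * (z * \<alpha>) * cnj (g \<bullet> x)) = Re (cnj (c * (z * \<alpha>) * cnj (g \<bullet> x)))"
      by (rule cnj.simps(1)[symmetric])
    then have "Re (z * (c * (\<alpha> * cnj (g \<bullet> x)))) = Re (cnj c * cnj (z * \<alpha>) * (g \<bullet> x))"
      by (simp only: complex_cnj_mult complex_cnj_cnj mult_ac)
    moreover have "sesq A v v = 0" using Av[OF v(1)] gv by simp
    ultimately show ?thesis
      unfolding sesq_add_smult_self[OF A x v(1)] Av[OF x] vA[OF x] distrib_left distrib_right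
      by (simp add: mult_ac)
  qed
  show ?thesis
  proof (cases "\<forall>y \<in> carrier_vec k. g \<bullet> (X *\<^sub>v y) = 0")
    case True
    then obtain X' where "X' \<in> carrier_mat (n - 1) k" "inj_mat X'"
      "\<And>y. y \<in> carrier_vec k \<Longrightarrow> Y *\<^sub>v (X' *\<^sub>v y) = X *\<^sub>v y"
      using subspace_in_hyperplane[OF L Y YL X] by blast
    then show ?thesis using nonneg_dim_restrictI[OF A Y] nnX by simp
  next
    case False
    then obtain y0 where y0: "y0 \<in> carrier_vec k" "g \<bullet> (X *\<^sub>v y0) \<noteq> 0" by blast
    let ?x0 = "X *\<^sub>v y0"
    have x0: "?x0 \<in> carrier_vec n" using X y0 by simp
    \<comment> \<open>If \<open>v\<close> were in the subspace, so would be all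
      \<open>?x0 + c \<cdot>\<^sub>v v\<close>; the real part is affine in \<open>c\<close> with
      nonzero slope, hence unbounded below. The choice of \<open>t\<close> makes its value exactly
      \<open>-1\<close>.\<close>
    have nin: "X *\<^sub>v w \<noteq> v" if w: "w \<in> carrier_vec k" for w
    proof
      assume Xw: "X *\<^sub>v w = v"
      define b where "b = (z * \<beta> + cnj (z * \<alpha>)) * (g \<bullet> ?x0)"
      have b: "b \<noteq> 0" using z y0 by (simp add: b_def)
      define t where "t = - ((Re (z * sesq A ?x0 ?x0) + 1) / (cmod b)\<^sup>2)"
      define c where "c = of_real t * b"
      have "X *\<^sub>v (y0 + c \<cdot>\<^sub>v w) = ?x0 + c \<cdot>\<^sub>v v"
        using mult_add_distrib_mat_vec[OF X(1) y0(1), of "c \<cdot>\<^sub>v w"] mult_mat_vec[OF X(1) w] w Xw by simp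
      then have "0 \<le> Re (z * sesq A ?x0 ?x0) + Re (cnj c * b)"
        using nnX[of "y0 + c \<cdot>\<^sub>v w"] q[OF x0, of c] y0 w by (simp add: b_def mult.assoc)
      moreover have "cnj c * b = of_real (t * (cmod b)\<^sup>2)"
        by (simp add: c_def complex_norm_square[symmetric] mult_ac)
      moreover have "t * (cmod b)\<^sup>2 = - (Re (z * sesq A ?x0 ?x0) + 1)" using b by (simp add: t_def)
      ultimately show False by simp
    qed
    from cut_subspace[OF X k g] obtain X' where X': "X' \<in> carrier_mat n (k - 1)" "inj_mat X'"
      "\<And>y. y \<in> carrier_vec (k - 1) \<Longrightarrow> g \<bullet> (X' *\<^sub>v y) = 0"
      "\<And>y. y \<in> carrier_vec (k - 1) \<Longrightarrow> \<exists>w \<in> carrier_vec k. X' *\<^sub>v y = X *\<^sub>v w" by blast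
    have nin': "X' *\<^sub>v y \<noteq> v" if "y \<in> carrier_vec (k - 1)" for y using X'(4)[OF that] nin by metis
    from add_vec_subspace[OF X'(1,2) v(1) nin'] k obtain Z where
      Z: "Z \<in> carrier_mat n k" "inj_mat Z"
      "\<And>y. y \<in> carrier_vec k \<Longrightarrow> \<exists>w \<in> carrier_vec (k - 1). \<exists>c. Z *\<^sub>v y = X' *\<^sub>v w + c \<cdot>\<^sub>v v" by auto
    have Zy: "g \<bullet> (Z *\<^sub>v y) = 0 \<and> 0 \<le> Re (z * sesq A (Z *\<^sub>v y) (Z *\<^sub>v y))" if y: "y \<in> carrier_vec k" for y
    proof -
      from Z(3)[OF y] obtain w c where w: "w \<in> carrier_vec (k - 1)" and eq: "Z *\<^sub>v y = X' *\<^sub>v w + c \<cdot>\<^sub>v v" by blast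
      have X'w: "X' *\<^sub>v w \<in> carrier_vec n" using X' w by simp
      obtain u where u: "u \<in> carrier_vec k" "X' *\<^sub>v w = X *\<^sub>v u" using X'(4)[OF w] by blast
      have "g \<bullet> (Z *\<^sub>v y) = 0"
        unfolding eq using X'(3)[OF w] gv scalar_prod_add_distrib[OF g X'w, of "c \<cdot>\<^sub>v v"] v g by simp
      moreover have "0 \<le> Re (z * sesq A (Z *\<^sub>v y) (Z *\<^sub>v y))"
        unfolding eq q[OF X'w] X'(3)[OF w] using nnX[OF u(1)] u(2) by simp
      ultimately show ?thesis by blast
    qed
    obtain X'' where "X'' \<in> carrier_mat (n - 1) k" "inj_mat X''"
      "\<And>y. y \<in> carrier_vec k \<Longrightarrow> Y *\<^sub>v (X'' *\<^sub>v y) = Z *\<^sub>v y"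
      using subspace_in_hyperplane[OF L Y YL Z(1,2)] Zy by blast
    then show ?thesis using nonneg_dim_restrictI[OF A Y] Zy by simp
  qed
qed

text \<open>By the max-min characterization the condition is \<open>0 \<le> lam\<close>, and
  \<open>lam\<close> is continuous in the direction. Approach from one side avoids the direction
  \<open>\<theta>\<close> itself.\<close>

lemma nonneg_dim_closed:
  assumes B: "B \<in> carrier_mat m m" and k: "1 \<le> k"
    and nn: "\<And>\<epsilon>. 0 < \<epsilon> \<Longrightarrow> \<epsilon> < 1 \<Longrightarrow> nonneg_dim m k B (cis (\<theta> + \<epsilon>))"
  shows "nonneg_dim m k B (cis \<theta>)"
proof -
  have "k \<le> m" using nonneg_dim_le[OF nn[of "1/2"]] by simp
  note iff = nonneg_dim_iff_lam[OF B k this]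
  let ?f = "\<lambda>\<epsilon>. lam k (cis (\<theta> + \<epsilon>) \<cdot>\<^sub>m B)"
  have "continuous_on UNIV ?f"
    using continuous_on_lam[OF B k \<open>k \<le> m\<close>]
    by (intro continuous_on_compose2[of UNIV "\<lambda>z. lam k (z \<cdot>\<^sub>m B)" UNIV "\<lambda>\<epsilon>. cis (\<theta> + \<epsilon>)"] continuous_intros) auto
  then have "isCont ?f 0" by (simp add: continuous_on_eq_continuous_at)
  then have "(?f \<longlongrightarrow> ?f 0) (at_right 0)"
    unfolding isCont_def by (rule filterlim_at_split[THEN iffD1, THEN conjunct2])
  moreover have "eventually (\<lambda>\<epsilon>. 0 \<le> ?f \<epsilon>) (at_right 0)"
    unfolding eventually_at_right_field using nn iff by (intro exI[of _ 1]) auto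
  ultimately have "0 \<le> ?f 0" by (intro tendsto_lowerbound) auto
  then show ?thesis using iff by simp
qed

text \<open>The common direction \<open>p\<close> makes both slots of the form at \<open>v\<close>
  multiples of one functional \<open>?g\<close>. Either both slots vanish and \<open>v\<close> is in
  the radical, or \<open>v\<close> lies in the hyperplane of \<open>?g\<close> and the condition is
  inherited there with the same \<open>k\<close>.\<close>

lemma isotropic_dim_reduce:
  assumes A: "A \<in> carrier_mat n n" and v: "v \<in> carrier_vec n" "v \<noteq> 0\<^sub>v n" and k: "1 \<le> k"
    and p: "p \<in> carrier_vec n" and Avp: "A *\<^sub>v v = \<alpha> \<cdot>\<^sub>v p" and aAvp: "mat_adjoint A *\<^sub>v v = \<beta> \<cdot>\<^sub>v p"
    and vv: "sesq A v v = 0"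
    and nn: "\<And>z. cmod z = 1 \<Longrightarrow> nonneg_dim n k A z"
    and IH: "\<And>j B. B \<in> carrier_mat (n - 1) (n - 1) \<Longrightarrow> (\<And>z. cmod z = 1 \<Longrightarrow> nonneg_dim (n - 1) j B z) \<Longrightarrow>
               isotropic_dim (n - 1) j B"
  shows "isotropic_dim n k A"
proof -
  let ?g = "conjugate p"
  have g: "?g \<in> carrier_vec n" using p by (simp add: carrier_vec_conjugate)
  have pg: "p \<bullet>c x = cnj (?g \<bullet> x)" if "x \<in> carrier_vec n" for x
    using that p by (simp add: scalar_prod_def)
  have Av: "sesq A v x = \<alpha> * cnj (?g \<bullet> x)" if "x \<in> carrier_vec n" for x
    using that p by (simp add: sesq_def Avp pg[symmetric])
  have vA: "sesq A x v = cnj \<beta> * (?g \<bullet> x)" if x: "x \<in> carrier_vec n" for x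
  proof -
    have "cnj (sesq A x v) = \<beta> * cnj (?g \<bullet> x)"
      using sesq_mat_adjoint[OF A v(1) x] x p by (simp add: sesq_def aAvp pg)
    then show ?thesis by (metis complex_cnj_cnj complex_cnj_mult)
  qed
  show ?thesis
  proof (cases "?g = 0\<^sub>v n \<or> (\<alpha> = 0 \<and> \<beta> = 0)")
    case True
    have "sesq A v x = 0 \<and> sesq A x v = 0" if x: "x \<in> carrier_vec n" for x
      using True Av[OF x] vA[OF x] x by auto
    then show ?thesis by (intro isotropic_dim_radical[OF A v k _ _ nn IH]) blast+
  next
    case False
    have gv: "?g \<bullet> v = 0" using vv Av[OF v(1)] vA[OF v(1)] False by auto
    from False have "?g \<noteq> 0\<^sub>v n" by blast
    from hyperplane_basis[OF g this] obtain Y L where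
      Y: "Y \<in> carrier_mat n (n - 1)" and L: "L \<in> carrier_mat (n - 1) n" "L * Y = 1\<^sub>m (n - 1)"
      and YL: "\<And>x. x \<in> carrier_vec n \<Longrightarrow> ?g \<bullet> x = 0 \<Longrightarrow> Y *\<^sub>v (L *\<^sub>v x) = x"
      and "\<And>y. y \<in> carrier_vec (n - 1) \<Longrightarrow> ?g \<bullet> (Y *\<^sub>v y) = 0" by blast
    have injY: "inj_mat Y" using inj_mat_left_inverse[OF L(2) Y L(1)] .
    let ?B = "mat_adjoint Y * A * Y"
    have aY: "mat_adjoint Y \<in> carrier_mat (n - 1) n" using Y by simp
    have B: "?B \<in> carrier_mat (n - 1) (n - 1)" by (rule mult_carrier_mat[OF mult_carrier_mat[OF aY A] Y])
    have generic: "nonneg_dim (n - 1) k ?B z" if "cmod z = 1" "z * cnj \<beta> + cnj (z * \<alpha>) \<noteq> 0" for z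
      by (rule nonneg_dim_hyperplane[OF A v k g gv L(1) Y YL Av vA that(2) nn[OF that(1)]])
    \<comment> \<open>The directions that are not generic form at most one antipodal pair, so closedness covers them.\<close>
    have "nonneg_dim (n - 1) k ?B z" if z: "cmod z = 1" for z
    proof (cases "z * cnj \<beta> + cnj (z * \<alpha>) = 0")
      case exc: True
      define \<theta> where "\<theta> = Arg z"
      have z\<theta>: "z = cis \<theta>" 
        unfolding \<theta>_def using z by (subst cis_Arg) (auto simp: sgn_eq)
      \<comment> \<open>Multiplying by \<open>w\<close> and using \<open>cmod w = 1\<close> turns
        the exceptional equation into one for the square of \<open>w\<close>, so two exceptional
        directions differ at most by sign.\<close>
      have sq: "w\<^sup>2 * cnj \<beta> = - cnj \<alpha>" if "w * cnj \<beta> + cnj (w * \<alpha>) = 0" "cmod w = 1" for w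
      proof -
        have "w * cnj w = 1" using that(2) complex_norm_square[of w] by simp
        have "w * (w * cnj \<beta> + cnj (w * \<alpha>)) = w\<^sup>2 * cnj \<beta> + (w * cnj w) * cnj \<alpha>"
          by (simp add: power2_eq_square algebra_simps)
        then show ?thesis using that(1) \<open>w * cnj w = 1\<close> by (simp add: eq_neg_iff_add_eq_0)
      qed
      have "\<beta> \<noteq> 0" using sq[OF exc z] False by auto
      have "nonneg_dim (n - 1) k ?B (cis (\<theta> + \<epsilon>))" if \<epsilon>: "0 < \<epsilon>" "\<epsilon> < 1" for \<epsilon>
      proof (rule generic)
        show "cis (\<theta> + \<epsilon>) * cnj \<beta> + cnj (cis (\<theta> + \<epsilon>) * \<alpha>) \<noteq> 0"
        proof
          assume "cis (\<theta> + \<epsilon>) * cnj \<beta> + cnj (cis (\<theta> + \<epsilon>) * \<alpha>) = 0"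
          from sq[OF this] sq[OF exc z] have "(cis (\<theta> + \<epsilon>))\<^sup>2 = (cis \<theta>)\<^sup>2"
            using \<open>\<beta> \<noteq> 0\<close> z\<theta> by (metis complex_cnj_zero_iff mult_right_cancel norm_cis)
          then have "(cis \<epsilon>)\<^sup>2 = 1" by (simp add: cis_mult[symmetric] power_mult_distrib)
          then have "cis (2 * \<epsilon>) = 1" by (simp add: power2_eq_square cis_mult)
          then have "sin (2 * \<epsilon>) = 0" by (simp add: complex_eq_iff)
          \<comment> \<open>\<open>\<epsilon> < 1\<close> keeps \<open>2 * \<epsilon>\<close> below
            \<open>pi\<close>, so the rotated direction is neither \<open>z\<close> nor
            \<open>- z\<close>.\<close>
          moreover have "sin (2 * \<epsilon>) > 0" using \<epsilon> pi_gt3 by (intro sin_gt_zero) auto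
          ultimately show False by simp
        qed
      qed simp
      then show ?thesis unfolding z\<theta> by (rule nonneg_dim_closed[OF B k])
    qed (use generic z in blast)
    then have "isotropic_dim (n - 1) k ?B" using IH[OF B] by blast
    then show ?thesis using isotropic_dim_restrict[OF A Y injY] by blast
  qed
qed

section \<open>Isotropic kernel vectors by compactness\<close>

lemma bounded_subseq_aux:
  fixes f :: "nat \<Rightarrow> nat \<Rightarrow> complex"
  assumes "\<And>j i. i < m \<Longrightarrow> cmod (f j i) \<le> 1"
  shows "\<exists>r l. strict_mono (r :: nat \<Rightarrow> nat) \<and> (\<forall>i<m. (\<lambda>j. f (r j) i) \<longlonglongrightarrow> l i)"
  using assms
proof (induction m)
  case 0
  show ?case by (intro exI[of _ id]) (auto simp: strict_mono_def)
next
  case (Suc m)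
  then obtain r l where r: "strict_mono (r :: nat \<Rightarrow> nat)" "\<And>i. i < m \<Longrightarrow> (\<lambda>j. f (r j) i) \<longlonglongrightarrow> l i"
    by (metis less_SucI)
  have "seq_compact (cball 0 1 :: complex set)" by (simp add: compact_imp_seq_compact)
  moreover have "\<forall>j. f (r j) m \<in> cball 0 1" using Suc.prems by simp
  ultimately obtain c s where s: "strict_mono (s :: nat \<Rightarrow> nat)" "((\<lambda>j. f (r j) m) \<circ> s) \<longlonglongrightarrow> c"
    unfolding seq_compact_def by meson
  show ?case
  proof (intro exI[of _ "r \<circ> s"] exI[of _ "l(m := c)"] conjI allI impI)
    show "strict_mono (r \<circ> s)" using r(1) s(1) by (rule strict_mono_o)
    fix i assume "i < Suc m"
    then show "(\<lambda>j. f ((r \<circ> s) j) i) \<longlonglongrightarrow> (l(m := c)) i"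
      using s(2) LIMSEQ_subseq_LIMSEQ[OF r(2) s(1), of i] by (cases "i = m") (auto simp: o_def)
  qed
qed

text \<open>Convergence is recorded through the values of all forms at once; the identity matrix
  among them shows that the limit is again a unit vector.\<close>

lemma unit_vec_subseq:
  assumes y: "\<And>j. y j \<in> carrier_vec m" "\<And>j. nrm2 (y j) = 1"
  obtains r l where "strict_mono (r :: nat \<Rightarrow> nat)" "l \<in> carrier_vec m" "nrm2 l = 1"
    "\<forall>B \<in> carrier_mat m m. (\<lambda>j. sesq B (y (r j)) (y (r j))) \<longlonglongrightarrow> sesq B l l"
proof -
  have "cmod (y j $ i) \<le> 1" if "i < m" for j i
  proof -
    have "(cmod (y j $ i))\<^sup>2 \<le> nrm2 (y j)"
      unfolding nrm2_eq[OF y(1)] using that member_le_sum[of i "{..<m}" "\<lambda>i. (cmod (y j $ i))\<^sup>2"] by simp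
    then show ?thesis using y(2) power_le_one_iff[of "cmod (y j $ i)" 2] by simp
  qed
  from bounded_subseq_aux[of m "\<lambda>j i. y j $ i", OF this] obtain r l where
    r: "strict_mono (r :: nat \<Rightarrow> nat)" and l: "\<And>i. i < m \<Longrightarrow> (\<lambda>j. y (r j) $ i) \<longlonglongrightarrow> l i" by blast
  let ?l = "vec m l"
  have expand: "sesq B x x = (\<Sum>i<m. \<Sum>j<m. B $$ (i,j) * x $ j * cnj (x $ i))"
    if "B \<in> carrier_mat m m" "x \<in> carrier_vec m" for B x
    using that by (auto simp: sesq_def scalar_prod_def sum_distrib_right atLeast0LessThan intro!: sum.cong)
  have lim: "(\<lambda>j. sesq B (y (r j)) (y (r j))) \<longlonglongrightarrow> sesq B ?l ?l" if B: "B \<in> carrier_mat m m" for B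
    unfolding expand[OF B y(1)] expand[OF B vec_carrier]
    by (intro tendsto_intros) (use l in auto)
  have one: "sesq (1\<^sub>m m) x x = of_real (nrm2 x)" if "x \<in> carrier_vec m" for x
    using that by (simp add: sesq_one[of _ m] cscalar_prod_nrm2)
  have "(\<lambda>j. complex_of_real 1) \<longlonglongrightarrow> of_real (nrm2 ?l)"
    using lim[of "1\<^sub>m m"] by (simp add: one y)
  then have "nrm2 ?l = 1"
    using LIMSEQ_unique tendsto_const by (metis of_real_eq_iff)
  then show thesis using that[OF r, of ?l] lim by simp
qed

text \<open>Nonnegative subspaces for the directions \<open>cis \<epsilon>\<close> and \<open>cis (- \<epsilon>)\<close> meet the nonpositive subspace of the real part.
  The limits for \<open>\<epsilon> \<rightarrow> 0\<close> are kernel vectors on which the imaginary part of the form has opposite signs,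
  and a path between them inside the kernel contains an isotropic vector.\<close>

lemma isotropic_kernel_vector:
  assumes A: "A \<in> carrier_mat n n" and k: "1 \<le> k" "k \<le> n"
    and nn: "\<And>z. cmod z = 1 \<Longrightarrow> nonneg_dim n k A z" and lam0: "lam k A \<le> 0"
  obtains v where "v \<in> carrier_vec n" "v \<noteq> 0\<^sub>v n" "sesq A v v = 0" "re_mat A *\<^sub>v v = 0\<^sub>v n"
proof -
  let ?m = "n - k + 1"
  from nonpos_subspace[OF A k lam0] obtain W where W: "W \<in> carrier_mat n ?m" "inj_mat W"
    and W1: "\<And>y. y \<in> carrier_vec ?m \<Longrightarrow> Re (sesq A (W *\<^sub>v y) (W *\<^sub>v y)) \<le> 0"
    and W2: "\<And>y. y \<in> carrier_vec ?m \<Longrightarrow> Re (sesq A (W *\<^sub>v y) (W *\<^sub>v y)) = 0 \<Longrightarrow> re_mat A *\<^sub>v (W *\<^sub>v y) = 0\<^sub>v n"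
    by blast
  let ?B = "mat_adjoint W * A * W"
  have aW: "mat_adjoint W \<in> carrier_mat ?m n" using W by simp
  have B: "?B \<in> carrier_mat ?m ?m" by (rule mult_carrier_mat[OF mult_carrier_mat[OF aW A] W(1)])
  have qB: "sesq ?B y y = sesq A (W *\<^sub>v y) (W *\<^sub>v y)" if "y \<in> carrier_vec ?m" for y
    by (rule sesq_congruence[OF A W(1) that that])
  \<comment> \<open>The dimensions \<open>k\<close> and \<open>n - k + 1\<close> add up to more than
    \<open>n\<close>. The common vector is normalized in the coordinates of \<open>W\<close>, where
    the compactness argument takes place.\<close>
  have meet: "\<exists>y \<in> carrier_vec ?m. nrm2 y = 1 \<and> 0 \<le> Re (z * sesq ?B y y)" if z: "cmod z = 1" for z
  proof -
    obtain X where X: "X \<in> carrier_mat n k" "inj_mat X"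
      and nnX: "\<And>y. y \<in> carrier_vec k \<Longrightarrow> 0 \<le> Re (z * sesq A (X *\<^sub>v y) (X *\<^sub>v y))"
      using nn[OF z] unfolding nonneg_dim_def by blast
    have "k + ?m > n" using k by simp
    from inj_mats_meet[OF X W this] obtain x y where xy: "x \<in> carrier_vec k" "y \<in> carrier_vec ?m"
      "X *\<^sub>v x = W *\<^sub>v y" "y \<noteq> 0\<^sub>v ?m" by blast
    have pos: "nrm2 y > 0" using nrm2_pos_iff[OF xy(2)] xy(4) by simp
    define c where "c = complex_of_real (1 / sqrt (nrm2 y))"
    have "1 / sqrt (nrm2 y) * (1 / sqrt (nrm2 y)) = 1 / nrm2 y" using pos by simp
    then have cc: "c * cnj c = of_real (1 / nrm2 y)"
      unfolding c_def complex_cnj_complex_of_real of_real_mult[symmetric] by simp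
    let ?y = "c \<cdot>\<^sub>v y"
    have y': "?y \<in> carrier_vec ?m" using xy by simp
    have "?y \<bullet>c ?y = c * cnj c * (y \<bullet>c y)"
      using xy by (simp add: conjugate_smult_vec)
    then have "complex_of_real (nrm2 ?y) = of_real (1 / nrm2 y * nrm2 y)"
      unfolding cc cscalar_prod_nrm2 of_real_mult .
    then have "nrm2 ?y = 1" using pos unfolding of_real_eq_iff by simp
    moreover have "sesq ?B ?y ?y = c * cnj c * sesq ?B y y"
      using xy(2) by (simp add: sesq_smult_left[OF B] sesq_smult_right[OF B])
    then have "sesq ?B ?y ?y = of_real (1 / nrm2 y) * sesq ?B y y" unfolding cc .
    then have "Re (z * sesq ?B ?y ?y) = 1 / nrm2 y * Re (z * sesq ?B y y)" by simp
    moreover have "0 \<le> Re (z * sesq ?B y y)" unfolding qB[OF xy(2)] using nnX[OF xy(1)] xy(3) by simp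
    ultimately show ?thesis using y' pos by (intro bexI[of _ ?y]) auto
  qed
  \<comment> \<open>The sign \<open>s\<close> selects from which side the direction tends to
    \<open>1\<close>.\<close>
  have sided: "\<exists>y \<in> carrier_vec ?m. nrm2 y = 1 \<and> Re (sesq ?B y y) = 0 \<and> s * Im (sesq ?B y y) \<le> 0"
    if s: "s = 1 \<or> s = - 1" for s :: real
  proof -
    let ?\<epsilon> = "\<lambda>j. inverse (real (Suc j))"
    have "\<exists>y. \<forall>j. y j \<in> carrier_vec ?m \<and> nrm2 (y j) = 1 \<and> 0 \<le> Re (cis (s * ?\<epsilon> j) * sesq ?B (y j) (y j))"
    proof (rule choice, rule allI)
      fix j show "\<exists>y. y \<in> carrier_vec ?m \<and> nrm2 y = 1 \<and> 0 \<le> Re (cis (s * ?\<epsilon> j) * sesq ?B y y)"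
        using meet[OF norm_cis, of "s * ?\<epsilon> j"] unfolding Bex_def .
    qed
    then obtain y where y: "\<And>j. y j \<in> carrier_vec ?m" "\<And>j. nrm2 (y j) = 1"
      and ge: "\<And>j. 0 \<le> Re (cis (s * ?\<epsilon> j) * sesq ?B (y j) (y j))" by blast
    obtain r l where r: "strict_mono (r :: nat \<Rightarrow> nat)" and l: "l \<in> carrier_vec ?m" "nrm2 l = 1"
      and "\<forall>B \<in> carrier_mat ?m ?m. (\<lambda>j. sesq B (y (r j)) (y (r j))) \<longlonglongrightarrow> sesq B l l"
      using unit_vec_subseq[of y ?m, OF y] by blast
    then have lim: "(\<lambda>j. sesq ?B (y (r j)) (y (r j))) \<longlonglongrightarrow> sesq ?B l l" using B by blast
    have "(\<lambda>j. ?\<epsilon> (r j)) \<longlonglongrightarrow> 0"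
      using LIMSEQ_subseq_LIMSEQ[OF LIMSEQ_inverse_real_of_nat r] by (simp add: o_def)
    then have "(\<lambda>j. cis (s * ?\<epsilon> (r j))) \<longlonglongrightarrow> cis (s * 0)" by (intro tendsto_intros)
    then have "(\<lambda>j. Re (cis (s * ?\<epsilon> (r j)) * sesq ?B (y (r j)) (y (r j)))) \<longlonglongrightarrow> Re (1 * sesq ?B l l)"
      using lim by (intro tendsto_intros) simp_all
    then have "0 \<le> Re (sesq ?B l l)" using ge by (intro LIMSEQ_le_const[of _ "Re (sesq ?B l l)"]) auto
    moreover have "Re (sesq ?B l l) \<le> 0" using W1[OF l(1)] qB[OF l(1)] by simp
    \<comment> \<open>The real part of the form is nonpositive on the range of \<open>W\<close>, so
      nonnegativity after a small rotation can only come from the imaginary part; this fixes its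
      sign already before the limit.\<close>
    moreover have "s * Im (sesq ?B (y j) (y j)) \<le> 0" for j
    proof -
      let ?e = "?\<epsilon> j" and ?f = "sesq ?B (y j) (y j)"
      have e: "0 < ?e" "?e \<le> 1" by (auto simp: inverse_le_1_iff)
      then have pos: "sin ?e > 0" "cos ?e > 0"
        using pi_gt3 by (auto intro!: sin_gt_zero cos_gt_zero)
      have "Re ?f \<le> 0" using W1[OF y(1)] qB[OF y(1)] by simp
      have "0 \<le> cos ?e * Re ?f - sin ?e * (s * Im ?f)" using ge[of j] s by auto
      moreover have "cos ?e * Re ?f \<le> 0" using pos \<open>Re ?f \<le> 0\<close> by (intro mult_nonneg_nonpos) auto
      ultimately have "sin ?e * (s * Im ?f) \<le> 0" by linarith
      then show ?thesis using pos by (simp add: mult_le_0_iff)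
    qed
    then have "s * Im (sesq ?B l l) \<le> 0"
      using tendsto_mult_left[OF tendsto_Im[OF lim], of s] by (intro LIMSEQ_le_const2) auto
    ultimately show ?thesis using l by (intro bexI[of _ l]) auto
  qed
  obtain y1 where y1: "y1 \<in> carrier_vec ?m" "nrm2 y1 = 1" "Re (sesq ?B y1 y1) = 0" "Im (sesq ?B y1 y1) \<le> 0"
    using sided[of 1] by auto
  obtain y2 where y2: "y2 \<in> carrier_vec ?m" "nrm2 y2 = 1" "Re (sesq ?B y2 y2) = 0" "0 \<le> Im (sesq ?B y2 y2)"
    using sided[of "-1"] by auto
  define x1 where "x1 = W *\<^sub>v y1"
  define x2 where "x2 = W *\<^sub>v y2"
  have nz: "x1 \<noteq> 0\<^sub>v n" "x2 \<noteq> 0\<^sub>v n"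
    using inj_matD[OF W(2,1) y1(1)] inj_matD[OF W(2,1) y2(1)] y1(2) y2(2) nrm2_pos_iff[OF y1(1)] nrm2_pos_iff[OF y2(1)]
    by (auto simp: x1_def x2_def)
  have x: "x1 \<in> carrier_vec n" "x2 \<in> carrier_vec n" using W y1 y2 by (auto simp: x1_def x2_def)
  have ker: "re_mat A *\<^sub>v x1 = 0\<^sub>v n" "re_mat A *\<^sub>v x2 = 0\<^sub>v n"
    using W2[OF y1(1)] W2[OF y2(1)] y1(3) y2(3) qB[OF y1(1)] qB[OF y2(1)] by (auto simp: x1_def x2_def)
  have im: "Im (sesq A x1 x1) \<le> 0" "0 \<le> Im (sesq A x2 x2)" and re: "Re (sesq A x1 x1) = 0"
    using y1 y2 qB[OF y1(1)] qB[OF y2(1)] by (auto simp: x1_def x2_def)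
  \<comment> \<open>The straight path from \<open>x1\<close> to \<open>x2\<close>; it stays in the
    kernel, so only the imaginary part of the form varies and the intermediate value theorem
    applies.\<close>
  define v where "v t = x1 + complex_of_real t \<cdot>\<^sub>v (x2 + (-1) \<cdot>\<^sub>v x1)" for t
  have v: "v t \<in> carrier_vec n" for t using x by (simp add: v_def)
  have vker: "re_mat A *\<^sub>v v t = 0\<^sub>v n" for t
  proof -
    let ?H = "re_mat A"
    have H: "?H \<in> carrier_mat n n" using A by simp
    show ?thesis unfolding v_def
      by (rule eq_vecI) (use x ker H in \<open>auto simp: mult_add_distrib_mat_vec[OF H] mult_mat_vec[OF H] simp del: index_mult_mat_vec\<close>)
  qed
  have vre: "Re (sesq A (v t) (v t)) = 0" for t
    using sesq_re_mat_self[OF A v] vker v by (simp add: sesq_def)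
  have cont: "continuous_on {0..1} (\<lambda>t. Im (sesq A (v t) (v t)))"
    unfolding v_def sesq_add_smult_self[OF A x(1) add_carrier_vec[OF x(2) smult_carrier_vec[THEN iffD2, OF x(1)]]]
    by (intro continuous_intros)
  have v0: "v 0 = x1" "v 1 = x2" by (auto simp: v_def intro!: eq_vecI) (use x in auto)
  obtain t where t: "0 \<le> t" "t \<le> 1" "Im (sesq A (v t) (v t)) = 0"
    using IVT'[of "\<lambda>t. Im (sesq A (v t) (v t))" 0 0 1] im cont unfolding v0 by auto
  show thesis
  proof (cases "v t = 0\<^sub>v n")
    case False
    then show thesis using that[OF v[of t]] vker vre t by (simp add: complex_eq_iff)
  next
    \<comment> \<open>If the path hits zero, then \<open>x1\<close> is a real multiple of
      \<open>x2\<close>, so the imaginary parts at both have the same sign as well as opposite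
      signs; \<open>x1\<close> itself is then isotropic.\<close>
    case True
    have "t \<noteq> 1" using True nz v0 by auto
    have eq: "x1 = complex_of_real (- t / (1 - t)) \<cdot>\<^sub>v x2"
    proof (rule eq_vecI)
      fix i assume "i < dim_vec (complex_of_real (- t / (1 - t)) \<cdot>\<^sub>v x2)"
      then have i: "i < n" using x by simp
      have "v t $ i = 0" using True i by simp
      then have "x1 $ i + of_real t * (x2 $ i - x1 $ i) = 0" using i x by (simp add: v_def)
      then have "of_real (1 - t) * x1 $ i = - (of_real t * x2 $ i)"
        by (simp add: algebra_simps eq_neg_iff_add_eq_0)
      moreover have "complex_of_real (1 - t) \<noteq> 0" using \<open>t \<noteq> 1\<close> by (simp del: of_real_diff)
      ultimately have "x1 $ i = - (of_real t * x2 $ i) / of_real (1 - t)"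
        by (metis nonzero_mult_div_cancel_left)
      then show "x1 $ i = (complex_of_real (- t / (1 - t)) \<cdot>\<^sub>v x2) $ i" using i x by simp
    qed (use x in auto)
    have "sesq A (of_real a \<cdot>\<^sub>v x2) (of_real a \<cdot>\<^sub>v x2) = of_real (a\<^sup>2) * sesq A x2 x2" for a
      using x by (simp add: sesq_simps[OF A] power2_eq_square)
    from this[of "- t / (1 - t)"] have "sesq A x1 x1 = of_real ((t / (1 - t))\<^sup>2) * sesq A x2 x2"
      unfolding eq[symmetric] by (simp add: power_divide)
    then have "Im (sesq A x1 x1) = (t / (1 - t))\<^sup>2 * Im (sesq A x2 x2)" by (simp del: of_real_power)
    then have "0 \<le> Im (sesq A x1 x1)" using im by simp
    then show thesis using that[OF x(1) nz(1) _ ker(1)] im re by (simp add: complex_eq_iff)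
  qed
qed

lemma smult_mat_mult_vec:
  fixes A :: "complex mat"
  assumes "A \<in> carrier_mat n m" "x \<in> carrier_vec m"
  shows "(c \<cdot>\<^sub>m A) *\<^sub>v x = c \<cdot>\<^sub>v (A *\<^sub>v x)"
  by (rule eq_vecI) (use assms in \<open>auto simp: smult_scalar_prod_distrib[of _ m]\<close>)

text \<open>After rotation by \<open>z0\<close> the kernel vector of the Hermitian part satisfies
  \<open>z0 A v = - cnj z0 A' v\<close> with \<open>A'\<close> the adjoint of \<open>A\<close>. This
  is exactly the parallelism that the reduction step asks for.\<close>

lemma isotropic_dim_boundary:
  assumes A: "A \<in> carrier_mat n n" and k: "1 \<le> k" "k \<le> n"
    and nn: "\<And>z. cmod z = 1 \<Longrightarrow> nonneg_dim n k A z"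
    and z0: "cmod z0 = 1" and lam0: "lam k (z0 \<cdot>\<^sub>m A) \<le> 0"
    and IH: "\<And>j B. B \<in> carrier_mat (n - 1) (n - 1) \<Longrightarrow> (\<And>z. cmod z = 1 \<Longrightarrow> nonneg_dim (n - 1) j B z) \<Longrightarrow>
               isotropic_dim (n - 1) j B"
  shows "isotropic_dim n k A"
proof -
  let ?A = "z0 \<cdot>\<^sub>m A"
  have A': "?A \<in> carrier_mat n n" using A by simp
  have sq: "sesq ?A x y = z0 * sesq A x y" if "x \<in> carrier_vec n" "y \<in> carrier_vec n" for x y
    using sesq_smult_mat[OF A that] .
  have "nonneg_dim n k ?A z" if "cmod z = 1" for z
  proof -
    have "nonneg_dim n k A (z * z0)" using nn that z0 by (simp add: norm_mult)
    then show ?thesis unfolding nonneg_dim_def using sq by (auto simp: mult.assoc intro!: bexI)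
  qed
  from isotropic_kernel_vector[OF A' k this lam0] obtain v where v: "v \<in> carrier_vec n" "v \<noteq> 0\<^sub>v n"
    and q: "sesq ?A v v = 0" and ker: "re_mat ?A *\<^sub>v v = 0\<^sub>v n" by blast
  have z0_ne: "z0 \<noteq> 0" using z0 by auto
  have qv: "sesq A v v = 0" using q sq[OF v(1) v(1)] z0_ne by simp
  have aA: "mat_adjoint A \<in> carrier_mat n n" using A by simp
  have adj: "mat_adjoint ?A = cnj z0 \<cdot>\<^sub>m mat_adjoint A" by (rule eq_matI) (use A in auto)
  have Av: "A *\<^sub>v v \<in> carrier_vec n" "mat_adjoint A *\<^sub>v v \<in> carrier_vec n"
    using mult_mat_vec_carrier[OF A v(1)] mult_mat_vec_carrier[OF aA v(1)] by auto
  have "re_mat ?A *\<^sub>v v = (1/2) \<cdot>\<^sub>v (z0 \<cdot>\<^sub>v (A *\<^sub>v v) + cnj z0 \<cdot>\<^sub>v (mat_adjoint A *\<^sub>v v))"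
    unfolding re_mat_def adj using A aA v
    by (simp add: smult_mat_mult_vec[of _ n n] add_mult_distrib_mat_vec[of _ n n])
  with ker have 0: "(1/2) \<cdot>\<^sub>v (z0 \<cdot>\<^sub>v (A *\<^sub>v v) + cnj z0 \<cdot>\<^sub>v (mat_adjoint A *\<^sub>v v)) = 0\<^sub>v n" by simp
  have "mat_adjoint A *\<^sub>v v = (- z0 / cnj z0) \<cdot>\<^sub>v (A *\<^sub>v v)"
  proof (rule eq_vecI)
    fix i assume "i < dim_vec ((- z0 / cnj z0) \<cdot>\<^sub>v (A *\<^sub>v v))"
    then have i: "i < n" using A by simp
    have "((1/2) \<cdot>\<^sub>v (z0 \<cdot>\<^sub>v (A *\<^sub>v v) + cnj z0 \<cdot>\<^sub>v (mat_adjoint A *\<^sub>v v))) $ i = 0"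
      unfolding 0 using i by simp
    then have "z0 * (A *\<^sub>v v) $ i + cnj z0 * (mat_adjoint A *\<^sub>v v) $ i = 0"
      using i A aA v by (simp del: index_mult_mat_vec)
    then have "cnj z0 * (mat_adjoint A *\<^sub>v v) $ i = - z0 * (A *\<^sub>v v) $ i"
      by (simp del: index_mult_mat_vec add: eq_neg_iff_add_eq_0 add.commute)
    then have "(mat_adjoint A *\<^sub>v v) $ i = (- z0 * (A *\<^sub>v v) $ i) / cnj z0"
      using z0_ne by (metis complex_cnj_zero_iff nonzero_mult_div_cancel_left)
    then show "(mat_adjoint A *\<^sub>v v) $ i = ((- z0 / cnj z0) \<cdot>\<^sub>v (A *\<^sub>v v)) $ i"
      using i A Av by (simp del: index_mult_mat_vec)
  qed (use A in auto)
  moreover have "A *\<^sub>v v = 1 \<cdot>\<^sub>v (A *\<^sub>v v)" by simp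
  ultimately show ?thesis using isotropic_dim_reduce[OF A v k(1) Av(1) _ _ qv nn IH] by blast
qed

section \<open>The case \<open>n = 2 k\<close>: a vector from the pencil\<close>

lemma pencil_eigenvector:
  assumes A: "A \<in> carrier_mat n n" and B: "(B :: complex mat) \<in> carrier_mat n n" and n: "n > 0"
  obtains v where "v \<in> carrier_vec n" "v \<noteq> 0\<^sub>v n" "B *\<^sub>v v = 0\<^sub>v n \<or> (\<exists>w. A *\<^sub>v v = w \<cdot>\<^sub>v (B *\<^sub>v v))"
proof (cases "Determinant.det B = 0")
  case True
  then show thesis using det_0_iff_vec_prod_zero[OF B] that by blast
next
  case False
  \<comment> \<open>For invertible \<open>B\<close> an eigenvector of \<open>Q * A\<close>, with
    \<open>Q\<close> the inverse of \<open>B\<close>, solves the pencil equation.\<close>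
  from det_non_zero_imp_unit[OF B False, of "()"] obtain Q where
    Q: "Q \<in> carrier_mat n n" "B * Q = 1\<^sub>m n" unfolding Units_def ring_mat_def by auto
  have QA: "Q * A \<in> carrier_mat n n" using Q A by simp
  from spectrum_non_empty[OF QA n] obtain w where "eigenvalue (Q * A) w" unfolding spectrum_def by auto
  then obtain v where v: "v \<in> carrier_vec n" "v \<noteq> 0\<^sub>v n" "Q * A *\<^sub>v v = w \<cdot>\<^sub>v v"
    using QA unfolding eigenvalue_def eigenvector_def by auto
  have Av: "A *\<^sub>v v \<in> carrier_vec n" using A v by simp
  have "A *\<^sub>v v = B * Q *\<^sub>v (A *\<^sub>v v)" using Av Q by simp
  also have "\<dots> = B *\<^sub>v (Q *\<^sub>v (A *\<^sub>v v))" by (rule assoc_mult_mat_vec[OF B Q(1) Av])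
  also have "Q *\<^sub>v (A *\<^sub>v v) = w \<cdot>\<^sub>v v" using assoc_mult_mat_vec[OF Q(1) A v(1)] v(3) by simp
  also have "B *\<^sub>v (w \<cdot>\<^sub>v v) = w \<cdot>\<^sub>v (B *\<^sub>v v)" by (rule mult_mat_vec[OF B v(1)])
  finally show thesis using that v by blast
qed

text \<open>A vector in the radical of the real part would enlarge a positive subspace of dimension
  \<open>k\<close> to a nonnegative one of dimension \<open>k + 1\<close>. In dimension
  \<open>2 k\<close> this must meet the negative subspace of dimension \<open>k\<close> provided by
  \<open>D\<close>.\<close>

lemma definite_no_radical:
  assumes C: "C \<in> carrier_mat (2 * k) (2 * k)" and D: "D \<in> carrier_mat (2 * k) (2 * k)" and k: "1 \<le> k"
    and DC: "\<And>x. x \<in> carrier_vec (2 * k) \<Longrightarrow> Re (sesq D x x) = - Re (sesq C x x)"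
    and pos: "lam k C > 0" "lam k D > 0"
    and v: "v \<in> carrier_vec (2 * k)" "v \<noteq> 0\<^sub>v (2 * k)"
    and rad: "\<And>x c. x \<in> carrier_vec (2 * k) \<Longrightarrow> Re (sesq C (x + c \<cdot>\<^sub>v v) (x + c \<cdot>\<^sub>v v)) = Re (sesq C x x)"
  shows False
proof -
  let ?n = "2 * k"
  have k': "k \<le> ?n" by simp
  obtain X where X: "X \<in> carrier_mat ?n k" "inj_mat X"
    and qX: "\<And>y. y \<in> carrier_vec k \<Longrightarrow> lam k C * nrm2 (X *\<^sub>v y) \<le> Re (sesq C (X *\<^sub>v y) (X *\<^sub>v y))"
    using le_lam_iff[OF k k' C, of "lam k C"] by blast
  obtain Y where Y: "Y \<in> carrier_mat ?n k" "inj_mat Y"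
    and qY: "\<And>y. y \<in> carrier_vec k \<Longrightarrow> lam k D * nrm2 (Y *\<^sub>v y) \<le> Re (sesq D (Y *\<^sub>v y) (Y *\<^sub>v y))"
    using le_lam_iff[OF k k' D, of "lam k D"] by blast
  have qv: "Re (sesq C v v) = 0"
  proof -
    have "v + (-1) \<cdot>\<^sub>v v = 0\<^sub>v ?n" by (rule eq_vecI) (use v in auto)
    then show ?thesis using rad[OF v(1), of "-1"] C by (simp add: sesq_def)
  qed
  have "X *\<^sub>v y \<noteq> v" if "y \<in> carrier_vec k" for y
    using qX[OF that] qv pos nrm2_pos_iff[OF v(1)] v(2) by (auto simp: mult_le_0_iff)
  from add_vec_subspace[OF X v(1) this] obtain Z where Z: "Z \<in> carrier_mat ?n (k + 1)" "inj_mat Z"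
    "\<And>y. y \<in> carrier_vec (k + 1) \<Longrightarrow> \<exists>w \<in> carrier_vec k. \<exists>c. Z *\<^sub>v y = X *\<^sub>v w + c \<cdot>\<^sub>v v" by blast
  have "k + 1 + k > ?n" by simp
  from inj_mats_meet[OF Z(1,2) Y this] obtain x y where xy: "x \<in> carrier_vec (k + 1)" "y \<in> carrier_vec k"
    "Z *\<^sub>v x = Y *\<^sub>v y" "Z *\<^sub>v x \<noteq> 0\<^sub>v ?n" by blast
  obtain w c where w: "w \<in> carrier_vec k" "Z *\<^sub>v x = X *\<^sub>v w + c \<cdot>\<^sub>v v" using Z(3)[OF xy(1)] by blast
  have "Re (sesq C (Z *\<^sub>v x) (Z *\<^sub>v x)) = Re (sesq C (X *\<^sub>v w) (X *\<^sub>v w))"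
    unfolding w(2) using rad X(1) w(1) by simp
  also have "\<dots> \<ge> 0" using qX[OF w(1)] pos nrm2_nonneg[of "X *\<^sub>v w"]
    by (meson less_imp_le mult_nonneg_nonneg order_trans)
  finally have "0 \<le> Re (sesq C (Z *\<^sub>v x) (Z *\<^sub>v x))" .
  moreover have Zx: "Z *\<^sub>v x \<in> carrier_vec ?n" using mult_mat_vec_carrier[OF Z(1) xy(1)] .
  have "0 < lam k D * nrm2 (Z *\<^sub>v x)" using pos nrm2_pos_iff[OF Zx] xy(4) by simp
  then have "0 < Re (sesq D (Z *\<^sub>v x) (Z *\<^sub>v x))" using qY[OF xy(2)] xy(3) by simp
  ultimately show False using DC[OF Zx] by simp
qed

text \<open>An eigenvector of the pencil \<open>A - w A\<^sup>*\<close> is isotropic if \<open>\<bar>w\<bar> \<noteq> 1\<close>; if \<open>\<bar>w\<bar> = 1\<close>, it is in the kernel of the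
  real part of some \<open>z A\<close>, which is invertible here because its signature is \<open>(k, k)\<close>.\<close>

lemma isotropic_dim_half:
  assumes A: "A \<in> carrier_mat (2 * k) (2 * k)" and k: "1 \<le> k"
    and pos: "\<And>z. cmod z = 1 \<Longrightarrow> lam k (z \<cdot>\<^sub>m A) > 0"
    and IH: "\<And>j B. B \<in> carrier_mat (2 * k - 1) (2 * k - 1) \<Longrightarrow>
       (\<And>z. cmod z = 1 \<Longrightarrow> nonneg_dim (2 * k - 1) j B z) \<Longrightarrow> isotropic_dim (2 * k - 1) j B"
  shows "isotropic_dim (2 * k) k A"
proof -
  let ?n = "2 * k" and ?A' = "mat_adjoint A"
  have k': "k \<le> ?n" by simp
  have A': "?A' \<in> carrier_mat ?n ?n" using A by simp
  have nn: "nonneg_dim ?n k A z" if "cmod z = 1" for z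
    using pos[OF that] nonneg_dim_iff_lam[OF A k k'] by simp
  have "?n > 0" using k by simp
  from pencil_eigenvector[OF A A' this] obtain v where v: "v \<in> carrier_vec ?n" "v \<noteq> 0\<^sub>v ?n"
    and ev: "?A' *\<^sub>v v = 0\<^sub>v ?n \<or> (\<exists>w. A *\<^sub>v v = w \<cdot>\<^sub>v (?A' *\<^sub>v v))" by blast
  have adj: "sesq ?A' v x = cnj (sesq A x v)" if "x \<in> carrier_vec ?n" for x
    using sesq_mat_adjoint[OF A v(1) that] .
  show ?thesis
  proof (cases "?A' *\<^sub>v v = 0\<^sub>v ?n")
    case True
    have "cnj (sesq A v v) = 0" using adj[OF v(1)] True v by (simp add: sesq_def)
    moreover have "?A' *\<^sub>v v = 0 \<cdot>\<^sub>v (A *\<^sub>v v)" unfolding True by (rule eq_vecI) (use A in auto)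
    moreover have "A *\<^sub>v v \<in> carrier_vec ?n" "A *\<^sub>v v = 1 \<cdot>\<^sub>v (A *\<^sub>v v)" using A v by auto
    ultimately show ?thesis using isotropic_dim_reduce[OF A v k _ _ _ _ nn IH] by fastforce
  next
    case False
    then obtain w where w: "A *\<^sub>v v = w \<cdot>\<^sub>v (?A' *\<^sub>v v)" using ev by blast
    have A'v: "?A' *\<^sub>v v \<in> carrier_vec ?n" "?A' *\<^sub>v v = 1 \<cdot>\<^sub>v (?A' *\<^sub>v v)" using A' v by auto
    have sw: "sesq A v x = w * cnj (sesq A x v)" if "x \<in> carrier_vec ?n" for x
      unfolding adj[OF that, symmetric] using that A'v by (simp add: sesq_def w)
    show ?thesis
    proof (cases "cmod w = 1")
      case True
      define \<phi> where "\<phi> = Arg w"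
      have w\<phi>: "w = cis \<phi>" unfolding \<phi>_def using True by (subst cis_Arg) (auto simp: sgn_eq)
      \<comment> \<open>The half angle solves \<open>z * z * w = -1\<close>. Then
        \<open>z * w = - cnj z\<close>, which puts \<open>v\<close> into the kernel of the Hermitian
        part of \<open>z \<cdot>\<^sub>m A\<close>.\<close>
      define z where "z = cis ((pi - \<phi>) / 2)"
      have z1: "cmod z = 1" by (simp add: z_def)
      have "z * z * w = cis pi" by (simp add: z_def w\<phi> cis_mult)
      then have "cnj z * (z * z * w) = - cnj z" by (simp add: cis_pi)
      moreover have "cnj z * z = 1" using complex_norm_square[of z] z1 by (simp add: mult.commute)
      then have "cnj z * (z * z * w) = z * w" by (simp add: mult.assoc[symmetric])
      ultimately have zw: "z * w = - cnj z" by simp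
      let ?C = "z \<cdot>\<^sub>m A" and ?D = "(- z) \<cdot>\<^sub>m A"
      have C: "?C \<in> carrier_mat ?n ?n" "?D \<in> carrier_mat ?n ?n" using A by auto
      have "Re (sesq ?C (x + c \<cdot>\<^sub>v v) (x + c \<cdot>\<^sub>v v)) = Re (sesq ?C x x)" if x: "x \<in> carrier_vec ?n" for x c
      proof -
        have cross: "Re (cnj c * sesq ?C x v + c * sesq ?C v x) = 0" if "x \<in> carrier_vec ?n" for x c
        proof -
          have "c * sesq ?C v x = - cnj (cnj c * sesq ?C x v)"
            using that v zw by (simp add: sesq_smult_mat[OF A] sw mult.assoc[of z w, symmetric] zw)
          then show ?thesis by simp
        qed
        have "Re (sesq ?C v v) = 0" using cross[OF v(1), of 1] by simp
        then have "Re (c * cnj c * sesq ?C v v) = 0" by (simp add: complex_norm_square[symmetric])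
        then show ?thesis
          using cross[OF x, of c] unfolding sesq_add_smult_self[OF C(1) x v(1)] plus_complex.simps
          by linarith
      qed
      moreover have "Re (sesq ?D x x) = - Re (sesq ?C x x)" if "x \<in> carrier_vec ?n" for x
        using that by (simp add: sesq_smult_mat[OF A])
      ultimately have False
        using definite_no_radical[OF C k _ pos pos v] z1 by simp
      then show ?thesis ..
    next
      case False
      \<comment> \<open>The pencil equation paired with \<open>v\<close> equates a number with
        \<open>w\<close> times its own conjugate; for \<open>cmod w \<noteq> 1\<close> that number
        is zero.\<close>
      have "cmod (sesq A v v) = cmod w * cmod (sesq A v v)" using sw[OF v(1)]
        by (metis complex_mod_cnj norm_mult)
      then have "sesq A v v = 0" using False by simp
      then show ?thesis using isotropic_dim_reduce[OF A v k A'v(1) w A'v(2) _ nn IH] by blast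
    qed
  qed
qed

section \<open>Shifts along the real axis\<close>

lemma sesq_shift:
  assumes "A \<in> carrier_mat n n" "x \<in> carrier_vec n" "y \<in> carrier_vec n"
  shows "sesq (A - c \<cdot>\<^sub>m 1\<^sub>m n) x y = sesq A x y - c * (x \<bullet>c y)"
  using assms by (simp add: sesq_minus_mat[of A n] sesq_smult_mat[of "1\<^sub>m n" n] sesq_one)

lemma lam_shift_scalar:
  assumes A: "A \<in> carrier_mat n n" and k: "1 \<le> k" "k \<le> n"
  shows "lam k (z \<cdot>\<^sub>m (A - c \<cdot>\<^sub>m 1\<^sub>m n)) = lam k (z \<cdot>\<^sub>m A) - Re (z * c)"
proof -
  have M: "A - c \<cdot>\<^sub>m 1\<^sub>m n \<in> carrier_mat n n" using A by (auto intro!: minus_carrier_mat)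
  have "lam k (z \<cdot>\<^sub>m A) = lam k (z \<cdot>\<^sub>m (A - c \<cdot>\<^sub>m 1\<^sub>m n)) + Re (z * c)"
  proof (rule lam_shift[OF k])
    fix x :: "complex vec" assume x: "x \<in> carrier_vec n"
    have "z * sesq A x x = z * (sesq A x x - c * (x \<bullet>c x)) + z * c * of_real (nrm2 x)"
      by (simp add: cscalar_prod_nrm2 algebra_simps)
    then have "Re (z * sesq A x x) = Re (z * (sesq A x x - c * (x \<bullet>c x))) + Re (z * c * of_real (nrm2 x))"
      by (metis plus_complex.simps(1))
    moreover have "Re (z * c * of_real (nrm2 x)) = Re (z * c) * nrm2 x" by (simp add: algebra_simps)
    ultimately have "Re (z * sesq A x x) = Re (z * (sesq A x x - c * (x \<bullet>c x))) + Re (z * c) * nrm2 x" by simp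
    then show "Re (sesq (z \<cdot>\<^sub>m A) x x) = Re (sesq (z \<cdot>\<^sub>m (A - c \<cdot>\<^sub>m 1\<^sub>m n)) x x) + Re (z * c) * nrm2 x"
      using x by (simp add: sesq_smult_mat[OF A] sesq_smult_mat[OF M] sesq_shift[OF A])
  qed (use A M in auto)
  then show ?thesis by simp
qed

text \<open>\<open>T\<close> collects the shifts that keep all directions nonnegative. It is closed,
  bounded by the value at \<open>1\<close>, and contains the positive minimum of \<open>?L\<close>.
  At its supremum some direction must become tight, so the boundary case applies there.\<close>

lemma isotropic_shift_exists:
  assumes A: "A \<in> carrier_mat n n" and k: "1 \<le> k" "k \<le> n"
    and pos: "\<And>z. cmod z = 1 \<Longrightarrow> lam k (z \<cdot>\<^sub>m A) > 0"
    and IH: "\<And>j B. B \<in> carrier_mat (n - 1) (n - 1) \<Longrightarrow> (\<And>z. cmod z = 1 \<Longrightarrow> nonneg_dim (n - 1) j B z) \<Longrightarrow>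
               isotropic_dim (n - 1) j B"
  obtains a where "a > 0" "isotropic_dim n k (A - complex_of_real a \<cdot>\<^sub>m 1\<^sub>m n)"
proof -
  let ?L = "\<lambda>z. lam k (z \<cdot>\<^sub>m A)" and ?S = "sphere (0::complex) 1"
  have contL: "continuous_on ?S ?L" using continuous_on_lam[OF A k] continuous_on_subset by blast
  have S_ne: "?S \<noteq> {}" by (auto intro: exI[of _ 1])
  define T where "T = {0..} \<inter> (\<Inter>z\<in>?S. {t. t * Re z \<le> ?L z})"
  have "closed T" unfolding T_def
    by (intro closed_Int closed_INT ballI closed_Collect_le continuous_intros)
  have T_le: "t \<le> ?L 1" if "t \<in> T" for t
  proof -
    have "(1::complex) \<in> ?S" by simp
    then have "t * Re 1 \<le> ?L 1" using that unfolding T_def by blast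
    then show ?thesis by simp
  qed
  then have bdd: "bdd_above T" by (rule bdd_aboveI)
  obtain z1 where z1: "z1 \<in> ?S" "\<And>z. z \<in> ?S \<Longrightarrow> ?L z1 \<le> ?L z"
    using continuous_attains_inf[OF compact_sphere S_ne contL] by blast
  have "?L z1 > 0" using pos z1 by simp
  moreover have "?L z1 \<in> T" unfolding T_def
  proof (intro IntI INT_I CollectI)
    fix z :: complex assume z: "z \<in> ?S"
    have "Re z \<le> 1" using complex_Re_le_cmod[of z] z by simp
    then have "?L z1 * Re z \<le> ?L z1 * 1" using \<open>?L z1 > 0\<close> by (intro mult_left_mono) auto
    then show "?L z1 * Re z \<le> ?L z" using z1(2)[OF z] by simp
  qed (use \<open>?L z1 > 0\<close> in auto)
  define a where "a = Sup T"
  have aT: "a \<in> T" unfolding a_def using closed_contains_Sup[OF _ bdd \<open>closed T\<close>] \<open>?L z1 \<in> T\<close> by blast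
  have "?L z1 \<le> a" unfolding a_def by (rule cSup_upper[OF \<open>?L z1 \<in> T\<close> bdd])
  then have a: "a > 0" using \<open>?L z1 > 0\<close> by simp
  have "continuous_on ?S (\<lambda>z. ?L z - a * Re z)" using contL by (intro continuous_intros)
  from continuous_attains_inf[OF compact_sphere S_ne this] obtain z0 where
    z0: "z0 \<in> ?S" "\<And>z. z \<in> ?S \<Longrightarrow> ?L z0 - a * Re z0 \<le> ?L z - a * Re z" by blast
  have le0: "?L z0 - a * Re z0 \<le> 0"
  proof (rule ccontr)
    let ?d = "?L z0 - a * Re z0"
    assume "\<not> ?d \<le> 0"
    then have d: "?d > 0" by simp
    \<comment> \<open>If the minimal slack \<open>?d\<close> on the circle were positive, the shift
      could grow by it, since \<open>Re z \<le> 1\<close>.\<close>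
    have "a + ?d \<in> T" unfolding T_def
    proof (intro IntI INT_I CollectI)
      fix z :: complex assume z: "z \<in> ?S"
      have "Re z \<le> 1" using complex_Re_le_cmod[of z] z by simp
      then have "?d * Re z \<le> ?d * 1" using d by (intro mult_left_mono) auto
      then show "(a + ?d) * Re z \<le> ?L z" using z0(2)[OF z] by (simp add: distrib_right)
    qed (use a d in auto)
    then have "a + ?d \<le> a" unfolding a_def by (intro cSup_upper bdd)
    then show False using d by simp
  qed
  let ?M = "A - complex_of_real a \<cdot>\<^sub>m 1\<^sub>m n"
  have M: "?M \<in> carrier_mat n n" using A by (auto intro!: minus_carrier_mat)
  have lamM: "lam k (z \<cdot>\<^sub>m ?M) = ?L z - a * Re z" for z
    using lam_shift_scalar[OF A k, of z "of_real a"] by (simp add: mult.commute)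
  have "isotropic_dim n k ?M"
  proof (rule isotropic_dim_boundary[OF M k _ _ _ IH])
    show "cmod z0 = 1" using z0 by simp
    show "lam k (z0 \<cdot>\<^sub>m ?M) \<le> 0" using le0 lamM by simp
    fix z :: complex assume "cmod z = 1"
    then have "z \<in> ?S" by simp
    then have "a * Re z \<le> ?L z" using aT unfolding T_def by blast
    then show "nonneg_dim n k ?M z" using nonneg_dim_iff_lam[OF M k] lamM by simp
  qed
  then show thesis using that a by blast
qed

lemma shift_embedding:
  obtains E F :: "complex mat" where "E \<in> carrier_mat (k + k) k" "inj_mat E" "F \<in> carrier_mat (k + k) k" "inj_mat F"
    "\<And>x. x \<in> carrier_vec k \<Longrightarrow> E *\<^sub>v x = x @\<^sub>v 0\<^sub>v k" "\<And>x. x \<in> carrier_vec k \<Longrightarrow> F *\<^sub>v x = 0\<^sub>v k @\<^sub>v x"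
proof -
  define E :: "complex mat" where "E = mat (k + k) k (\<lambda>(i,j). if i = j then 1 else 0)"
  define F :: "complex mat" where "F = mat (k + k) k (\<lambda>(i,j). if i = j + k then 1 else 0)"
  have c: "E \<in> carrier_mat (k + k) k" "F \<in> carrier_mat (k + k) k" by (auto simp: E_def F_def)
  have Ex: "E *\<^sub>v x = x @\<^sub>v 0\<^sub>v k" if "x \<in> carrier_vec k" for x
  proof (rule eq_vecI)
    fix i assume "i < dim_vec (x @\<^sub>v 0\<^sub>v k)"
    then have i: "i < k + k" using that by simp
    have "row E i = (if i < k then unit_vec k i else 0\<^sub>v k)"
      by (rule eq_vecI) (use i in \<open>auto simp: E_def unit_vec_def\<close>)
    then show "(E *\<^sub>v x) $ i = (x @\<^sub>v 0\<^sub>v k) $ i" using i c that by auto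
  qed (use c that in auto)
  have Fx: "F *\<^sub>v x = 0\<^sub>v k @\<^sub>v x" if "x \<in> carrier_vec k" for x
  proof (rule eq_vecI)
    fix i assume "i < dim_vec (0\<^sub>v k @\<^sub>v x)"
    then have i: "i < k + k" using that by simp
    have "row F i = (if i < k then 0\<^sub>v k else unit_vec k (i - k))"
      by (rule eq_vecI) (use i in \<open>auto simp: F_def unit_vec_def\<close>)
    then show "(F *\<^sub>v x) $ i = (0\<^sub>v k @\<^sub>v x) $ i" using i c that by auto
  qed (use c that in auto)
  have "inj_mat E"
  proof (rule inj_matI[OF c(1)])
    fix y :: "complex vec" assume y: "y \<in> carrier_vec k" "E *\<^sub>v y = 0\<^sub>v (k + k)"
    then have "y @\<^sub>v 0\<^sub>v k = 0\<^sub>v k @\<^sub>v 0\<^sub>v k" using Ex append_zero_vec by simp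
    then show "y = 0\<^sub>v k" using append_vec_eq[OF y(1) zero_carrier_vec] by simp
  qed
  moreover have "inj_mat F"
  proof (rule inj_matI[OF c(2)])
    fix y :: "complex vec" assume y: "y \<in> carrier_vec k" "F *\<^sub>v y = 0\<^sub>v (k + k)"
    then have "0\<^sub>v k @\<^sub>v y = 0\<^sub>v k @\<^sub>v 0\<^sub>v k" using Fx append_zero_vec by simp
    then show "y = 0\<^sub>v k" using append_vec_eq[of "0\<^sub>v k :: complex vec" k "0\<^sub>v k"] by simp
  qed
  ultimately show thesis using that c Ex Fx by blast
qed

text \<open>With \<open>Z = [X Y]\<close> for isotropic \<open>X\<close> and \<open>Y\<close> of the two shifts, the form of \<open>A\<close> is a positive multiple
  of the norm on the range of \<open>X\<close> and a negative one on the range of \<open>Y\<close>: the two ranges are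
  independent, and one of them serves each direction \<open>z\<close>.\<close>

lemma isotropic_dim_between:
  assumes A: "A \<in> carrier_mat n n" and "a > 0" "b > 0"
    and iX: "isotropic_dim n k (A - complex_of_real a \<cdot>\<^sub>m 1\<^sub>m n)"
    and iY: "isotropic_dim n k (A - complex_of_real (- b) \<cdot>\<^sub>m 1\<^sub>m n)"
  obtains Z where "Z \<in> carrier_mat n (k + k)" "inj_mat Z" "\<And>z. nonneg_dim (k + k) k (mat_adjoint Z * A * Z) z"
proof -
  have shift: "\<exists>X \<in> carrier_mat n k. inj_mat X \<and>
      (\<forall>y \<in> carrier_vec k. sesq A (X *\<^sub>v y) (X *\<^sub>v y) = of_real (c * nrm2 (X *\<^sub>v y)))"
    if "isotropic_dim n k (A - complex_of_real c \<cdot>\<^sub>m 1\<^sub>m n)" for c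
  proof -
    have "sesq (A - complex_of_real c \<cdot>\<^sub>m 1\<^sub>m n) x x = 0 \<Longrightarrow> sesq A x x = of_real (c * nrm2 x)"
      if "x \<in> carrier_vec n" for x
      using sesq_shift[OF A that that, of "of_real c"] by (simp add: cscalar_prod_nrm2)
    then show ?thesis using that unfolding isotropic_dim_def by (metis mult_mat_vec_carrier)
  qed
  obtain X where X: "X \<in> carrier_mat n k" "inj_mat X"
    and qX: "\<And>y. y \<in> carrier_vec k \<Longrightarrow> sesq A (X *\<^sub>v y) (X *\<^sub>v y) = of_real (a * nrm2 (X *\<^sub>v y))"
    using shift[OF iX] by blast
  obtain Y where Y: "Y \<in> carrier_mat n k" "inj_mat Y"
    and qY: "\<And>y. y \<in> carrier_vec k \<Longrightarrow> sesq A (Y *\<^sub>v y) (Y *\<^sub>v y) = of_real (- b * nrm2 (Y *\<^sub>v y))"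
    using shift[OF iY] by blast
  let ?Z = "hcat X Y"
  have Z: "?Z \<in> carrier_mat n (k + k)" by (rule hcat_carrier[OF X(1) Y(1)])
  have injZ: "inj_mat ?Z"
  proof (rule ccontr)
    assume "\<not> inj_mat ?Z"
    from inj_hcatD[OF X(1) Y(1) this] obtain x y where xy: "x \<in> carrier_vec k" "y \<in> carrier_vec k"
      "X *\<^sub>v x + Y *\<^sub>v y = 0\<^sub>v n" "x \<noteq> 0\<^sub>v k \<or> y \<noteq> 0\<^sub>v k" .
    have c: "X *\<^sub>v x \<in> carrier_vec n" "Y *\<^sub>v y \<in> carrier_vec n" using X Y xy by auto
    have eq: "X *\<^sub>v x = (-1) \<cdot>\<^sub>v (Y *\<^sub>v y)"
    proof (rule eq_vecI)
      fix i assume "i < dim_vec ((-1) \<cdot>\<^sub>v (Y *\<^sub>v y))"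
      then have i: "i < n" using Y(1) by simp
      have "(X *\<^sub>v x + Y *\<^sub>v y) $ i = 0" unfolding xy(3) using i by simp
      then have "(X *\<^sub>v x) $ i + (Y *\<^sub>v y) $ i = 0" using i c Y by (subst (asm) index_add_vec) auto
      then have "(X *\<^sub>v x) $ i = - (Y *\<^sub>v y) $ i" by (simp add: eq_neg_iff_add_eq_0)
      then show "(X *\<^sub>v x) $ i = ((-1) \<cdot>\<^sub>v (Y *\<^sub>v y)) $ i" using i Y by simp
    qed (use X Y in auto)
    \<comment> \<open>On a common vector the form would be both nonnegative and nonpositive, with
      equality only at zero.\<close>
    have "sesq A (X *\<^sub>v x) (X *\<^sub>v x) = sesq A (Y *\<^sub>v y) (Y *\<^sub>v y)"
      unfolding eq using c by (simp add: sesq_simps[OF A])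
    then have "complex_of_real (a * nrm2 (X *\<^sub>v x)) = of_real (- b * nrm2 (Y *\<^sub>v y))"
      using qX[OF xy(1)] qY[OF xy(2)] by simp
    then have "a * nrm2 (X *\<^sub>v x) = - b * nrm2 (Y *\<^sub>v y)" unfolding of_real_eq_iff .
    moreover have "a * nrm2 (X *\<^sub>v x) \<ge> 0" "b * nrm2 (Y *\<^sub>v y) \<ge> 0" using assms nrm2_nonneg by auto
    ultimately have "a * nrm2 (X *\<^sub>v x) = 0" "b * nrm2 (Y *\<^sub>v y) = 0" by linarith+
    then have "X *\<^sub>v x = 0\<^sub>v n" "Y *\<^sub>v y = 0\<^sub>v n" using assms nrm2_pos_iff[OF c(1)] nrm2_pos_iff[OF c(2)] by auto
    then show False using xy inj_matD[OF X(2,1) xy(1)] inj_matD[OF Y(2,1) xy(2)] by auto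
  qed
  from shift_embedding[of k] obtain E F :: "complex mat" where
    E: "E \<in> carrier_mat (k + k) k" "inj_mat E" and F: "F \<in> carrier_mat (k + k) k" "inj_mat F"
    and Ex: "\<And>x. x \<in> carrier_vec k \<Longrightarrow> E *\<^sub>v x = x @\<^sub>v 0\<^sub>v k"
    and Fx: "\<And>x. x \<in> carrier_vec k \<Longrightarrow> F *\<^sub>v x = 0\<^sub>v k @\<^sub>v x" by blast
  have ZE: "?Z *\<^sub>v (E *\<^sub>v x) = X *\<^sub>v x" "?Z *\<^sub>v (F *\<^sub>v x) = Y *\<^sub>v x" if "x \<in> carrier_vec k" for x
    unfolding Ex[OF that] Fx[OF that]
    using hcat_mult_vec[OF X(1) Y(1) that zero_carrier_vec] hcat_mult_vec[OF X(1) Y(1) zero_carrier_vec that] X Y that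
    by auto
  have "nonneg_dim (k + k) k (mat_adjoint ?Z * A * ?Z) z" for z
  proof (cases "Re z \<ge> 0")
    case True
    show ?thesis
      by (rule nonneg_dim_restrictI[OF A Z E])
        (use True assms nrm2_nonneg in \<open>simp add: ZE qX\<close>)
  next
    case False
    show ?thesis
      by (rule nonneg_dim_restrictI[OF A Z F])
        (use False assms nrm2_nonneg in \<open>simp add: ZE qY mult_nonpos_nonneg\<close>)
  qed
  then show thesis using that Z injZ by blast
qed

text \<open>The induction is strong and leaves \<open>k\<close> arbitrary because the reductions
  lead from \<open>(n, k)\<close> to \<open>(n - 1, k)\<close>, \<open>(n - 1, k - 1)\<close> and
  \<open>(2 k, k)\<close>. The range \<open>n < 2 k\<close> requires no case of its own: if all
  \<open>lam\<close> are positive, the injective \<open>Z\<close> with \<open>2 k\<close> columns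
  forces \<open>2 k \<le> n\<close>.\<close>

theorem isotropic_dim_if_nonneg_dim:
  assumes "A \<in> carrier_mat n n" "\<And>z. cmod z = 1 \<Longrightarrow> nonneg_dim n k A z"
  shows "isotropic_dim n k A"
  using assms
proof (induction n arbitrary: A k rule: less_induct)
  case (less n)
  note A = less.prems(1) and nn = less.prems(2)
  show ?case
  proof (cases "k = 0")
    \<comment> \<open>Removing radical vectors can bring \<open>k\<close> down to \<open>0\<close>;
      the witness is the matrix without columns.\<close>
    case True
    have X: "(0\<^sub>m n 0 :: complex mat) \<in> carrier_mat n 0" by simp
    have "y = 0\<^sub>v 0" if "y \<in> carrier_vec 0" for y :: "complex vec" using that by (intro eq_vecI) auto
    then have "inj_mat (0\<^sub>m n 0)" by (intro inj_matI[OF X]) auto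
    moreover have "sesq A (0\<^sub>m n 0 *\<^sub>v y) (0\<^sub>m n 0 *\<^sub>v y) = 0" if "y \<in> carrier_vec 0" for y
    proof -
      have "(0\<^sub>m n 0 :: complex mat) *\<^sub>v y = 0\<^sub>v n"
        by (rule eq_vecI) (use that in \<open>auto simp: scalar_prod_def\<close>)
      then show ?thesis using A by (simp add: sesq_def)
    qed
    ultimately show ?thesis unfolding isotropic_dim_def using X True by blast
  next
    case False
    then have k: "1 \<le> k" by simp
    have k': "k \<le> n" using nonneg_dim_le[OF nn[of 1]] by simp
    have "n - 1 < n" using k k' by simp
    note IH = less.IH[OF this]
    show ?thesis
    proof (cases "\<exists>z. cmod z = 1 \<and> lam k (z \<cdot>\<^sub>m A) \<le> 0")
      case True
      then show ?thesis using isotropic_dim_boundary[OF A k k' nn _ _ IH] by blast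
    next
      case False
      then have pos: "lam k (z \<cdot>\<^sub>m A) > 0" if "cmod z = 1" for z using that by force
      show ?thesis
      proof (cases "n = 2 * k")
        case True
        show ?thesis using isotropic_dim_half[of A k] A k pos IH unfolding True by blast
      next
        case n: False
        obtain a where a: "a > 0" "isotropic_dim n k (A - complex_of_real a \<cdot>\<^sub>m 1\<^sub>m n)"
          using isotropic_shift_exists[OF A k k' pos IH] by blast
        \<comment> \<open>A positive shift of \<open>- A\<close> is a negative shift of
          \<open>A\<close>, which supplies the second isotropic subspace.\<close>
        let ?A' = "(- 1) \<cdot>\<^sub>m A"
        have A': "?A' \<in> carrier_mat n n" using A by simp
        have "z \<cdot>\<^sub>m ?A' = (- z) \<cdot>\<^sub>m A" for z by (rule eq_matI) auto
        then have "lam k (z \<cdot>\<^sub>m ?A') > 0" if "cmod z = 1" for z using pos[of "- z"] that by simp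
        then obtain b where b: "b > 0" "isotropic_dim n k (?A' - complex_of_real b \<cdot>\<^sub>m 1\<^sub>m n)"
          using isotropic_shift_exists[OF A' k k' _ IH] by blast
        have "sesq (A - complex_of_real (- b) \<cdot>\<^sub>m 1\<^sub>m n) x x = - sesq (?A' - complex_of_real b \<cdot>\<^sub>m 1\<^sub>m n) x x"
          if "x \<in> carrier_vec n" for x
          using that by (simp add: sesq_shift[OF A] sesq_shift[OF A'] sesq_smult_mat[OF A])
        then have "isotropic_dim n k (A - complex_of_real (- b) \<cdot>\<^sub>m 1\<^sub>m n)"
          using b(2) unfolding isotropic_dim_def by fastforce
        from isotropic_dim_between[OF A a(1) b(1) a(2) this] obtain Z where
          Z: "Z \<in> carrier_mat n (k + k)" "inj_mat Z" "\<And>z. nonneg_dim (k + k) k (mat_adjoint Z * A * Z) z" by blast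
        have "k + k < n" using inj_mat_le[OF Z(1,2)] n by simp
        moreover have aZ: "mat_adjoint Z \<in> carrier_mat (k + k) n" using Z by simp
        have "mat_adjoint Z * A * Z \<in> carrier_mat (k + k) (k + k)"
          by (rule mult_carrier_mat[OF mult_carrier_mat[OF aZ A] Z(1)])
        ultimately have "isotropic_dim (k + k) k (mat_adjoint Z * A * Z)" using less.IH Z(3) by blast
        then show ?thesis by (rule isotropic_dim_restrict[OF A Z(1,2)])
      qed
    qed
  qed
qed

section \<open>Half-plane description of the rank-k numerical range\<close>

text \<open>Polarization with the coefficients \<open>1\<close> and \<open>\<i>\<close> separates
  the two mixed terms.\<close>

lemma sesq_zero_if_quadratic_zero:
  assumes B: "B \<in> carrier_mat n n" and "\<And>x. x \<in> S \<Longrightarrow> x \<in> carrier_vec n"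
    and q: "\<And>x. x \<in> S \<Longrightarrow> sesq B x x = 0"
    and S: "\<And>x y c. x \<in> S \<Longrightarrow> y \<in> S \<Longrightarrow> x + c \<cdot>\<^sub>v y \<in> S"
    and "x \<in> S" "y \<in> S"
  shows "sesq B x y = 0"
proof -
  have "cnj c * sesq B x y + c * sesq B y x = 0" for c
    using sesq_add_smult_self[OF B, of x y c] q S assms by simp
  from this[of 1] this[of \<i>] have "sesq B x y + sesq B y x = 0" "\<i> * (sesq B y x - sesq B x y) = 0"
    by (auto simp: algebra_simps)
  then have "sesq B y x = sesq B x y" "2 * sesq B x y = 0" by auto
  then show ?thesis by simp
qed

lemma eig_fun_eq_lam:
  assumes A: "A \<in> carrier_mat n n"
  shows "eig_fun k A \<theta> = lam k (cis (- \<theta>) \<cdot>\<^sub>m A)"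
proof -
  have "complex_of_real (cos \<theta>) \<cdot>\<^sub>m re_mat A + complex_of_real (sin \<theta>) \<cdot>\<^sub>m im_mat A = re_mat (cis (- \<theta>) \<cdot>\<^sub>m A)"
  proof (rule eq_matI)
    fix i j assume "i < dim_row (re_mat (cis (- \<theta>) \<cdot>\<^sub>m A))" "j < dim_col (re_mat (cis (- \<theta>) \<cdot>\<^sub>m A))"
    then have ij: "i < n" "j < n" using A by (auto simp: re_mat_def)
    have a: "cis (- \<theta>) = cos \<theta> - \<i> * sin \<theta>" "cnj (cis (- \<theta>)) = cos \<theta> + \<i> * sin \<theta>"
      by (simp_all add: complex_eq_iff)
    have "(x + y) / 2 * c + (x - y) / (2 * \<i>) * s = ((c - \<i> * s) * x + (c + \<i> * s) * y) / 2" for x y c s :: complex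
      by (simp add: field_simps)
    from this[of "A $$ (i,j)" "cnj (A $$ (j,i))" "cos \<theta>" "sin \<theta>"]
    show "(complex_of_real (cos \<theta>) \<cdot>\<^sub>m re_mat A + complex_of_real (sin \<theta>) \<cdot>\<^sub>m im_mat A) $$ (i,j) =
        re_mat (cis (- \<theta>) \<cdot>\<^sub>m A) $$ (i,j)"
      using ij A unfolding re_mat_def im_mat_def
      by (simp add: a[symmetric] mult.commute del: cis_cnj)
  qed (use A in \<open>auto simp: re_mat_def im_mat_def\<close>)
  then show ?thesis by (simp add: eig_fun_def lam_def)
qed

text \<open>A compression to \<open>\<mu>\<close> makes the form equal to \<open>\<mu>\<close> times
  the squared norm on a \<open>k\<close>-dimensional subspace, which tests \<open>lam\<close> in
  every direction. Conversely, the half-plane conditions are the nonnegativity conditions for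
  \<open>A\<close> shifted by \<open>\<mu>\<close>; an isotropic subspace of the shift is
  orthonormalized, and polarization turns the quadratic identity into a matrix identity.\<close>

lemma rank_num_range_eq:
  assumes A: "A \<in> carrier_mat n n" and k: "1 \<le> k" "k \<le> n"
  shows "rank_num_range k A = {\<mu>. \<forall>\<theta>. Re \<mu> * cos \<theta> + Im \<mu> * sin \<theta> \<le> eig_fun k A \<theta>}"
proof (intro equalityI subsetI)
  fix \<mu> assume "\<mu> \<in> rank_num_range k A"
  then obtain X where X: "X \<in> carrier_mat n k" "mat_adjoint X * X = 1\<^sub>m k" "mat_adjoint X * A * X = \<mu> \<cdot>\<^sub>m 1\<^sub>m k"
    using A unfolding rank_num_range_def by auto
  have injX: "inj_mat X" by (rule inj_mat_left_inverse[OF X(2,1)]) (use X in auto)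
  have "Re \<mu> * cos \<theta> + Im \<mu> * sin \<theta> \<le> lam k (cis (- \<theta>) \<cdot>\<^sub>m A)" for \<theta>
  proof (subst le_lam_iff[OF k], use A in simp, intro bexI[OF _ X(1)] conjI injX ballI)
    fix y :: "complex vec" assume y: "y \<in> carrier_vec k"
    have Xy: "X *\<^sub>v y \<in> carrier_vec n" using X y by simp
    have "sesq A (X *\<^sub>v y) (X *\<^sub>v y) = \<mu> * of_real (nrm2 y)"
      using sesq_congruence[OF A X(1) y y] y X(3)
      by (simp add: sesq_smult_mat[of "1\<^sub>m k" k] sesq_one[OF y] cscalar_prod_nrm2)
    moreover have "nrm2 (X *\<^sub>v y) = nrm2 y"
      using sesq_gram[OF X(1) y y] y X(2) by (simp add: sesq_one[OF y] nrm2_def)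
    ultimately show "(Re \<mu> * cos \<theta> + Im \<mu> * sin \<theta>) * nrm2 (X *\<^sub>v y) \<le>
        Re (sesq (cis (- \<theta>) \<cdot>\<^sub>m A) (X *\<^sub>v y) (X *\<^sub>v y))"
      using Xy by (simp add: sesq_smult_mat[OF A] algebra_simps)
  qed
  then show "\<mu> \<in> {\<mu>. \<forall>\<theta>. Re \<mu> * cos \<theta> + Im \<mu> * sin \<theta> \<le> eig_fun k A \<theta>}"
    by (simp add: eig_fun_eq_lam[OF A])
next
  fix \<mu> assume "\<mu> \<in> {\<mu>. \<forall>\<theta>. Re \<mu> * cos \<theta> + Im \<mu> * sin \<theta> \<le> eig_fun k A \<theta>}"
  then have le: "Re \<mu> * cos \<theta> + Im \<mu> * sin \<theta> \<le> lam k (cis (- \<theta>) \<cdot>\<^sub>m A)" for \<theta>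
    by (simp add: eig_fun_eq_lam[OF A])
  let ?M = "A - \<mu> \<cdot>\<^sub>m 1\<^sub>m n"
  have M: "?M \<in> carrier_mat n n" using A by (auto intro!: minus_carrier_mat)
  have "nonneg_dim n k ?M z" if z: "cmod z = 1" for z
  proof -
    have "z = cis (- (- Arg z))" using z by (subst minus_minus, subst cis_Arg) (auto simp: sgn_eq)
    then obtain \<theta> where z\<theta>: "z = cis (- \<theta>)" by blast
    show ?thesis
      unfolding nonneg_dim_iff_lam[OF M k] lam_shift_scalar[OF A k] z\<theta>
      using le[of \<theta>] by (simp add: algebra_simps)
  qed
  from isotropic_dim_if_nonneg_dim[OF M this] obtain X where X: "X \<in> carrier_mat n k" "inj_mat X"
    and iso: "\<And>y. y \<in> carrier_vec k \<Longrightarrow> sesq ?M (X *\<^sub>v y) (X *\<^sub>v y) = 0" unfolding isotropic_dim_def by blast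
  from orthonormalize[OF X] obtain R where R: "R \<in> carrier_mat k k" "mat_adjoint (X * R) * (X * R) = 1\<^sub>m k" by blast
  let ?Y = "X * R" and ?S = "(\<lambda>u. X *\<^sub>v u) ` carrier_vec k"
  have Y: "?Y \<in> carrier_mat n k" using X R by simp
  have colY: "col ?Y j \<in> ?S" if "j < k" for j
    unfolding col_mult2[OF X(1) R(1) that] using R that by (intro imageI) simp
  have S: "x + c \<cdot>\<^sub>v y \<in> ?S" if xy: "x \<in> ?S" "y \<in> ?S" for x y c
  proof -
    obtain u w where "u \<in> carrier_vec k" "x = X *\<^sub>v u" "w \<in> carrier_vec k" "y = X *\<^sub>v w" using xy by blast
    then show ?thesis using X
      by (intro image_eqI[of _ _ "u + c \<cdot>\<^sub>v w"]) (auto simp: mult_add_distrib_mat_vec[OF X(1)] mult_mat_vec[OF X(1)])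
  qed
  have zero: "sesq ?M (col ?Y j) (col ?Y i) = 0" if "i < k" "j < k" for i j
    by (rule sesq_zero_if_quadratic_zero[OF M _ _ S colY colY]) (use iso X that in auto)
  have "mat_adjoint ?Y * A * ?Y = \<mu> \<cdot>\<^sub>m 1\<^sub>m k"
  proof (rule eq_matI)
    fix i j assume "i < dim_row (\<mu> \<cdot>\<^sub>m 1\<^sub>m k)" "j < dim_col (\<mu> \<cdot>\<^sub>m 1\<^sub>m k)"
    then have ij: "i < k" "j < k" by auto
    have c: "col ?Y j \<in> carrier_vec n" "col ?Y i \<in> carrier_vec n" using colY[OF ij(1)] colY[OF ij(2)] X(1) by auto
    have "col ?Y j \<bullet>c col ?Y i = 1\<^sub>m k $$ (i,j)" using index_gram[OF Y ij] R(2) by simp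
    then have "sesq A (col ?Y j) (col ?Y i) = \<mu> * 1\<^sub>m k $$ (i,j)"
      using zero[OF ij] sesq_shift[OF A c, of \<mu>] by simp
    then show "(mat_adjoint ?Y * A * ?Y) $$ (i,j) = (\<mu> \<cdot>\<^sub>m 1\<^sub>m k) $$ (i,j)"
      unfolding index_congruence[OF A Y ij] using ij by simp
  qed (use X R in auto)
  then show "\<mu> \<in> rank_num_range k A"
    unfolding rank_num_range_def using Y R(2) A by auto
qed

lemma eig_fun_antipodal:
  assumes A: "A \<in> carrier_mat n n" and k: "1 \<le> k" "k \<le> n"
  shows "eig_fun k A (\<theta> + pi) = - eig_fun (n - k + 1) A \<theta>"
proof -
  let ?H = "\<lambda>\<theta>. cis (- \<theta>) \<cdot>\<^sub>m A"
  have H: "?H \<theta> \<in> carrier_mat n n" for \<theta> using A by simp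
  have "cis (- (\<theta> + pi)) = - cis (- \<theta>)" by (simp add: complex_eq_iff)
  then have "Re (sesq (re_mat (?H (\<theta> + pi))) x x) = - Re (sesq (re_mat (?H \<theta>)) x x)" if "x \<in> carrier_vec n" for x
    unfolding sesq_re_mat_self[OF H that] sesq_smult_mat[OF A that that] by simp
  from nth_eigenvalue_uminus[OF re_mat_carrier[OF H] mat_adjoint_re_mat[OF H] k
      re_mat_carrier[OF H] mat_adjoint_re_mat[OF H] this]
  show ?thesis by (simp add: eig_fun_eq_lam[OF A] lam_def)
qed

lemma eig_fun_antimono:
  assumes A: "A \<in> carrier_mat n n" and "1 \<le> j" "j \<le> k" "k \<le> n"
  shows "eig_fun k A \<theta> \<le> eig_fun j A \<theta>"
  unfolding eig_fun_eq_lam[OF A] lam_def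
  by (rule nth_eigenvalue_antimono[of _ n]) (use assms mat_adjoint_re_mat[of "cis (- \<theta>) \<cdot>\<^sub>m A" n] in auto)

lemma continuous_on_eig_fun:
  assumes A: "A \<in> carrier_mat n n" and k: "1 \<le> k" "k \<le> n"
  shows "continuous_on UNIV (eig_fun k A)"
  unfolding eig_fun_eq_lam[OF A, abs_def] using continuous_on_lam[OF A k]
  by (intro continuous_on_compose2[of UNIV "\<lambda>z. lam k (z \<cdot>\<^sub>m A)" UNIV "\<lambda>\<theta>. cis (- \<theta>)"] continuous_intros) auto

lemma eig_fun_cong: "cos \<phi> = cos \<theta> \<Longrightarrow> sin \<phi> = sin \<theta> \<Longrightarrow> eig_fun k A \<phi> = eig_fun k A \<theta>"
  by (simp add: eig_fun_def)

section \<open>Faces of the convex hull of the curve\<close>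

text \<open>The smallest face containing \<open>x\<close> works: if \<open>x\<close> were on its
  relative boundary, a supporting hyperplane would cut out a smaller face through
  \<open>x\<close>.\<close>

lemma exists_face_rel_interior:
  fixes S :: "'a::euclidean_space set"
  assumes S: "convex S" "x \<in> S"
  obtains F where "F face_of S" "x \<in> rel_interior F"
proof -
  let ?\<F> = "{T. T face_of S \<and> x \<in> T}"
  define F where "F = \<Inter>?\<F>"
  have "S \<in> ?\<F>" using assms face_of_refl by auto
  then have F: "F face_of S" unfolding F_def by (intro face_of_Inter) auto
  have xF: "x \<in> F" by (auto simp: F_def)
  have convF: "convex F" using F by (rule face_of_imp_convex)
  have "x \<in> rel_interior F"
  proof (rule ccontr)
    assume "x \<notin> rel_interior F"
    from supporting_hyperplane_rel_boundary[OF convF xF this] obtain a where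
      a: "\<And>y. y \<in> F \<Longrightarrow> inner a x \<le> inner a y" "\<And>y. y \<in> rel_interior F \<Longrightarrow> inner a x < inner a y" by metis
    have "(F \<inter> {y. inner a y = inner a x}) face_of F"
      by (rule face_of_Int_supporting_hyperplane_ge[OF convF a(1)])
    then have "(F \<inter> {y. inner a y = inner a x}) face_of S" using F face_of_trans by blast
    then have sub: "F \<subseteq> {y. inner a y = inner a x}" using xF unfolding F_def by blast
    have "rel_interior F \<noteq> {}" using rel_interior_eq_empty[OF convF] xF by auto
    then show False using a(2) sub rel_interior_subset by fastforce
  qed
  then show thesis using that F by blast
qed

text \<open>The segment from \<open>p\<close> to the origin can be prolonged inside
  \<open>S\<close>, and the functional changes sign along it unless it is zero at
  \<open>p\<close>.\<close>

lemma linear_zero_on_rel_interior: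
  fixes S :: "'a::euclidean_space set"
  assumes "convex S" "0 \<in> rel_interior S" and nn: "\<And>p. p \<in> S \<Longrightarrow> 0 \<le> inner w p" and p: "p \<in> S"
  shows "inner w p = 0"
proof -
  have "p \<in> affine hull S" using p by (rule hull_inc)
  with bspec[OF convex_rel_interior_if2[OF assms(1,2)]] obtain e where "e > 1" "(1 - e) *\<^sub>R p \<in> S"
    by auto
  then have "0 \<le> (1 - e) * inner w p" using nn[of "(1 - e) *\<^sub>R p"] by simp
  then have "inner w p \<le> 0" using \<open>e > 1\<close> by (simp add: zero_le_mult_iff)
  then show ?thesis using nn[OF p] by simp
qed

lemma rel_interior_eq_interior_if_full:
  fixes S :: "'a::euclidean_space set"
  assumes "0 \<in> S" and "\<And>a. a \<noteq> 0 \<Longrightarrow> \<exists>x\<in>S. inner a x \<noteq> 0"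
  shows "aff_dim S = DIM('a)" "rel_interior S = interior S"
proof -
  have "dim S = DIM('a)"
  proof (rule ccontr)
    assume "dim S \<noteq> DIM('a)"
    then have "dim S < DIM('a)" using dim_subset_UNIV[of S] by simp
    from lowdim_subset_hyperplane[OF this] obtain a where "a \<noteq> 0" "span S \<subseteq> {x. inner a x = 0}" by blast
    moreover obtain x where "x \<in> S" "inner a x \<noteq> 0" using assms(2)[OF \<open>a \<noteq> 0\<close>] by (rule bexE)
    ultimately show False using span_base[of x S] by auto
  qed
  moreover have "0 \<in> affine hull S" using assms(1) by (rule hull_inc)
  ultimately show "aff_dim S = DIM('a)" using aff_dim_zero by metis
  then have "affine hull S = UNIV" by (simp only: aff_dim_eq_full)
  then show "rel_interior S = interior S" by (rule rel_interior_interior)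
qed

text \<open>The properties of \<open>eig_fun k A\<close> on which the convex geometry rests. The
  minus signs in \<open>nonplanar\<close> are those of the curve, so the expression is a linear
  functional evaluated at a point of the curve.\<close>

locale support_curve =
  fixes f :: "real \<Rightarrow> real"
  assumes cont: "continuous_on UNIV f"
    and cong: "cos \<phi> = cos \<theta> \<Longrightarrow> sin \<phi> = sin \<theta> \<Longrightarrow> f \<phi> = f \<theta>"
    and sum_nonneg: "0 \<le> f \<theta> + f (\<theta> + pi)"
    and nonplanar: "(c, a, b) \<noteq> (0, 0, 0 :: real) \<Longrightarrow> \<exists>\<theta>. c * f \<theta> - a * cos \<theta> - b * sin \<theta> \<noteq> 0"
begin

definition P :: "real \<Rightarrow> real \<times> real \<times> real" where
  "P \<theta> = (f \<theta>, - cos \<theta>, - sin \<theta>)"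

text \<open>The whole real line serves as parameter range, so that \<open>\<theta> + pi\<close> is
  always admissible; by periodicity the curve is the same as over one period.\<close>

definition C :: "(real \<times> real \<times> real) set" where
  "C = convex hull range P"

definition R :: "complex set" where
  "R = {\<mu>. \<forall>\<theta>. Re \<mu> * cos \<theta> + Im \<mu> * sin \<theta> \<le> f \<theta>}"

lemma range_P: "range P = P ` {0..<2 * pi}"
proof -
  have "P \<theta> \<in> P ` {0..<2 * pi}" for \<theta>
  proof -
    obtain t where "0 \<le> t" "t < 2 * pi" "cos \<theta> = cos t" "sin \<theta> = sin t"
      using sincos_total_2pi[of "cos \<theta>" "sin \<theta>"] by auto
    then show ?thesis using cong[of \<theta> t] by (intro image_eqI[of _ _ t]) (auto simp: P_def)
  qed
  then show ?thesis by auto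
qed

lemma compact_C: "compact C"
proof -
  have "range P = P ` {0..2 * pi}" using range_P by auto
  moreover have "continuous_on {0..2 * pi} P"
    unfolding P_def[abs_def] using cont continuous_on_subset by (intro continuous_intros) blast
  ultimately have "compact (range P)" by (metis compact_Icc compact_continuous_image)
  then show ?thesis unfolding C_def by (rule compact_convex_hull)
qed

lemma convex_C: "convex C"
  by (simp add: C_def)

lemma P_in_C: "P \<theta> \<in> C"
  by (simp add: C_def hull_inc)

lemma inner_P: "inner (c, a, b) (P \<theta>) = c * f \<theta> - a * cos \<theta> - b * sin \<theta>"
  by (simp add: P_def inner_Pair)

lemma inner_C_ge: "(\<And>\<theta>. d \<le> inner w (P \<theta>)) \<Longrightarrow> p \<in> C \<Longrightarrow> d \<le> inner w p"
proof -
  assume "\<And>\<theta>. d \<le> inner w (P \<theta>)"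
  then have "C \<subseteq> {p. inner w p \<ge> d}"
    unfolding C_def by (intro hull_minimal convex_halfspace_ge) auto
  then show "p \<in> C \<Longrightarrow> d \<le> inner w p" by auto
qed

lemma R_inner_nonneg: "\<mu> \<in> R \<Longrightarrow> p \<in> C \<Longrightarrow> 0 \<le> inner (1, Re \<mu>, Im \<mu>) p"
  by (rule inner_C_ge) (auto simp: R_def inner_P algebra_simps)

lemma convex_R: "convex R"
proof -
  have "R = (\<Inter>\<theta>. {\<mu>. inner (Complex (cos \<theta>) (sin \<theta>)) \<mu> \<le> f \<theta>})"
    by (auto simp: R_def inner_complex_def mult.commute)
  then show ?thesis by (auto intro!: convex_INT convex_halfspace_le)
qed

lemma full_dim:
  assumes "0 \<in> C"
  shows "aff_dim C = 3" "rel_interior C = interior C"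
proof -
  have "\<exists>x\<in>C. inner w x \<noteq> 0" if w: "w \<noteq> 0" for w :: "real \<times> real \<times> real"
  proof -
    obtain c a b where cab: "w = (c, a, b)" by (cases w)
    with w have "(c, a, b) \<noteq> (0, 0, 0)" by (simp add: zero_prod_def)
    from nonplanar[OF this] show ?thesis unfolding cab inner_P[symmetric] using P_in_C by blast
  qed
  from rel_interior_eq_interior_if_full[OF assms this]
  show "aff_dim C = 3" "rel_interior C = interior C" by auto
qed

text \<open>Adding the values at antipodal parameters cancels \<open>a\<close> and \<open>b\<close>
  and leaves \<open>c\<close> times a nonnegative sum. For \<open>c \<le> 0\<close> both values
  would be zero for all \<open>\<theta>\<close>, which puts the curve into a plane through the
  origin.\<close>

lemma supporting_coeff_pos:
  assumes w: "(c, a, b) \<noteq> (0, 0, 0)" and nn: "\<And>\<theta>. 0 \<le> inner (c, a, b) (P \<theta>)"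
  shows "c > 0"
proof (rule ccontr)
  assume "\<not> c > 0"
  have sum: "inner (c, a, b) (P \<theta>) + inner (c, a, b) (P (\<theta> + pi)) = c * (f \<theta> + f (\<theta> + pi))" for \<theta>
    by (simp add: inner_P algebra_simps)
  have "c * (f \<theta> + f (\<theta> + pi)) \<le> 0" for \<theta>
    using \<open>\<not> c > 0\<close> sum_nonneg by (intro mult_nonpos_nonneg) auto
  then have "inner (c, a, b) (P \<theta>) = 0" for \<theta>
    using sum[of \<theta>] nn[of \<theta>] nn[of "\<theta> + pi"] by (smt (verit))
  then show False using nonplanar[OF w] inner_P by simp
qed

text \<open>A supporting functional at the origin, scaled to first coefficient \<open>1\<close>, is
  a point of \<open>R\<close>.\<close>

lemma R_nonempty:
  assumes "0 \<in> C" "0 \<notin> rel_interior C"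
  shows "R \<noteq> {}"
proof -
  from supporting_hyperplane_rel_boundary[OF convex_C assms] obtain w where
    w: "w \<noteq> 0" "\<And>y. y \<in> C \<Longrightarrow> inner w 0 \<le> inner w y" by metis
  obtain c a b where cab: "w = (c, a, b)" by (cases w)
  have ne: "(c, a, b) \<noteq> (0, 0, 0)" using w(1) by (simp add: cab zero_prod_def)
  have nn: "0 \<le> inner (c, a, b) (P \<theta>)" for \<theta> using w(2)[OF P_in_C] cab by simp
  have c: "c > 0" by (rule supporting_coeff_pos[OF ne nn])
  have "a / c * cos \<theta> + b / c * sin \<theta> \<le> f \<theta>" for \<theta>
    using nn[of \<theta>] c by (simp add: inner_P field_simps)
  then have "Complex (a / c) (b / c) \<in> R" by (simp add: R_def)
  then show ?thesis by blast
qed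

lemma zero_in_C_if_no_interior:
  assumes "R \<noteq> {}" "interior R = {}"
  shows "0 \<in> C" "0 \<notin> rel_interior C"
proof -
  show 0: "0 \<in> C"
  proof (rule ccontr)
    assume "0 \<notin> C"
    from separating_hyperplane_closed_point[OF convex_C compact_imp_closed[OF compact_C] this]
    obtain w d where w: "inner w 0 < d" "\<And>x. x \<in> C \<Longrightarrow> d < inner w x" by blast
    obtain c a b where cab: "w = (c, a, b)" by (cases w)
    have d: "d > 0" using w(1) by simp
    have nn: "d < inner (c, a, b) (P \<theta>)" for \<theta> using w(2)[OF P_in_C] cab by simp
    have ne: "(c, a, b) \<noteq> (0, 0, 0)" using nn[of 0] d by (auto simp: inner_P)
    have "0 \<le> inner (c, a, b) (P \<theta>)" for \<theta> using nn[of \<theta>] d by simp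
    then have c: "c > 0" by (rule supporting_coeff_pos[OF ne])
    let ?\<mu> = "Complex (a / c) (b / c)"
    \<comment> \<open>The gap \<open>d\<close> of a strict separation becomes, after scaling by
      \<open>c\<close>, a uniform slack in all half-planes, hence the radius of a ball.\<close>
    have "ball ?\<mu> (d / c) \<subseteq> R"
    proof
      fix \<mu> assume "\<mu> \<in> ball ?\<mu> (d / c)"
      then have dist: "cmod (\<mu> - ?\<mu>) < d / c" by (simp add: dist_norm norm_minus_commute)
      have "Re \<mu> * cos \<theta> + Im \<mu> * sin \<theta> \<le> f \<theta>" for \<theta>
      proof -
        have "Re ((\<mu> - ?\<mu>) * cis (- \<theta>)) \<le> cmod ((\<mu> - ?\<mu>) * cis (- \<theta>))" by (rule complex_Re_le_cmod)
        then have "(Re \<mu> - a / c) * cos \<theta> + (Im \<mu> - b / c) * sin \<theta> \<le> cmod (\<mu> - ?\<mu>)"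
          by (simp add: norm_mult)
        moreover have "a / c * cos \<theta> + b / c * sin \<theta> + d / c < f \<theta>"
          using nn[of \<theta>] c by (simp add: inner_P field_simps)
        ultimately show ?thesis using dist by (simp add: left_diff_distrib)
      qed
      then show "\<mu> \<in> R" by (simp add: R_def)
    qed
    moreover have "?\<mu> \<in> ball ?\<mu> (d / c)" using c d by simp
    ultimately have "?\<mu> \<in> interior R" by (meson interior_maximal open_ball subsetD)
    then show False using assms by simp
  qed
  obtain \<mu> where \<mu>: "\<mu> \<in> R" using assms by blast
  let ?w = "(1, Re \<mu>, Im \<mu>)"
  show "0 \<notin> rel_interior C"
  proof
    \<comment> \<open>The functional of a point of \<open>R\<close> is nonnegative on
      \<open>C\<close>; with the origin in the relative interior it would vanish on the whole
      curve.\<close>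
    assume "0 \<in> rel_interior C"
    then have "inner ?w (P \<theta>) = 0" for \<theta>
      using linear_zero_on_rel_interior[OF convex_C _ R_inner_nonneg[OF \<mu>] P_in_C] by blast
    then show False using nonplanar[of 1 "Re \<mu>" "Im \<mu>"] by (simp add: inner_P)
  qed
qed

lemma interior_R_empty:
  assumes "0 \<in> C"
  shows "interior R = {}"
proof (rule ccontr)
  assume "interior R \<noteq> {}"
  then obtain \<mu> e where e: "e > 0" "cball \<mu> e \<subseteq> R"
    using mem_interior_cball by (metis ex_in_conv)
  have "e \<le> inner (1, Re \<mu>, Im \<mu>) (P \<theta>)" for \<theta>
  proof -
    \<comment> \<open>The point of the disc that lies farthest in direction \<open>\<theta>\<close>;
      its half-plane inequality leaves a margin \<open>e\<close> at the centre.\<close>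
    have "\<mu> + of_real e * cis \<theta> \<in> cball \<mu> e" using e(1) by (simp add: dist_norm norm_mult)
    then have "\<mu> + of_real e * cis \<theta> \<in> R" using e(2) by blast
    then have "(Re \<mu> + e * cos \<theta>) * cos \<theta> + (Im \<mu> + e * sin \<theta>) * sin \<theta> \<le> f \<theta>"
      by (simp add: R_def)
    moreover have "(Re \<mu> + e * cos \<theta>) * cos \<theta> + (Im \<mu> + e * sin \<theta>) * sin \<theta> =
        Re \<mu> * cos \<theta> + Im \<mu> * sin \<theta> + e * ((sin \<theta>)\<^sup>2 + (cos \<theta>)\<^sup>2)"
      by (simp only: power2_eq_square distrib_left distrib_right mult.assoc)
    ultimately have "Re \<mu> * cos \<theta> + Im \<mu> * sin \<theta> + e \<le> f \<theta>" by simp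
    then show ?thesis by (simp add: inner_P)
  qed
  from inner_C_ge[OF this assms] have "e \<le> inner (1 :: real, Re \<mu>, Im \<mu>) 0" .
  then show False using e by simp
qed

lemma aff_dim_R_iff: "aff_dim R \<in> {0, 1} \<longleftrightarrow> R \<noteq> {} \<and> interior R = {}"
proof -
  have "aff_dim R \<le> 2" using aff_dim_le_DIM[of R] by simp
  moreover have "aff_dim R = 2 \<longleftrightarrow> R \<noteq> {} \<and> interior R \<noteq> {}"
  proof
    assume 2: "aff_dim R = 2"
    then have "affine hull R = UNIV" using aff_dim_eq_full[of R] by simp
    then have "rel_interior R = interior R" by (rule rel_interior_interior)
    moreover have "R \<noteq> {}" using 2 by auto
    ultimately show "R \<noteq> {} \<and> interior R \<noteq> {}" using rel_interior_eq_empty[OF convex_R] by auto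
  next
    assume "R \<noteq> {} \<and> interior R \<noteq> {}"
    then show "aff_dim R = 2" using aff_dim_nonempty_interior[of R] by simp
  qed
  moreover have "aff_dim R = -1 \<longleftrightarrow> R = {}" by (rule aff_dim_empty[symmetric])
  moreover have "aff_dim R \<ge> -1" by (rule aff_dim_geq)
  ultimately show ?thesis by auto
qed

definition good_face :: "(real \<times> real \<times> real) set \<Rightarrow> bool" where
  "good_face F \<longleftrightarrow> F face_of C \<and> 0 \<in> rel_interior F \<and> 1 \<le> aff_dim F \<and> aff_dim F \<le> 2"

lemma good_faceD:
  assumes "good_face F"
  shows "0 \<in> C" "0 \<notin> rel_interior C"
proof -
  have F: "F face_of C" "0 \<in> rel_interior F" "aff_dim F \<le> 2" using assms by (auto simp: good_face_def)
  show 0: "0 \<in> C" using F rel_interior_subset face_of_imp_subset by blast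
  have "F \<noteq> C" using full_dim(1)[OF 0] F(3) by auto
  then show "0 \<notin> rel_interior C" using face_of_disjoint_rel_interior[OF F(1)] F(2) rel_interior_subset by blast
qed

text \<open>A zero-dimensional face would make the origin an extreme point of \<open>C\<close>,
  hence a point of the curve, whose last two coordinates have squares summing to \<open>1\<close>. A
  proper face of the three-dimensional \<open>C\<close> has dimension at most
  \<open>2\<close>.\<close>

lemma exists_good_face:
  assumes "0 \<in> C" "0 \<notin> rel_interior C"
  shows "\<exists>F. good_face F"
proof -
  from exists_face_rel_interior[OF convex_C assms(1)] obtain F where F: "F face_of C" "0 \<in> rel_interior F" .
  have "F \<noteq> C" using F assms by auto
  then have "aff_dim F \<le> 2" using face_of_aff_dim_lt[OF convex_C F(1)] full_dim(1)[OF assms(1)] by simp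
  moreover have "aff_dim F \<ge> 1"
  proof (rule ccontr)
    have 0: "0 \<in> F" using F(2) rel_interior_subset by blast
    assume "\<not> aff_dim F \<ge> 1"
    moreover have "aff_dim F \<noteq> -1" using 0 aff_dim_empty by blast
    ultimately have "aff_dim F = 0" using aff_dim_geq[of F] by linarith
    then obtain x where "F = {x}" using aff_dim_sing aff_dim_eq_0 by blast
    then have "0 extreme_point_of C" using F(1) 0 face_of_singleton by auto
    then have "0 \<in> range P" unfolding C_def by (rule extreme_point_of_convex_hull)
    then obtain \<theta> where "0 = P \<theta>" by (rule rangeE)
    then have "cos \<theta> = 0" "sin \<theta> = 0" by (auto simp: P_def zero_prod_def)
    then show False using sin_cos_squared_add[of \<theta>] by simp
  qed
  ultimately show ?thesis using F unfolding good_face_def by blast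
qed

theorem dim_iff_good_face: "aff_dim R \<in> {0, 1} \<longleftrightarrow> (\<exists>F. good_face F)"
  unfolding aff_dim_R_iff
  using zero_in_C_if_no_interior exists_good_face good_faceD R_nonempty interior_R_empty by metis

text \<open>The end points of the segment are extreme in \<open>C\<close> and so lie on the curve;
  the origin is a convex combination of them.\<close>

lemma good_face_segment:
  assumes F: "good_face F" and 1: "aff_dim F = 1"
  obtains \<theta> where "f (\<theta> + pi) = - f \<theta>" "F = convex hull {P \<theta>, P (\<theta> + pi)}"
proof -
  have face: "F face_of C" and 0: "0 \<in> rel_interior F" using F by (auto simp: good_face_def)
  have "F \<noteq> {}" using 1 by auto
  moreover have "collinear F" using 1 by (simp add: collinear_aff_dim)
  ultimately obtain p q where pq: "F = closed_segment p q"
    using compact_convex_collinear_segment face_of_imp_compact[OF convex_C compact_C face] face_of_imp_convex[OF face]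
    by metis
  have "p extreme_point_of F" "q extreme_point_of F" by (auto simp: pq extreme_point_of_segment)
  then have "p extreme_point_of C" "q extreme_point_of C" using extreme_point_of_face[OF face] by auto
  then have "p \<in> range P" "q \<in> range P" unfolding C_def by (auto intro: extreme_point_of_convex_hull)
  then obtain \<theta> \<phi> where p: "p = P \<theta>" and q: "q = P \<phi>" by blast
  have "p \<noteq> q" using 1 pq by auto
  then have "0 \<in> open_segment p q" using 0 by (simp add: pq rel_interior_closed_segment)
  then obtain u where u: "0 < u" "u < 1" "0 = (1 - u) *\<^sub>R p + u *\<^sub>R q" by (auto simp: in_segment)
  then have eqs: "(1 - u) * f \<theta> = - (u * f \<phi>)" "(1 - u) * cos \<theta> = - (u * cos \<phi>)" "(1 - u) * sin \<theta> = - (u * sin \<phi>)"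
    by (auto simp: p q P_def zero_prod_def eq_neg_iff_add_eq_0)
  \<comment> \<open>The last two coordinates of curve points are unit vectors, so their cancellation
    forces equal weights and antipodal directions.\<close>
  have "(1 - u)\<^sup>2 = ((1 - u) * cos \<theta>)\<^sup>2 + ((1 - u) * sin \<theta>)\<^sup>2"
    by (simp add: power_mult_distrib flip: distrib_left)
  also have "\<dots> = u\<^sup>2" unfolding eqs by (simp add: power_mult_distrib flip: distrib_left)
  finally have "1 - u = u" using u power2_eq_iff_nonneg[of "1 - u" u] by simp
  then have u: "u = 1/2" by simp
  have fc: "f \<phi> = - f \<theta>" "cos \<phi> = - cos \<theta>" "sin \<phi> = - sin \<theta>" using eqs unfolding u by auto
  then have "f \<phi> = f (\<theta> + pi)" by (intro cong) auto
  then have "q = P (\<theta> + pi)" "f (\<theta> + pi) = - f \<theta>" using fc by (auto simp: q P_def)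
  then show thesis using that pq p segment_convex_hull by metis
qed

text \<open>Every point of \<open>R\<close> yields a plane containing \<open>F\<close>, because its
  functional is nonnegative on \<open>F\<close> and the origin is in the relative interior. Two
  different planes meet in a line, too small for \<open>F\<close>; so \<open>R\<close> has at most
  one point, and it is nonempty.\<close>

lemma good_face_plane:
  assumes F: "good_face F" and 2: "aff_dim F = 2" and plane: "F \<subseteq> {(t, x, y). t + a * x + b * y = 0}"
  shows "R = {Complex a b}"
proof -
  have face: "F face_of C" and 0: "0 \<in> rel_interior F" using F by (auto simp: good_face_def)
  have "\<mu> = Complex a b" if \<mu>: "\<mu> \<in> R" for \<mu>
  proof (rule ccontr)
    assume ne: "\<mu> \<noteq> Complex a b"
    define \<alpha> where "\<alpha> = Re \<mu> - a"
    define \<beta> where "\<beta> = Im \<mu> - b"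
    have ab: "\<alpha>\<^sup>2 + \<beta>\<^sup>2 \<noteq> 0" using ne by (auto simp: \<alpha>_def \<beta>_def complex_eq_iff sum_power2_eq_zero_iff)
    \<comment> \<open>The cross product of \<open>(1, a, b)\<close> and
      \<open>(0, \<alpha>, \<beta>)\<close>, that is, the direction of the line in which the planes
      of \<open>Complex a b\<close> and \<open>\<mu>\<close> meet.\<close>
    let ?u = "(a * \<beta> - b * \<alpha>, - \<beta>, \<alpha>)"
    have "F \<subseteq> span {?u}"
    proof
      fix p assume p: "p \<in> F"
      obtain t x y where txy: "p = (t, x, y)" by (cases p)
      have "inner (1, Re \<mu>, Im \<mu>) p = 0"
        by (rule linear_zero_on_rel_interior[OF face_of_imp_convex[OF face] 0 R_inner_nonneg[OF \<mu>] p])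
          (use face_of_imp_subset[OF face] in auto)
      then have "t + Re \<mu> * x + Im \<mu> * y = 0" by (simp add: txy inner_Pair)
      moreover have t: "t + a * x + b * y = 0" using plane p txy by auto
      ultimately have xy: "\<alpha> * x + \<beta> * y = 0" by (simp add: \<alpha>_def \<beta>_def algebra_simps)
      define s where "s = (\<alpha> * y - \<beta> * x) / (\<alpha>\<^sup>2 + \<beta>\<^sup>2)"
      have "(\<alpha>\<^sup>2 + \<beta>\<^sup>2) * x = - \<beta> * (\<alpha> * y - \<beta> * x) + \<alpha> * (\<alpha> * x + \<beta> * y)"
        "(\<alpha>\<^sup>2 + \<beta>\<^sup>2) * y = \<alpha> * (\<alpha> * y - \<beta> * x) + \<beta> * (\<alpha> * x + \<beta> * y)"
        by (simp_all add: algebra_simps power2_eq_square)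
      then have "x = s * (- \<beta>)" "y = s * \<alpha>" using ab unfolding xy s_def by (simp_all add: field_simps)
      moreover from this have "t = s * (a * \<beta> - b * \<alpha>)" using t by (simp add: algebra_simps)
      ultimately have "p = s *\<^sub>R ?u" by (simp add: txy)
      then show "p \<in> span {?u}" using span_scale[OF span_base[of ?u "{?u}"]] by blast
    qed
    then have "dim F \<le> 1"
      using dim_le_card[of F "{?u}"] by simp
    moreover have "0 \<in> F" using 0 rel_interior_subset by blast
    then have "0 \<in> affine hull F" by (rule hull_inc)
    ultimately show False using aff_dim_zero[of F] 2 by simp
  qed
  then show ?thesis using R_nonempty[OF good_faceD[OF F]] by blast
qed

end

theorem proposition6p1:
  fixes A :: "complex mat" and n k :: nat
  assumes "A \<in> carrier_mat n n"
    and "1 \<le> k" and "real k \<le> (real n + 1) / 2"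
    and "\<not> (\<exists>c a b :: real. (c, a, b) \<noteq> (0, 0, 0) \<and>
               O_set k A \<subseteq> {(t, x, y). c * t + a * x + b * y = 0})"
  shows "(aff_dim (rank_num_range k A) \<in> {0, 1} \<longleftrightarrow>
            (\<exists>F. F face_of convex hull O_set k A \<and> (0, 0, 0) \<in> rel_interior F \<and>
                 1 \<le> aff_dim F \<and> aff_dim F \<le> 2)) \<and>
         (\<forall>F. F face_of convex hull O_set k A \<and> (0, 0, 0) \<in> rel_interior F \<and>
              1 \<le> aff_dim F \<and> aff_dim F \<le> 2 \<longrightarrow>
            (aff_dim F = 1 \<longrightarrow>
               (\<exists>p q. antipodal_points k A p q \<and> F = convex hull {p, q})) \<and>
            (aff_dim F = 2 \<longrightarrow>
               (\<forall>a b :: real. F \<subseteq> {(t, x, y). t + a * x + b * y = 0} \<longrightarrow>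
                  rank_num_range k A = {Complex a b})))"
proof -
  note A = assms(1) and k = assms(2)
  have k2: "2 * k \<le> n + 1" using assms(3) by simp
  then have kn: "k \<le> n" "k \<le> n - k + 1" "n - k + 1 \<le> n" using k by auto
  let ?f = "eig_fun k A"
  have anti: "?f (\<theta> + pi) = - eig_fun (n - k + 1) A \<theta>" for \<theta>
    by (rule eig_fun_antipodal[OF A k kn(1)])
  interpret S: support_curve ?f
  proof
    show "continuous_on UNIV ?f" by (rule continuous_on_eig_fun[OF A k kn(1)])
    show "cos \<phi> = cos \<theta> \<Longrightarrow> sin \<phi> = sin \<theta> \<Longrightarrow> ?f \<phi> = ?f \<theta>" for \<phi> \<theta> by (rule eig_fun_cong)
    \<comment> \<open>The sum is the \<open>k\<close>-th minus the \<open>(n - k + 1)\<close>-th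
      eigenvalue, and \<open>k \<le> n - k + 1\<close>.\<close>
    show "0 \<le> ?f \<theta> + ?f (\<theta> + pi)" for \<theta>
      using eig_fun_antimono[OF A k kn(2,3), of \<theta>] by (simp add: anti)
    fix c a b :: real assume "(c, a, b) \<noteq> (0, 0, 0)"
    then have "\<not> O_set k A \<subseteq> {(t, x, y). c * t + a * x + b * y = 0}" using assms(4) by metis
    then show "\<exists>\<theta>. c * ?f \<theta> - a * cos \<theta> - b * sin \<theta> \<noteq> 0"
      unfolding O_set_def O_point_def by force
  qed
  have P: "S.P = O_point k A" by (rule ext) (simp add: S.P_def O_point_def)
  have C: "convex hull O_set k A = S.C" unfolding S.C_def S.range_P by (simp add: O_set_def P)
  have R: "rank_num_range k A = S.R" unfolding rank_num_range_eq[OF A k kn(1)] S.R_def ..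
  have zero: "(0, 0, 0) = (0 :: real \<times> real \<times> real)" by (simp add: zero_prod_def)
  have antipodal: "\<exists>p q. antipodal_points k A p q \<and> F = convex hull {p, q}"
    if "S.good_face F" "aff_dim F = 1" for F
  proof -
    from S.good_face_segment[OF that] obtain \<theta> where
      \<theta>: "?f (\<theta> + pi) = - ?f \<theta>" "F = convex hull {O_point k A \<theta>, O_point k A (\<theta> + pi)}" unfolding P .
    then have "?f \<theta> = eig_fun (dim_row A - k + 1) A \<theta>" using anti[of \<theta>] A by simp
    then show ?thesis using \<theta>(2) unfolding antipodal_points_def by blast
  qed
  show ?thesis
    unfolding C R zero S.good_face_def[symmetric] S.dim_iff_good_face
    using antipodal S.good_face_plane by blast
qed

end
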